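(* Let $\xi$ be a transcendental complex number, let $r$ be a non-zero rational number, and let $\beta,\sigma_1,\sigma_2,\tau,\nu$ be non-negative real numbers with $\beta>1$, $\sigma_1\le 3\sigma_2$, $(1/3)\sigma_1+\sigma_2+\tau<1$ and $\nu>1+\beta-(1/3)\sigma_1-\sigma_2-\tau$. Then there are arbitrarily large values of $n$ for which there exists no non-zero polynomial $P\in\mathbb{Z}[T]$ of degree at most $n$ and height at most $\exp(n^\beta)$ with $\max\{|P^{[j]}(i_1\xi+i_2r)| : 1\le i_1\le n^{\sigma_1},\ 1\le i_2\le n^{\sigma_2},\ 0\le j\le n^\tau\}\le\exp(-n^\nu)$, where $i_1,i_2,j$ range over integers.
   Context: For non-zero $P\in\mathbb{Q}[T]$: $\|P\|$ is the maximum absolute value of its coefficients, $\mathrm{cont}(P)$ the positive rational $c$ with $c^{-1}P$ primitive in $\mathbb{Z}[T]$, and $H(P)=\|P\|/\mathrm{cont}(P)$. $P^{[j]}$ is the $j$-th derivative divided by $j!$. *)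

theory Defs
  imports "HOL-Computational_Algebra.Computational_Algebra"
begin

definition max_coeff :: "rat poly \<Rightarrow> rat"
  where "max_coeff P = Max ((\<lambda>i. \<bar>coeff P i\<bar>) ` {..degree P})"

text \<open>An integer polynomial is primitive if its (library) content is 1.  The definition
  is meaningful only for non-zero \<open>P\<close>; see \<open>ex1_rat_content\<close> below.\<close>

definition rat_content :: "rat poly \<Rightarrow> rat"
  where "rat_content P =
    (THE c. 0 < c \<and> (\<exists>Q :: int poly. content Q = 1 \<and> smult (inverse c) P = map_poly of_int Q))"

definition poly_height :: "rat poly \<Rightarrow> rat"
  where "poly_height P = max_coeff P / rat_content P"

definition divided_pderiv :: "nat \<Rightarrow> 'a::field_char_0 poly \<Rightarrow> 'a poly"
  where "divided_pderiv j P = smult (1 / fact j) ((pderiv ^^ j) P)"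

lemma smult_inverse_eq_iff:
  fixes c :: rat
  assumes "c \<noteq> 0"
  shows "smult (inverse c) P = Q \<longleftrightarrow> P = smult c Q"
  using assms by auto

lemma ex1_rat_content:
  fixes P :: "rat poly"
  assumes "P \<noteq> 0"
  shows "\<exists>!c. 0 < c \<and> (\<exists>Q :: int poly. content Q = 1 \<and> smult (inverse c) P = map_poly of_int Q)"
proof -
  have eq: "map_poly of_int (smult k Q) = smult (of_int k) (map_poly of_int Q :: rat poly)"
    for k Q by (rule poly_eqI) (simp add: coeff_map_poly)
  show ?thesis
  proof (rule ex_ex1I)
    define b :: int where "b = (\<Prod>i\<le>degree P. snd (quotient_of (coeff P i)))"
    have b: "b > 0" unfolding b_def by (intro prod_pos) (simp add: quotient_of_denom_pos')
    have "\<exists>m. of_int b * coeff P i = of_int m" for i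
    proof (cases "i \<le> degree P")
      case True
      obtain u v where uv: "quotient_of (coeff P i) = (u, v)" by fastforce
      have "v dvd b" unfolding b_def using True uv
        by (metis atMost_iff dvd_prodI finite_atMost snd_conv)
      then obtain w where w: "b = v * w" by blast
      have "v \<noteq> 0" using quotient_of_denom_pos[OF uv] by simp
      then have "of_int b * coeff P i = of_int (w * u)"
        by (simp add: quotient_of_div[OF uv] w)
      then show ?thesis ..
    qed (auto simp: coeff_eq_0 intro: exI[of _ 0])
    then obtain m where m: "of_int b * coeff P i = of_int (m i)" for i by metis
    define R where "R = map_poly (\<lambda>x. floor (of_int b * x)) P"
    have R: "map_poly of_int R = smult (of_int b) P"
      by (rule poly_eqI) (simp add: R_def coeff_map_poly m)
    with assms b have "R \<noteq> 0" by force
    define c :: rat where "c = of_int (content R) / of_int b"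
    have "content R > 0" using \<open>R \<noteq> 0\<close>
      by (metis abs_ge_zero content_eq_zero_iff normalize_content normalize_int_def order_le_less)
    with b have c: "c > 0" by (simp add: c_def)
    have "smult (of_int b) P = smult (of_int (content R)) (map_poly of_int (primitive_part R))"
      using R eq[of "content R" "primitive_part R"] by simp
    then have "smult (1 / of_int b) (smult (of_int b) P) =
      smult (1 / of_int b) (smult (of_int (content R)) (map_poly of_int (primitive_part R)))" by simp
    then have "P = smult c (map_poly of_int (primitive_part R))"
      using b by (simp add: c_def)
    moreover have "content (primitive_part R) = 1"
      using \<open>R \<noteq> 0\<close> by simp
    ultimately show "\<exists>c. 0 < c \<and>
        (\<exists>Q :: int poly. content Q = 1 \<and> smult (inverse c) P = map_poly of_int Q)"
      using c smult_inverse_eq_iff by (metis less_irrefl)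
  next
    fix c d :: rat
    assume c: "0 < c \<and> (\<exists>Q :: int poly. content Q = 1 \<and> smult (inverse c) P = map_poly of_int Q)"
      and d: "0 < d \<and> (\<exists>Q :: int poly. content Q = 1 \<and> smult (inverse d) P = map_poly of_int Q)"
    then obtain Q S :: "int poly" where Q: "content Q = 1" "P = smult c (map_poly of_int Q)"
      and S: "content S = 1" "P = smult d (map_poly of_int S)"
      by (metis less_irrefl smult_inverse_eq_iff)
    obtain u v where uv: "quotient_of c = (u, v)" by fastforce
    obtain x y where xy: "quotient_of d = (x, y)" by fastforce
    have v: "v > 0" "c = of_int u / of_int v"
      using uv quotient_of_denom_pos quotient_of_div by auto
    have y: "y > 0" "d = of_int x / of_int y"
      using xy quotient_of_denom_pos quotient_of_div by auto
    have pos: "u > 0" "x > 0"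
      using c d v y by (auto simp: zero_less_divide_iff)
    have "map_poly of_int (smult (u * y) Q) = smult (of_int v * of_int y) P"
      using v y by (subst Q(2)) (simp add: eq mult.commute)
    also have "\<dots> = (map_poly of_int (smult (x * v) S) :: rat poly)"
      using v y by (subst S(2)) (simp add: eq mult.commute)
    finally have "smult (u * y) Q = smult (x * v) S"
      by (auto simp: poly_eq_iff coeff_map_poly simp flip: of_int_mult)
    then have "content (smult (u * y) Q) = content (smult (x * v) S)" by simp
    then have "u * y = x * v"
      using Q S pos v y by (simp add: abs_mult)
    then show "c = d" using v y by (simp add: frac_eq_eq flip: of_int_mult)
  qed
qed

end

theory Submission
  imports
    Defs
    "HOL-Complex_Analysis.Cauchy_Integral_Formula"
    "HOL-Real_Asymp.Real_Asymp"
    "Subresultants.Subresultant_Gcd"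
begin

text \<open>
  After rescaling one may take \<open>r = 1\<close>. Suppose a polynomial \<open>P\<close> as described exists for every large \<open>n\<close>,
  and put \<open>a = \<sigma>\<^sub>1 / 3\<close>. Let \<open>S\<close> be the product of the dilates \<open>P(i T + j)\<close> with \<open>i \<le> n^a\<close> and \<open>j\<close> up to
  about \<open>n^\<sigma>\<^sub>2\<close>. It is very small, to high order, near each point \<open>k \<xi> + l\<close> with \<open>k \<le> n^{2a}\<close> and \<open>l\<close> up to
  about \<open>n^{\<sigma>\<^sub>2 - a}\<close>, so its roots have a large logarithmic potential there. Resultants and
  discriminants of integer polynomials are nonzero integers, which bounds the mutual energy of the roots;
  hence roots of small multiplicity cannot produce that potential at every point, and some irreducible
  factor of large multiplicity has a large potential at one of them. Large multiplicity in \<open>S\<close> means that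
  many dilates of this factor divide \<open>P\<close>, so its degree and height are small.
  Pulled back to \<open>\<xi>\<close> these factors contradict Gelfond's criterion. If the points \<open>k \<xi> + l\<close> are not well
  separated, a linear polynomial is small at \<open>\<xi>\<close> and takes the place of the factor.\<close>

section \<open>Resultants and roots\<close>

hide_const (open) Module.smult Henstock_Kurzweil_Integration.content

text \<open>The exponent \<sigma>1 / 3 balances two counts. With dilation ratios up to n^a there are
  about n^(a + \<sigma>2) dilates, and the points may use about n^(\<sigma>1 - a) values of k and
  n^(\<sigma>2 - a) of l. The energy inequality needs (number of points) * n^\<tau> * n^\<nu> to
  exceed n^(1 + \<beta>), while the multiplicity forced on a factor, which divides its degree and
  height, is of the order (number of dilates) * n^\<tau>. Both numbers equal n^(a + \<sigma>2) when
  \<sigma>1 = 3 a, and \<sigma>1 \<le> 3 \<sigma>2 keeps \<sigma>2 - a non-negative. Derivatives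
  enter only through a radius: P is about exp(- n^\<nu>) on discs of radius exp(- n^(\<nu> -
  \<tau>)), so one root contributes at most about n^(\<nu> - \<tau>) to a truncated potential, and a
  large potential needs many roots. The obstacle is that multiplicity in the product of dilates says
  nothing about P if one prime factor of P can serve several dilates.
  \<open>conjugate_affine_images\<close> excludes this, apart from a rational root, where the factor
  of the product is itself at most linear and of small height.\<close>

lemma det_vandermonde_nonzero:
  fixes as :: "'a :: idom list"
  assumes "distinct as" and d: "length as = d"
  shows "Determinant.det (mat d d (\<lambda>(i, k). as ! k ^ (d - 1 - i))) \<noteq> 0"
proof
  let ?V = "mat d d (\<lambda>(i, k). as ! k ^ (d - 1 - i))"
  have V: "?V \<in> carrier_mat d d" by simp
  assume "Determinant.det ?V = 0"
  then have "Determinant.det (transpose_mat ?V) = 0" using det_transpose[OF V] by metis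
  then obtain v where v: "v \<in> carrier_vec d" "v \<noteq> 0\<^sub>v d" "transpose_mat ?V *\<^sub>v v = 0\<^sub>v d"
    using det_0_iff_vec_prod_zero[of "transpose_mat ?V" d] by auto
  \<comment> \<open>A kernel vector of the transpose is the coefficient vector of a polynomial of
    degree less than d with d distinct roots.\<close>
  define G where "G = (\<Sum>j<d. monom (vec_index v j) (d - 1 - j))"
  have root: "poly G (as ! k) = 0" if "k < d" for k
  proof -
    have "0 = vec_index (transpose_mat ?V *\<^sub>v v) k" using v(3) that by simp
    also have "\<dots> = (\<Sum>j<d. as ! k ^ (d - 1 - j) * vec_index v j)"
      using that v(1) by (simp add: scalar_prod_def atLeast0LessThan)
    also have "\<dots> = poly G (as ! k)"
      by (simp add: G_def poly_sum poly_monom mult.commute)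
    finally show ?thesis by simp
  qed
  obtain j0 where j0: "j0 < d" "vec_index v j0 \<noteq> 0"
    using v(1,2) by (metis carrier_vecD dim_vec eq_vecI index_zero_vec(1) zero_carrier_vec)
  have "coeff G (d - 1 - j0) = (\<Sum>j<d. if j = j0 then vec_index v j else 0)"
    unfolding G_def coeff_sum using j0(1) by (intro sum.cong) auto
  also have "\<dots> = vec_index v j0" using j0 by simp
  finally have "G \<noteq> 0" using j0 by auto
  have "degree G < d" unfolding G_def
    using j0(1) by (intro degree_sum_less) (auto intro: le_less_trans[OF degree_monom_le])
  moreover have "d \<le> card {x. poly G x = 0}"
  proof -
    have "set as \<subseteq> {x. poly G x = 0}" using root d by (auto simp: in_set_conv_nth)
    then have "card (set as) \<le> card {x. poly G x = 0}"
      using \<open>G \<noteq> 0\<close> by (intro card_mono poly_roots_finite)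
    then show ?thesis using assms distinct_card by metis
  qed
  ultimately show False using card_poly_roots_bound[OF \<open>G \<noteq> 0\<close>] by linarith
qed

text \<open>With the rows of the Sylvester matrix read as polynomials, multiplying the matrix by the
  column of powers of a number evaluates every row at that number.\<close>

definition sylvester_row :: "'a :: comm_ring_1 poly \<Rightarrow> 'a poly \<Rightarrow> nat \<Rightarrow> 'a poly" where
  "sylvester_row A B i = (if i < degree B then monom 1 (degree B - 1 - i) * A
     else monom 1 (degree A + degree B - 1 - i) * B)"

lemma sylvester_index_row:
  fixes A B :: "'a :: comm_ring_1 poly"
  assumes i: "i < degree A + degree B" and j: "j < degree A + degree B"
  shows "sylvester_mat A B $$ (i, j) = coeff (sylvester_row A B i) (degree A + degree B - 1 - j)"
proof -
  define N where "N = degree A + degree B"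
  \<comment> \<open>Accounts for the shift by one between the exponents in
    \<open>sylvester_index_mat2\<close> and those of \<open>sylvester_row\<close>.\<close>
  have *: "coeff (monom 1 (Suc k) * q) (N - j) = coeff (monom 1 k * q) (N - 1 - j)" for k and q :: "'a poly"
  proof -
    have "monom 1 (Suc k) * q = pCons 0 (monom 1 k * q)" by (simp add: monom_Suc)
    moreover have "N - j = Suc (N - 1 - j)" using j by (simp add: N_def)
    ultimately show ?thesis by (metis coeff_pCons_Suc)
  qed
  show ?thesis
  proof (cases "i < degree B")
    case True
    then have "degree B - i = Suc (degree B - 1 - i)" by simp
    with True i j show ?thesis
      by (subst sylvester_index_mat2) (simp_all add: sylvester_row_def N_def[symmetric] *)
  next
    case False
    then have "N - i = Suc (N - 1 - i)" using i by (simp add: N_def)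
    with False i j show ?thesis
      by (subst sylvester_index_mat2) (simp_all add: sylvester_row_def N_def[symmetric] *)
  qed
qed

lemma sylvester_row_eval:
  fixes A B :: "'a :: comm_ring_1 poly"
  assumes i: "i < degree A + degree B"
  shows "(\<Sum>j<degree A + degree B. coeff (sylvester_row A B i) (degree A + degree B - 1 - j) *
    a ^ (degree A + degree B - 1 - j)) = poly (sylvester_row A B i) a"
proof -
  define N where "N = degree A + degree B"
  have deg: "degree (sylvester_row A B i) < N"
  proof (cases "i < degree B")
    case True
    have "degree (sylvester_row A B i) \<le> degree (monom (1::'a) (degree B - 1 - i)) + degree A"
      unfolding sylvester_row_def using True by (simp add: degree_mult_le)
    with True show ?thesis unfolding N_def by (simp add: degree_monom_eq)
  next
    case False
    have "degree (sylvester_row A B i) \<le> degree (monom (1::'a) (N - 1 - i)) + degree B"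
      unfolding sylvester_row_def N_def using False by (simp add: degree_mult_le)
    with False i show ?thesis unfolding N_def by (simp add: degree_monom_eq)
  qed
  have "(\<Sum>j<N. coeff (sylvester_row A B i) (N - 1 - j) * a ^ (N - 1 - j)) =
      (\<Sum>j<N. coeff (sylvester_row A B i) j * a ^ j)"
    using sum.nat_diff_reindex[of "\<lambda>j. coeff (sylvester_row A B i) j * a ^ j" N] by simp
  also have "\<dots> = (\<Sum>j\<le>degree (sylvester_row A B i). coeff (sylvester_row A B i) j * a ^ j)"
    using deg by (intro sum.mono_neutral_right) (auto simp: coeff_eq_0)
  finally show ?thesis by (simp add: poly_altdef N_def)
qed

text \<open>The Sylvester matrix is multiplied by a unit block bordered by the powers of the roots
  of A. The last columns then evaluate the rows at these roots: rows from A vanish, rows from B give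
  powers times B-values. Both sides are block triangular, and the Vandermonde determinant cancels.
  Distinct roots suffice, since the formula is applied to irreducible polynomials.\<close>

lemma resultant_eq_prod_roots:
  fixes A B :: "'a :: idom poly"
  assumes "distinct as" and d: "length as = degree A" and root: "\<And>a. a \<in> set as \<Longrightarrow> poly A a = 0"
  shows "resultant A B = lead_coeff A ^ degree B * (\<Prod>k<degree A. poly B (as ! k))"
proof -
  define d where "d = degree A"
  define e where "e = degree B"
  define N where "N = d + e"
  define G where "G = sylvester_row A B"
  have G_eq: "G i = (if i < e then monom 1 (e - 1 - i) * A else monom 1 (N - 1 - i) * B)" for i
    unfolding G_def sylvester_row_def N_def d_def e_def ..
  let ?S = "sylvester_mat A B"
  define V where "V = mat d d (\<lambda>(i, k). as ! k ^ (d - 1 - i))"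
  define W where "W = four_block_mat (1\<^sub>m e) (mat e d (\<lambda>(i, k). as ! k ^ (N - 1 - i))) (0\<^sub>m d e) V"
  define U where "U = mat e e (\<lambda>(i, k). coeff (G i) (N - 1 - k))"
  define C where "C = mat d e (\<lambda>(i, k). coeff (G (e + i)) (N - 1 - k))"
  define R where "R = mat d d (\<lambda>(i, k). if i = k then poly B (as ! k) else 0)"
  have S_dim: "?S \<in> carrier_mat N N" unfolding N_def d_def e_def by (rule sylvester_carrier_mat)
  have [simp]: "length as = d" by (simp add: d d_def)
  have S_ix: "?S $$ (i, j) = coeff (G i) (N - 1 - j)" if "i < N" "j < N" for i j
    using sylvester_index_row that unfolding G_def N_def d_def e_def by blast
  have W_dim: "W \<in> carrier_mat N N" unfolding W_def V_def N_def by (auto simp: add.commute)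
  have ev: "(\<Sum>j<N. coeff (G i) (N - 1 - j) * a ^ (N - 1 - j)) = poly (G i) a" if "i < N" for i a
    using sylvester_row_eval that unfolding G_def N_def d_def e_def by blast
  have prod: "?S * W = four_block_mat U (0\<^sub>m e d) C (V * R)"
  proof (rule eq_matI)
    fix i k assume "i < dim_row (four_block_mat U (0\<^sub>m e d) C (V * R))"
      and "k < dim_col (four_block_mat U (0\<^sub>m e d) C (V * R))"
    then have i: "i < N" and k: "k < N" by (auto simp: U_def C_def V_def R_def N_def)
    have W_ix: "W $$ (j, k) = (if k < e then if j = k then 1 else 0 else as ! (k - e) ^ (N - 1 - j))"
      if "j < N" for j
      using that k unfolding W_def V_def N_def by auto
    have "(?S * W) $$ (i, k) = (\<Sum>j<N. coeff (G i) (N - 1 - j) * W $$ (j, k))"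
      using S_dim W_dim i k S_ix by (auto simp: scalar_prod_def atLeast0LessThan intro!: sum.cong)
    also have "\<dots> = (if k < e then coeff (G i) (N - 1 - k) else poly (G i) (as ! (k - e)))"
    proof (cases "k < e")
      case True
      have "(\<Sum>j<N. coeff (G i) (N - 1 - j) * W $$ (j, k)) = (\<Sum>j<N. if j = k then coeff (G i) (N - 1 - j) else 0)"
        using True by (intro sum.cong) (auto simp: W_ix)
      with True k show ?thesis by simp
    next
      case False
      then show ?thesis using ev[OF i, of "as ! (k - e)"] by (simp add: W_ix)
    qed
    also have "\<dots> = four_block_mat U (0\<^sub>m e d) C (V * R) $$ (i, k)"
    proof -
      have VR: "(V * R) $$ (i - e, k - e) = poly (G i) (as ! (k - e))" if "\<not> i < e" "\<not> k < e"
      proof -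
        have ik: "i - e < d" "k - e < d" using i k that by (auto simp: N_def)
        have "(V * R) $$ (i - e, k - e) = (\<Sum>j<d. if j = k - e then as ! j ^ (d - 1 - (i - e)) * poly B (as ! j) else 0)"
          using ik by (auto simp: V_def R_def scalar_prod_def atLeast0LessThan if_distrib cong: if_cong)
        also have "\<dots> = as ! (k - e) ^ (d - 1 - (i - e)) * poly B (as ! (k - e))" using ik by simp
        also have "d - 1 - (i - e) = N - 1 - i" using that by (simp add: N_def)
        finally show ?thesis using that by (simp add: G_eq poly_monom)
      qed
      have "poly (G i) (as ! (k - e)) = 0" if "i < e" "\<not> k < e"
        using that k root[of "as ! (k - e)"] by (simp add: G_eq N_def)
      then show ?thesis using i k VR by (auto simp: U_def C_def V_def R_def N_def)
    qed
    finally show "(?S * W) $$ (i, k) = four_block_mat U (0\<^sub>m e d) C (V * R) $$ (i, k)" .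
  qed (use S_dim W_dim in \<open>auto simp: U_def C_def V_def R_def N_def\<close>)
  have detW: "Determinant.det W = Determinant.det V"
    unfolding W_def by (subst det_four_block_mat_lower_left_zero) (auto simp: V_def)
  have detU: "Determinant.det U = lead_coeff A ^ e"
  proof -
    have "coeff (G i) (N - 1 - k) = 0" if "k < i" "i < e" for i k
      using that by (simp add: G_eq coeff_monom_mult N_def coeff_eq_0 d_def)
    then have "upper_triangular U" by (auto simp: U_def)
    then have "Determinant.det U = prod_list (diag_mat U)"
      by (rule det_upper_triangular[where n = e]) (simp add: U_def)
    also have "diag_mat U = replicate e (lead_coeff A)"
      by (rule nth_equalityI) (auto simp: diag_mat_def U_def G_eq coeff_monom_mult N_def d_def)
    finally show ?thesis by (simp add: prod_list_replicate)
  qed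
  have detR: "Determinant.det R = (\<Prod>k<d. poly B (as ! k))"
  proof -
    have "Determinant.det R = prod_list (diag_mat R)"
      by (rule det_upper_triangular[where n = d]) (auto simp: R_def)
    also have "\<dots> = (\<Prod>k<d. poly B (as ! k))"
      by (simp add: prod_list_diag_prod R_def atLeast0LessThan)
    finally show ?thesis .
  qed
  have "resultant A B * Determinant.det V = Determinant.det (?S * W)"
    using det_mult[OF S_dim W_dim] detW by (simp add: resultant_def)
  also have "\<dots> = Determinant.det U * Determinant.det (V * R)"
    unfolding prod by (rule det_four_block_mat_upper_right_zero) (auto simp: U_def C_def V_def R_def)
  also have "Determinant.det (V * R) = Determinant.det V * Determinant.det R"
    by (rule det_mult) (auto simp: V_def R_def)
  finally have "resultant A B * Determinant.det V = (lead_coeff A ^ e * (\<Prod>k<d. poly B (as ! k))) * Determinant.det V"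
    by (simp add: detU detR)
  moreover have "Determinant.det V \<noteq> 0"
    unfolding V_def using assms(1) by (intro det_vandermonde_nonzero) simp_all
  ultimately show ?thesis by (simp add: d_def e_def)
qed

text \<open>The powers of a common root form a kernel vector of the Sylvester matrix; it is nonzero
  because its last entry is 1.\<close>

lemma resultant_zero_if_common_root:
  fixes A B :: "'a :: idom poly"
  assumes A: "poly A z = 0" and B: "poly B z = 0" and "A \<noteq> 0"
  shows "resultant A B = 0"
proof -
  define N where "N = degree A + degree B"
  have "degree A \<noteq> 0"
  proof
    assume "degree A = 0"
    then obtain c where "A = [:c:]" by (rule degree_eq_zeroE)
    with A \<open>A \<noteq> 0\<close> show False by simp
  qed
  then have N: "0 < N" by (simp add: N_def)
  let ?S = "sylvester_mat A B"
  let ?v = "vec N (\<lambda>j. z ^ (N - 1 - j))"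
  have S: "?S \<in> carrier_mat N N" unfolding N_def by (rule sylvester_carrier_mat)
  have nz: "?v \<noteq> 0\<^sub>v N"
  proof
    assume "?v = 0\<^sub>v N"
    then have "vec_index ?v (N - 1) = vec_index (0\<^sub>v N) (N - 1)" by (rule arg_cong)
    with N show False by simp
  qed
  have "vec_index (?S *\<^sub>v ?v) i = 0" if i: "i < N" for i
  proof -
    have "vec_index (?S *\<^sub>v ?v) i = poly (sylvester_row A B i) z"
      using S i sylvester_index_row[of i A B] sylvester_row_eval[of i A B z]
      by (simp add: scalar_prod_def atLeast0LessThan N_def[symmetric])
    also have "\<dots> = 0" using A B by (simp add: sylvester_row_def)
    finally show ?thesis .
  qed
  then have "?S *\<^sub>v ?v = 0\<^sub>v N" using S by (intro eq_vecI) auto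
  then have "Determinant.det ?S = 0"
    using det_0_iff_vec_prod_zero[OF S] nz by (intro iffD2[OF det_0_iff_vec_prod_zero[OF S]] exI[of _ ?v]) auto
  then show ?thesis by (simp add: resultant_def)
qed

section \<open>Energy of pairs of integer polynomials\<close>

definition croots :: "int poly \<Rightarrow> complex multiset" where
  "croots P = proots (of_int_poly P)"

text \<open>Since \<open>ln 0 = 0\<close>, coinciding roots contribute nothing; so \<open>energy p p\<close> is a discriminant, and
  the lower bound \<open>energy_lower_bound\<close> needs no coprimality.\<close>

definition energy :: "int poly \<Rightarrow> int poly \<Rightarrow> real" where
  "energy p q = (\<Sum>a\<in>#croots p. \<Sum>b\<in>#croots q. ln (cmod (a - b)))"

lemma croots_mult: "P \<noteq> 0 \<Longrightarrow> Q \<noteq> 0 \<Longrightarrow> croots (P * Q) = croots P + croots Q"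
  by (simp add: croots_def hom_distribs proots_mult)

lemma size_croots: "size (croots P) = degree P"
  by (simp add: croots_def size_proots_complex)

lemma in_croots_iff: "P \<noteq> 0 \<Longrightarrow> z \<in># croots P \<longleftrightarrow> poly (of_int_poly P) z = 0"
  by (simp add: croots_def)

lemma croots_degree_0: "degree P = 0 \<Longrightarrow> croots P = {#}"
  using size_croots[of P] by simp

lemma poly_prod_mset: "poly (prod_mset (image_mset f A)) z = (\<Prod>a\<in>#A. poly (f a) z)"
  by (induction A) auto

lemma poly_of_int_croots:
  "poly (of_int_poly P) z = of_int (lead_coeff P) * (\<Prod>a\<in>#croots P. z - a)"
proof -
  have "poly (of_int_poly P) z = poly (Polynomial.smult (lead_coeff (of_int_poly P)) (\<Prod>a\<in>#croots P. [:-a, 1:])) z"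
    unfolding croots_def by (subst complex_poly_decompose_multiset) simp
  also have "\<dots> = of_int (lead_coeff P) * (\<Prod>a\<in>#croots P. z - a)"
    by (simp add: poly_prod_mset)
  finally show ?thesis .
qed

lemma cmod_prod_mset: "cmod (\<Prod>a\<in>#A. f a) = (\<Prod>a\<in>#A. cmod (f a))"
  by (induction A) (auto simp: norm_mult)

lemma ln_prod_mset:
  fixes f :: "'a \<Rightarrow> real"
  assumes "\<And>a. a \<in># A \<Longrightarrow> 0 < f a"
  shows "0 < (\<Prod>a\<in>#A. f a)" "ln (\<Prod>a\<in>#A. f a) = (\<Sum>a\<in>#A. ln (f a))"
proof -
  have "0 < (\<Prod>a\<in>#A. f a) \<and> ln (\<Prod>a\<in>#A. f a) = (\<Sum>a\<in>#A. ln (f a))"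
    using assms by (induction A) (auto simp: ln_mult_pos)
  then show "0 < (\<Prod>a\<in>#A. f a)" "ln (\<Prod>a\<in>#A. f a) = (\<Sum>a\<in>#A. ln (f a))" by auto
qed

lemma ln_cmod_poly_of_int:
  assumes "P \<noteq> 0" "poly (of_int_poly P) z \<noteq> 0"
  shows "ln (cmod (poly (of_int_poly P) z)) = ln \<bar>lead_coeff P\<bar> + (\<Sum>a\<in>#croots P. ln (cmod (z - a)))"
proof -
  have "0 < cmod (z - a)" if "a \<in># croots P" for a
    using that assms in_croots_iff by auto
  note * = ln_prod_mset[of "croots P" "\<lambda>a. cmod (z - a)", OF this]
  have "cmod (poly (of_int_poly P) z) = of_int \<bar>lead_coeff P\<bar> * (\<Prod>a\<in>#croots P. cmod (z - a))"
    by (simp add: poly_of_int_croots norm_mult cmod_prod_mset)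
  then show ?thesis using * assms(1) by (simp add: ln_mult_pos)
qed

lemma ln_lead_nonneg: "P \<noteq> 0 \<Longrightarrow> 0 \<le> ln (real_of_int \<bar>lead_coeff P\<bar>)"
proof -
  assume "P \<noteq> 0"
  then have "lead_coeff P \<noteq> 0" by simp
  then have "1 \<le> \<bar>lead_coeff P\<bar>" by linarith
  then have "1 \<le> real_of_int \<bar>lead_coeff P\<bar>" by linarith
  then show ?thesis by (rule ln_ge_zero)
qed

section \<open>Roots of irreducible integer polynomials\<close>

lemma prime_elem_dvd_if_common_root:
  assumes p: "prime_elem p" and z: "poly (of_int_poly p) z = 0" "poly (of_int_poly F) (z::complex) = 0"
  shows "p dvd F"
proof (cases "F = 0")
  case False
  have p0: "p \<noteq> 0" using p by auto
  have "resultant (of_int_poly p) (of_int_poly F :: complex poly) = 0"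
    using z p0 by (intro resultant_zero_if_common_root) auto
  then have "resultant p F = 0" by (simp add: of_int_hom.resultant_hom)
  then have deg: "degree (gcd p F) \<noteq> 0" by (simp add: resultant_0_gcd)
  define g where "g = gcd p F"
  have "g dvd p" by (simp add: g_def)
  then obtain k where k: "p = g * k" by (rule dvdE)
  have "irreducible p" using p by (rule prime_elem_imp_irreducible)
  then have "is_unit g \<or> is_unit k" using irreducibleD[OF _ k] by blast
  moreover have "\<not> is_unit g" using deg by (auto simp: g_def[symmetric] is_unit_poly_iff)
  ultimately have "is_unit k" by blast
  then have "p dvd g" using dvd_mult_unit_iff[of k p g] k[symmetric] by simp
  then have "p dvd gcd p F" unfolding g_def .
  then show ?thesis by (rule dvd_trans) simp
qed simp

lemma order_pderiv_root:
  fixes P :: "complex poly"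
  assumes "P \<noteq> 0" "2 \<le> order z P"
  shows "poly (pderiv P) z = 0"
proof -
  have "[:-z, 1:] ^ 2 dvd P" using assms order_1 power_le_dvd by blast
  then obtain R where "P = [:-z, 1:] ^ 2 * R" by blast
  then have "pderiv P = ([:-z, 1:] * [:-z, 1:]) * pderiv R + R * ([:-z, 1:] * pderiv [:-z, 1:] + [:-z, 1:] * pderiv [:-z, 1:])"
    by (simp only: pderiv_mult power2_eq_square)
  then show ?thesis by (simp only: poly_mult poly_add) simp
qed

lemma prime_elem_not_dvd_pderiv:
  fixes p :: "int poly"
  assumes "degree p \<noteq> 0"
  shows "\<not> p dvd pderiv p" "pderiv p \<noteq> 0"
proof -
  show nz: "pderiv p \<noteq> 0" using assms by (simp add: pderiv_eq_0_iff)
  show "\<not> p dvd pderiv p"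
    using assms nz dvd_imp_degree_le[of p "pderiv p"] degree_pderiv[of p] by auto
qed

text \<open>A multiple root would be shared with the derivative, so p would divide a nonzero
  polynomial of smaller degree.\<close>

lemma count_croots_prime_elem:
  assumes p: "prime_elem p"
  shows "count (croots p) z \<le> 1"
proof (rule ccontr)
  assume *: "\<not> count (croots p) z \<le> 1"
  have p0: "p \<noteq> 0" using p by auto
  have deg: "degree p \<noteq> 0" using * croots_degree_0 by force
  have "2 \<le> order z (of_int_poly p)" using * p0 by (simp add: croots_def)
  then have "poly (pderiv (of_int_poly p)) z = 0" using p0 by (intro order_pderiv_root) auto
  then have "poly (of_int_poly (pderiv p)) z = 0" by (simp add: hom_distribs)
  moreover have "poly (of_int_poly p) z = 0" using * in_croots_iff[OF p0, of z] by (simp add: not_le flip: count_greater_zero_iff)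
  ultimately have "p dvd pderiv p" using prime_elem_dvd_if_common_root[OF p] by blast
  then show False using prime_elem_not_dvd_pderiv[OF deg] by blast
qed

text \<open>Without a common root the product formula shows that the resultant is nonzero; being an
  integer, it has absolute value at least 1. The formula applies because the roots of p are
  simple.\<close>

lemma ln_norm_nonneg:
  assumes p: "prime_elem p" and q: "q \<noteq> 0" and "\<not> p dvd q"
  shows "0 \<le> degree q * ln \<bar>lead_coeff p\<bar> + (\<Sum>a\<in>#croots p. ln (cmod (poly (of_int_poly q) a)))"
proof -
  have p0: "p \<noteq> 0" using p by auto
  obtain as where as: "mset as = croots p" using ex_mset by blast
  have "distinct as" unfolding distinct_count_atmost_1
  proof
    fix a
    have "count (mset as) a \<le> 1" using count_croots_prime_elem[OF p] as by simp
    moreover have "count (mset as) a = 0 \<longleftrightarrow> a \<notin> set as" by (simp add: count_eq_zero_iff)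
    ultimately show "count (mset as) a = (if a \<in> set as then 1 else 0)" by presburger
  qed
  have len: "length as = degree p" using as size_croots by (metis size_mset)
  have root: "poly (of_int_poly p) a = 0" if "a \<in> set as" for a
    using that as p0 in_croots_iff by (metis set_mset_mset)
  have nz: "poly (of_int_poly q) a \<noteq> 0" if "a \<in># croots p" for a
    using that p0 in_croots_iff prime_elem_dvd_if_common_root[OF p] assms(3) by blast
  have "of_int (resultant p q) = resultant (of_int_poly p) (of_int_poly q :: complex poly)"
    by (simp add: of_int_hom.resultant_hom)
  also have "\<dots> = of_int (lead_coeff p) ^ degree q * (\<Prod>k<degree p. poly (of_int_poly q) (as ! k))"
    using resultant_eq_prod_roots[of as "of_int_poly p" "of_int_poly q"] \<open>distinct as\<close> len root by simp
  also have "(\<Prod>k<degree p. poly (of_int_poly q) (as ! k)) = (\<Prod>a\<in>#croots p. poly (of_int_poly q) a)"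
    unfolding as[symmetric] using len
    by (simp only: mset_map[symmetric] prod_mset_prod_list prod.list_conv_set_nth length_map) (simp add: atLeast0LessThan)
  finally have eq: "complex_of_int (resultant p q) = of_int (lead_coeff p) ^ degree q * (\<Prod>a\<in>#croots p. poly (of_int_poly q) a)" .
  have eq': "\<bar>real_of_int (resultant p q)\<bar> = of_int \<bar>lead_coeff p\<bar> ^ degree q * (\<Prod>a\<in>#croots p. cmod (poly (of_int_poly q) a))"
  proof -
    have "cmod (complex_of_int (resultant p q)) = cmod (of_int (lead_coeff p)) ^ degree q * (\<Prod>a\<in>#croots p. cmod (poly (of_int_poly q) a))"
      unfolding eq norm_mult norm_power cmod_prod_mset ..
    then show ?thesis by (simp only: norm_of_int of_int_abs)
  qed
  note l = ln_prod_mset[of "croots p" "\<lambda>a. cmod (poly (of_int_poly q) a)"]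
  have pos: "0 < (\<Prod>a\<in>#croots p. cmod (poly (of_int_poly q) a))" using l(1) nz by simp
  have "0 < \<bar>real_of_int (resultant p q)\<bar>" using eq' pos p0 by simp
  then have "resultant p q \<noteq> 0" by auto
  then have "1 \<le> \<bar>resultant p q\<bar>" by linarith
  then have "1 \<le> \<bar>real_of_int (resultant p q)\<bar>" by linarith
  then have "0 \<le> ln \<bar>real_of_int (resultant p q)\<bar>" by simp
  also have "\<dots> = degree q * ln \<bar>lead_coeff p\<bar> + (\<Sum>a\<in>#croots p. ln (cmod (poly (of_int_poly q) a)))"
    using eq' pos l(2) nz p0 by (simp add: ln_mult_pos ln_realpow)
  finally show ?thesis .
qed

lemma energy_prime_not_dvd:
  assumes p: "prime_elem p" and q: "q \<noteq> 0" and "\<not> p dvd q"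
  shows "0 \<le> degree q * ln \<bar>lead_coeff p\<bar> + degree p * ln \<bar>lead_coeff q\<bar> + energy p q"
proof -
  have p0: "p \<noteq> 0" using p by auto
  have nz: "poly (of_int_poly q) a \<noteq> 0" if "a \<in># croots p" for a
    using that p0 in_croots_iff prime_elem_dvd_if_common_root[OF p] assms(3) by blast
  have "(\<Sum>a\<in>#croots p. ln (cmod (poly (of_int_poly q) a))) = (\<Sum>a\<in>#croots p. ln \<bar>lead_coeff q\<bar> + (\<Sum>b\<in>#croots q. ln (cmod (a - b))))"
    using q nz by (intro arg_cong[of _ _ sum_mset] image_mset_cong) (simp add: ln_cmod_poly_of_int)
  also have "\<dots> = degree p * ln \<bar>lead_coeff q\<bar> + energy p q"
    by (simp add: sum_mset.distrib energy_def size_croots)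
  finally show ?thesis using ln_norm_nonneg[OF assms] by simp
qed

text \<open>Here q = p shares all its roots with p, so \<open>pderiv p\<close> takes its place. At a
  root a, the derivative is the leading coefficient times the product of a - b over the other roots
  b; the missing diagonal factor costs nothing because ln 0 = 0.\<close>

lemma energy_prime_self:
  assumes p: "prime_elem p"
  shows "0 \<le> degree p * ln \<bar>lead_coeff p\<bar> + degree p * ln \<bar>lead_coeff p\<bar> + energy p p"
proof (cases "degree p = 0")
  case True
  then show ?thesis by (simp add: energy_def croots_degree_0)
next
  case False
  have p0: "p \<noteq> 0" using p by auto
  let ?q = "pderiv p"
  note nd = prime_elem_not_dvd_pderiv[OF False]
  have key: "ln (cmod (poly (of_int_poly ?q) a)) = ln \<bar>lead_coeff p\<bar> + (\<Sum>b\<in>#croots p. ln (cmod (a - b)))"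
    if a: "a \<in># croots p" for a
  proof -
    define M where "M = croots p - {#a#}"
    have M: "croots p = add_mset a M" using a by (simp add: M_def)
    define R where "R = Polynomial.smult (of_int (lead_coeff p)) (\<Prod>b\<in>#M. [:-b, 1:])"
    have "of_int_poly p = Polynomial.smult (lead_coeff (of_int_poly p)) (\<Prod>b\<in>#croots p. [:-b, 1:])"
      unfolding croots_def by (subst complex_poly_decompose_multiset) simp
    also have "\<dots> = [:-a, 1:] * R" by (simp add: M R_def)
    finally have "pderiv (of_int_poly p) = [:-a, 1:] * pderiv R + R"
      by (simp only: pderiv_mult) (simp add: pderiv_pCons)
    then have "of_int_poly ?q = [:-a, 1:] * pderiv R + R" by (simp only: of_int_hom.map_poly_pderiv)
    then have "poly (of_int_poly ?q) a = poly R a" by (simp only: poly_add poly_mult) simp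
    also have "\<dots> = of_int (lead_coeff p) * (\<Prod>b\<in>#M. a - b)" by (simp add: R_def poly_prod_mset)
    finally have eq: "poly (of_int_poly ?q) a = of_int (lead_coeff p) * (\<Prod>b\<in>#M. a - b)" .
    have "count M a = 0" using count_croots_prime_elem[OF p, of a] unfolding M by simp
    then have "b \<noteq> a" if "b \<in># M" for b
      using that by (metis count_eq_zero_iff)
    then have l: "0 < cmod (a - b)" if "b \<in># M" for b using that by force
    note * = ln_prod_mset[of M "\<lambda>b. cmod (a - b)", OF l]
    have "ln (cmod (poly (of_int_poly ?q) a)) = ln (\<bar>lead_coeff p\<bar> * (\<Prod>b\<in>#M. cmod (a - b)))"
      unfolding eq by (simp add: norm_mult cmod_prod_mset)
    also have "\<dots> = ln \<bar>lead_coeff p\<bar> + (\<Sum>b\<in>#M. ln (cmod (a - b)))"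
      using * p0 by (simp add: ln_mult_pos)
    finally show ?thesis by (simp add: M)
  qed
  have "(\<Sum>a\<in>#croots p. ln (cmod (poly (of_int_poly ?q) a))) = (\<Sum>a\<in>#croots p. ln \<bar>lead_coeff p\<bar> + (\<Sum>b\<in>#croots p. ln (cmod (a - b))))"
    using key by (intro arg_cong[of _ _ sum_mset] image_mset_cong) simp
  also have "\<dots> = degree p * ln \<bar>lead_coeff p\<bar> + energy p p"
    by (simp add: sum_mset.distrib energy_def size_croots)
  finally have "0 \<le> degree ?q * ln \<bar>lead_coeff p\<bar> + (degree p * ln \<bar>lead_coeff p\<bar> + energy p p)"
    using ln_norm_nonneg[OF p nd(2,1)] by simp
  moreover have "degree ?q * ln \<bar>lead_coeff p\<bar> \<le> degree p * ln \<bar>lead_coeff p\<bar>"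
    using ln_lead_nonneg[OF p0] degree_pderiv[of p] by (intro mult_right_mono) auto
  ultimately show ?thesis by linarith
qed

lemma energy_mult_right: "q \<noteq> 0 \<Longrightarrow> r \<noteq> 0 \<Longrightarrow> energy p (q * r) = energy p q + energy p r"
  by (simp add: energy_def croots_mult sum_mset.distrib)

lemma energy_mult_left: "q \<noteq> 0 \<Longrightarrow> r \<noteq> 0 \<Longrightarrow> energy (q * r) p = energy q p + energy r p"
  by (simp add: energy_def croots_mult)

lemma ln_lead_mult: "p \<noteq> 0 \<Longrightarrow> q \<noteq> 0 \<Longrightarrow>
    ln (real_of_int \<bar>lead_coeff (p * q)\<bar>) = ln \<bar>lead_coeff p\<bar> + ln \<bar>lead_coeff q\<bar>"
  by (simp add: lead_coeff_mult abs_mult ln_mult)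

lemma energy_prime:
  assumes p: "prime p" and q: "q \<noteq> 0"
  shows "0 \<le> degree q * ln \<bar>lead_coeff p\<bar> + degree p * ln \<bar>lead_coeff q\<bar> + energy p q"
  using q
proof (induction q rule: prime_divisors_induct)
  case (unit q)
  then have "degree q = 0" by (auto simp: is_unit_poly_iff)
  then show ?case
    using ln_lead_nonneg[of q] unit by (auto simp: energy_def croots_degree_0)
next
  case (factor r q)
  then have r0: "r \<noteq> 0" and q0: "q \<noteq> 0" by auto
  have "0 \<le> degree r * ln \<bar>lead_coeff p\<bar> + degree p * ln \<bar>lead_coeff r\<bar> + energy p r"
  proof (cases "p dvd r")
    case True
    then have "p = r" using p factor primes_dvd_imp_eq by blast
    then show ?thesis using energy_prime_self[of p] p by auto
  qed (use energy_prime_not_dvd r0 p in auto)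
  moreover have "0 \<le> degree q * ln \<bar>lead_coeff p\<bar> + degree p * ln \<bar>lead_coeff q\<bar> + energy p q"
    using factor q0 by simp
  ultimately show ?case
    unfolding energy_mult_right[OF r0 q0] ln_lead_mult[OF r0 q0] unfolding degree_mult_eq[OF r0 q0] by (simp add: algebra_simps)
qed simp

text \<open>The right-hand side is additive in each argument, so factorization reduces it to pairs
  of primes: distinct ones are handled by resultants, equal ones by discriminants. Units contribute
  nothing negative.\<close>

theorem energy_lower_bound:
  assumes p: "p \<noteq> 0" and q: "q \<noteq> 0"
  shows "0 \<le> degree q * ln \<bar>lead_coeff p\<bar> + degree p * ln \<bar>lead_coeff q\<bar> + energy p q"
  using p
proof (induction p rule: prime_divisors_induct)
  case (unit p)
  then have "degree p = 0" by (auto simp: is_unit_poly_iff)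
  then show ?case
    using ln_lead_nonneg[of p] unit by (auto simp: energy_def croots_degree_0)
next
  case (factor r p)
  then have r0: "r \<noteq> 0" and p0: "p \<noteq> 0" by auto
  show ?case
    using energy_prime[OF factor(1) q] factor(2)[OF p0]
    unfolding energy_mult_left[OF r0 p0] ln_lead_mult[OF r0 p0] unfolding degree_mult_eq[OF r0 p0] by (simp add: algebra_simps)
qed simp

section \<open>Heights\<close>

text \<open>The product is 1 at the origin, so the maximum principle, here the Cauchy inequality of
  order 0, gives a point of the circle where it is at least 1.\<close>

lemma exists_circle_prod_ge_1:
  fixes A :: "complex multiset"
  assumes \<rho>: "0 < \<rho>"
  shows "\<exists>w. cmod w = \<rho> \<and> 1 \<le> cmod (\<Prod>a\<in>#A. 1 - a * w)"
proof -
  define h where "h = poly (\<Prod>a\<in>#A. [:1, -a:])"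
  have h: "h w = (\<Prod>a\<in>#A. 1 - a * w)" for w
    by (simp add: h_def poly_prod_mset mult.commute)
  have cont: "continuous_on S h" for S unfolding h_def by (intro continuous_intros)
  have "sphere 0 \<rho> \<noteq> ({} :: complex set)" using \<rho> by simp
  then obtain w where w: "w \<in> sphere 0 \<rho>" and max: "\<And>x. x \<in> sphere 0 \<rho> \<Longrightarrow> cmod (h x) \<le> cmod (h w)"
    using continuous_attains_sup[OF compact_sphere _ continuous_on_norm[OF cont]] by blast
  have "cmod ((deriv ^^ 0) h 0) \<le> fact 0 * cmod (h w) / \<rho> ^ 0"
  proof (rule Cauchy_inequality)
    show "h holomorphic_on ball 0 \<rho>" unfolding h_def by (intro holomorphic_intros)
    show "continuous_on (cball 0 \<rho>) h" by (rule cont)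
    show "cmod (h x) \<le> cmod (h w)" if "cmod (0 - x) = \<rho>" for x using max[of x] that by simp
  qed (rule \<rho>)
  moreover have "h 0 = 1" by (simp add: h)
  ultimately show ?thesis using w h by (intro exI[of _ w]) auto
qed

text \<open>The inversion w = 1 / (z - y) turns z - a into (1 - (a - y) w) / w.\<close>

lemma exists_circle_prod_ge_power:
  fixes A :: "complex multiset"
  assumes \<rho>: "0 < \<rho>"
  shows "\<exists>z. cmod (z - y) = \<rho> \<and> \<rho> ^ size A \<le> cmod (\<Prod>a\<in>#A. z - a)"
proof -
  obtain w where w: "cmod w = inverse \<rho>" "1 \<le> cmod (\<Prod>a\<in>#image_mset (\<lambda>a. a - y) A. 1 - a * w)"
    using exists_circle_prod_ge_1[of "inverse \<rho>"] \<rho> by auto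
  then have w0: "w \<noteq> 0" using \<rho> by auto
  define z where "z = y + inverse w"
  have "(\<Prod>a\<in>#B. z - a) * w ^ size B = (\<Prod>a\<in>#B. 1 - (a - y) * w)" for B
    using w0 by (induction B) (auto simp: z_def algebra_simps)
  then have "cmod (\<Prod>a\<in>#A. z - a) * inverse \<rho> ^ size A = cmod (\<Prod>a\<in>#A. 1 - (a - y) * w)"
    by (metis norm_mult norm_power w(1))
  then have "1 \<le> cmod (\<Prod>a\<in>#A. z - a) * inverse \<rho> ^ size A"
    using w(2) by (simp add: multiset.map_comp comp_def)
  then have "\<rho> ^ size A \<le> cmod (\<Prod>a\<in>#A. z - a)"
    using \<rho> by (simp add: field_simps)
  moreover have "cmod (z - y) = \<rho>" using w(1) \<rho> by (simp add: z_def norm_inverse)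
  ultimately show ?thesis by blast
qed

lemma prod_mset_nonneg_real:
  fixes f :: "'a \<Rightarrow> real"
  assumes "\<And>a. a \<in># A \<Longrightarrow> 0 \<le> f a"
  shows "0 \<le> (\<Prod>a\<in>#A. f a)"
  using assms by (induction A) auto

lemma prod_mset_mono_real:
  fixes f g :: "'a \<Rightarrow> real"
  assumes "\<And>a. a \<in># A \<Longrightarrow> 0 \<le> f a \<and> f a \<le> g a"
  shows "(\<Prod>a\<in>#A. f a) \<le> (\<Prod>a\<in>#A. g a)"
  using assms
proof (induction A)
  case (add x A)
  then have "f x * (\<Prod>a\<in>#A. f a) \<le> g x * (\<Prod>a\<in>#A. g a)"
    by (intro mult_mono prod_mset_nonneg_real) (auto intro: order_trans[of 0 "f x" "g x"])
  then show ?case by simp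
qed simp

lemma prod_mset_const_mult: "(\<Prod>a\<in>#A. c * f a) = (c::real) ^ size A * (\<Prod>a\<in>#A. f a)"
  by (induction A) auto

text \<open>One point z must serve all roots. Those within 2 \<rho> of y are handled together by
  \<open>exists_circle_prod_ge_power\<close>; for a farther root, |y - a| \<le> 2 |z - a| holds at
  every z on the circle. Either way a root costs a factor 2.\<close>

lemma exists_circle_prod_ge_max:
  fixes A :: "complex multiset"
  assumes \<rho>: "0 < \<rho>"
  shows "\<exists>z. cmod (z - y) = \<rho> \<and> (\<Prod>a\<in>#A. max \<rho> (cmod (y - a))) \<le> 2 ^ size A * (\<Prod>a\<in>#A. cmod (z - a))"
proof -
  define N where "N = filter_mset (\<lambda>a. cmod (y - a) < 2 * \<rho>) A"
  define F where "F = filter_mset (\<lambda>a. \<not> cmod (y - a) < 2 * \<rho>) A"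
  have A: "A = N + F" unfolding N_def F_def by (rule multiset_partition)
  obtain z where z: "cmod (z - y) = \<rho>" "\<rho> ^ size N \<le> cmod (\<Prod>a\<in>#N. z - a)"
    using exists_circle_prod_ge_power[OF \<rho>] by blast
  have "(\<Prod>a\<in>#N. max \<rho> (cmod (y - a))) \<le> (\<Prod>a\<in>#N. 2 * \<rho>)"
    using \<rho> by (intro prod_mset_mono_real) (auto simp: N_def)
  also have "\<dots> = 2 ^ size N * \<rho> ^ size N" by (simp add: power_mult_distrib)
  also have "\<dots> \<le> 2 ^ size N * (\<Prod>a\<in>#N. cmod (z - a))" using z(2) by (simp add: cmod_prod_mset)
  finally have 1: "(\<Prod>a\<in>#N. max \<rho> (cmod (y - a))) \<le> 2 ^ size N * (\<Prod>a\<in>#N. cmod (z - a))" .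
  have "(\<Prod>a\<in>#F. max \<rho> (cmod (y - a))) \<le> (\<Prod>a\<in>#F. 2 * cmod (z - a))"
  proof (rule prod_mset_mono_real)
    fix a assume "a \<in># F"
    then have "2 * \<rho> \<le> cmod (y - a)" by (simp add: F_def)
    moreover have "cmod (y - a) \<le> cmod (z - y) + cmod (z - a)"
      using norm_triangle_ineq4[of "z - a" "z - y"] by simp
    ultimately show "0 \<le> max \<rho> (cmod (y - a)) \<and> max \<rho> (cmod (y - a)) \<le> 2 * cmod (z - a)"
      using z(1) \<rho> by auto
  qed
  also have "\<dots> = 2 ^ size F * (\<Prod>a\<in>#F. cmod (z - a))" by (rule prod_mset_const_mult)
  finally have 2: "(\<Prod>a\<in>#F. max \<rho> (cmod (y - a))) \<le> 2 ^ size F * (\<Prod>a\<in>#F. cmod (z - a))" .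
  have "(\<Prod>a\<in>#N. max \<rho> (cmod (y - a))) * (\<Prod>a\<in>#F. max \<rho> (cmod (y - a)))
      \<le> (2 ^ size N * (\<Prod>a\<in>#N. cmod (z - a))) * (2 ^ size F * (\<Prod>a\<in>#F. cmod (z - a)))"
    using \<rho> by (intro mult_mono 1 2 prod_mset_nonneg_real mult_nonneg_nonneg) (auto simp: le_max_iff_disj)
  then show ?thesis using z(1) by (intro exI[of _ z]) (simp add: A power_add mult_ac)
qed

text \<open>The logarithmic Mahler measure with 1 + |a| in place of max(1, |a|). It stays exactly
  additive and fits the estimate |a - b| \<le> (1 + |a|) (1 + |b|) used for distances between
  roots.\<close>

definition ht :: "int poly \<Rightarrow> real" where
  "ht P = ln \<bar>lead_coeff P\<bar> + (\<Sum>a\<in>#croots P. ln (1 + cmod a))"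

lemma ht_mult: "P \<noteq> 0 \<Longrightarrow> Q \<noteq> 0 \<Longrightarrow> ht (P * Q) = ht P + ht Q"
  unfolding ht_def by (subst ln_lead_mult) (auto simp: croots_mult)

lemma sum_mset_nonneg_real:
  fixes f :: "'a \<Rightarrow> real"
  assumes "\<And>a. a \<in># A \<Longrightarrow> 0 \<le> f a"
  shows "0 \<le> (\<Sum>a\<in>#A. f a)"
  using assms by (induction A) auto

lemma sum_mset_mono_real:
  fixes f g :: "'a \<Rightarrow> real"
  assumes "\<And>a. a \<in># A \<Longrightarrow> f a \<le> g a"
  shows "(\<Sum>a\<in>#A. f a) \<le> (\<Sum>a\<in>#A. g a)"
  using assms by (induction A) (auto intro: add_mono)

lemma ht_ge_ln_lead: "ln (real_of_int \<bar>lead_coeff P\<bar>) \<le> ht P"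
  unfolding ht_def using sum_mset_nonneg_real[of "croots P" "\<lambda>a. ln (1 + cmod a)"] by simp

lemma ht_nonneg: "P \<noteq> 0 \<Longrightarrow> 0 \<le> ht P"
  using ht_ge_ln_lead[of P] ln_lead_nonneg[of P] by linarith

text \<open>One factor 2 per root comes from 1 + |a| \<le> 2 max(1, |a|), the other from
  \<open>exists_circle_prod_ge_max\<close>; together they give the 4.\<close>

lemma ht_le_if_bounded_on_disc:
  assumes P: "P \<noteq> 0" and C: "\<And>z. cmod z = 1 \<Longrightarrow> cmod (poly (of_int_poly P) z) \<le> C"
  shows "ht P \<le> degree P * ln 4 + ln C"
proof -
  obtain z where z: "cmod (z - 0) = 1"
    "(\<Prod>a\<in>#croots P. max 1 (cmod (0 - a))) \<le> 2 ^ size (croots P) * (\<Prod>a\<in>#croots P. cmod (z - a))"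
    using exists_circle_prod_ge_max[of 1 0 "croots P"] by auto
  have l0: "0 < real_of_int \<bar>lead_coeff P\<bar>" using P by simp
  have pos: "0 < (\<Prod>a\<in>#croots P. 1 + cmod a)" by (rule ln_prod_mset) (simp add: add_pos_nonneg)
  have "(\<Prod>a\<in>#croots P. 1 + cmod a) \<le> (\<Prod>a\<in>#croots P. 2 * max 1 (cmod (0 - a)))"
    by (intro prod_mset_mono_real) auto
  also have "\<dots> = 2 ^ degree P * (\<Prod>a\<in>#croots P. max 1 (cmod (0 - a)))"
    by (simp only: prod_mset_const_mult size_croots)
  also have "\<dots> \<le> 2 ^ degree P * (2 ^ degree P * (\<Prod>a\<in>#croots P. cmod (z - a)))"
    using z(2) by (intro mult_left_mono) (auto simp: size_croots)
  also have "\<dots> = 4 ^ degree P * (\<Prod>a\<in>#croots P. cmod (z - a))"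
    by (simp add: power_mult_distrib[symmetric] mult.assoc[symmetric])
  finally have "\<bar>lead_coeff P\<bar> * (\<Prod>a\<in>#croots P. 1 + cmod a) \<le> \<bar>lead_coeff P\<bar> * (4 ^ degree P * (\<Prod>a\<in>#croots P. cmod (z - a)))"
    using l0 by (intro mult_left_mono) auto
  also have "\<dots> = 4 ^ degree P * cmod (poly (of_int_poly P) z)"
    by (simp add: poly_of_int_croots norm_mult cmod_prod_mset)
  also have "\<dots> \<le> 4 ^ degree P * C" using C z(1) by simp
  finally have le: "\<bar>lead_coeff P\<bar> * (\<Prod>a\<in>#croots P. 1 + cmod a) \<le> 4 ^ degree P * C" .
  have C0: "0 < C"
    using less_le_trans[OF mult_pos_pos[OF l0 pos] le] by (simp add: zero_less_mult_iff)
  have "ht P = ln (\<bar>lead_coeff P\<bar> * (\<Prod>a\<in>#croots P. 1 + cmod a))"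
    using l0 pos ln_prod_mset(2)[of "croots P" "\<lambda>a. 1 + cmod a"] by (simp add: ht_def ln_mult_pos add_pos_nonneg)
  also have "\<dots> \<le> ln (4 ^ degree P * C)"
    using le mult_pos_pos[OF l0 pos] C0 by (subst ln_le_cancel_iff) auto
  also have "\<dots> = degree P * ln 4 + ln C" using C0 by (simp add: ln_mult_pos ln_realpow)
  finally show ?thesis .
qed

text \<open>The leading coefficient is a nonzero integer, so it may be dropped from the lower bound
  for the polynomial; what remains is \<open>exists_circle_prod_ge_max\<close>.\<close>

lemma sum_ln_max_le_if_small_on_disc:
  assumes P: "P \<noteq> 0" and \<rho>: "0 < \<rho>"
    and \<epsilon>: "\<And>z. cmod (z - y) = \<rho> \<Longrightarrow> cmod (poly (of_int_poly P) z) \<le> \<epsilon>"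
  shows "(\<Sum>a\<in>#croots P. ln (max \<rho> (cmod (y - a)))) \<le> degree P * ln 2 + ln \<epsilon>"
proof -
  obtain z where z: "cmod (z - y) = \<rho>"
    "(\<Prod>a\<in>#croots P. max \<rho> (cmod (y - a))) \<le> 2 ^ size (croots P) * (\<Prod>a\<in>#croots P. cmod (z - a))"
    using exists_circle_prod_ge_max[OF \<rho>, of y "croots P"] by auto
  have l1: "1 \<le> \<bar>real_of_int (lead_coeff P)\<bar>"
  proof -
    have "lead_coeff P \<noteq> 0" using P by simp
    then have "1 \<le> \<bar>lead_coeff P\<bar>" by linarith
    then show ?thesis by linarith
  qed
  note l = ln_prod_mset[of "croots P" "\<lambda>a. max \<rho> (cmod (y - a))"]
  have pos: "0 < (\<Prod>a\<in>#croots P. max \<rho> (cmod (y - a)))" using l(1) \<rho> by simp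
  have nn: "0 \<le> (\<Prod>a\<in>#croots P. cmod (z - a))" by (rule prod_mset_nonneg_real) simp
  have "(\<Prod>a\<in>#croots P. max \<rho> (cmod (y - a))) \<le> 2 ^ degree P * (\<Prod>a\<in>#croots P. cmod (z - a))"
    using z(2) by (simp add: size_croots)
  also have "\<dots> \<le> 2 ^ degree P * (\<bar>lead_coeff P\<bar> * (\<Prod>a\<in>#croots P. cmod (z - a)))"
    using mult_right_mono[OF l1 nn] by (intro mult_left_mono) auto
  also have "\<dots> = 2 ^ degree P * cmod (poly (of_int_poly P) z)"
    by (simp add: poly_of_int_croots norm_mult cmod_prod_mset)
  also have "\<dots> \<le> 2 ^ degree P * \<epsilon>" using \<epsilon> z(1) by simp
  finally have le: "(\<Prod>a\<in>#croots P. max \<rho> (cmod (y - a))) \<le> 2 ^ degree P * \<epsilon>" .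
  have e0: "0 < \<epsilon>" using less_le_trans[OF pos le] by (simp add: zero_less_mult_iff)
  have "(\<Sum>a\<in>#croots P. ln (max \<rho> (cmod (y - a)))) = ln (\<Prod>a\<in>#croots P. max \<rho> (cmod (y - a)))"
    using l(2) \<rho> by simp
  also have "\<dots> \<le> ln (2 ^ degree P * \<epsilon>)" using le pos e0 by (subst ln_le_cancel_iff) auto
  also have "\<dots> = degree P * ln 2 + ln \<epsilon>" using e0 by (simp add: ln_mult_pos ln_realpow)
  finally show ?thesis .
qed

section \<open>Truncated logarithmic potentials\<close>

text \<open>\<open>gam\<close> is \<open>ln (s / |y - a|)\<close> clipped to the interval from \<open>0\<close> to \<open>ln (s / \<rho>)\<close>; discs of radius \<open>s\<close> around
  the points in play will be disjoint.\<close>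

definition gam :: "real \<Rightarrow> real \<Rightarrow> complex \<Rightarrow> complex \<Rightarrow> real" where
  "gam s \<rho> y a = ln s - ln (max \<rho> (min s (cmod (y - a))))"

definition pot :: "real \<Rightarrow> real \<Rightarrow> complex \<Rightarrow> int poly \<Rightarrow> real" where
  "pot s \<rho> y P = (\<Sum>a\<in>#croots P. gam s \<rho> y a)"

lemma
  assumes "0 < \<rho>" "\<rho> \<le> s"
  shows gam_nonneg: "0 \<le> gam s \<rho> y a"
    and gam_le: "gam s \<rho> y a \<le> ln s - ln \<rho>"
    and gam_eq_0: "s \<le> cmod (y - a) \<Longrightarrow> gam s \<rho> y a = 0"
    and gam_ge: "ln s - ln (max \<rho> (cmod (y - a))) \<le> gam s \<rho> y a"
    and cmod_le_exp_gam: "cmod (y - a) < s \<Longrightarrow> cmod (y - a) \<le> s * exp (- gam s \<rho> y a)"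
proof -
  let ?m = "max \<rho> (min s (cmod (y - a)))"
  have m: "0 < ?m" "?m \<le> s" "\<rho> \<le> ?m" using assms by auto
  show "0 \<le> gam s \<rho> y a" "gam s \<rho> y a \<le> ln s - ln \<rho>" using m assms by (auto simp: gam_def)
  show "gam s \<rho> y a = 0" if "s \<le> cmod (y - a)" using that assms by (simp add: gam_def)
  have "?m \<le> max \<rho> (cmod (y - a))" by auto
  then have "ln ?m \<le> ln (max \<rho> (cmod (y - a)))" using m assms by (subst ln_le_cancel_iff) auto
  then show "ln s - ln (max \<rho> (cmod (y - a))) \<le> gam s \<rho> y a" by (simp add: gam_def)
  have "s * exp (- gam s \<rho> y a) = ?m"
    using m assms by (simp add: gam_def exp_diff)
  then show "cmod (y - a) \<le> s * exp (- gam s \<rho> y a)" if "cmod (y - a) < s" using that by simp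
qed

lemma ln_le_if_le_exp: "0 < x \<Longrightarrow> x \<le> exp c \<Longrightarrow> ln x \<le> (c::real)"
  by (metis exp_gt_zero ln_exp ln_le_cancel_iff)

lemma sum_mset_subtractf: "(\<Sum>a\<in>#A. f a - g a) = (\<Sum>a\<in>#A. f a) - (\<Sum>a\<in>#A. g a :: real)"
  by (induction A) auto

lemma sum_mset_cmult_left: "(\<Sum>a\<in>#A. c * f a) = (c::real) * (\<Sum>a\<in>#A. f a)"
  by (induction A) (auto simp: distrib_left)

lemma sum_mset_cmult_right: "(\<Sum>a\<in>#A. f a * c) = (\<Sum>a\<in>#A. f a) * (c::real)"
  by (induction A) (auto simp: distrib_right)

lemma pot_mult: "P \<noteq> 0 \<Longrightarrow> Q \<noteq> 0 \<Longrightarrow> pot s \<rho> y (P * Q) = pot s \<rho> y P + pot s \<rho> y Q"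
  by (simp add: pot_def croots_mult)

lemma pot_ge_if_small_on_disc:
  assumes P: "P \<noteq> 0" and \<rho>: "0 < \<rho>" "\<rho> \<le> s"
    and \<epsilon>: "\<And>z. cmod (z - y) = \<rho> \<Longrightarrow> cmod (poly (of_int_poly P) z) \<le> \<epsilon>"
  shows "degree P * ln s - degree P * ln 2 - ln \<epsilon> \<le> pot s \<rho> y P"
proof -
  have "degree P * ln s - (\<Sum>a\<in>#croots P. ln (max \<rho> (cmod (y - a)))) =
      (\<Sum>a\<in>#croots P. ln s - ln (max \<rho> (cmod (y - a))))"
    by (simp add: sum_mset_subtractf size_croots)
  also have "\<dots> \<le> pot s \<rho> y P"
    unfolding pot_def using \<rho> by (intro sum_mset_mono_real gam_ge)
  finally have "degree P * ln s - (\<Sum>a\<in>#croots P. ln (max \<rho> (cmod (y - a)))) \<le> pot s \<rho> y P" .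
  moreover have "(\<Sum>a\<in>#croots P. ln (max \<rho> (cmod (y - a)))) \<le> degree P * ln 2 + ln \<epsilon>"
    using P \<rho>(1) \<epsilon> by (rule sum_ln_max_le_if_small_on_disc)
  ultimately show ?thesis by linarith
qed

text \<open>The passage back from a potential to a small value. A root within s of y satisfies ln |y
  - a| \<le> - gam because s \<le> 1; any other root has no potential and |y - a| \<le> (1 + |a|) (1
  + |y|).\<close>

lemma pot_le_minus_ln:
  assumes P: "P \<noteq> 0" and \<rho>: "0 < \<rho>" "\<rho> \<le> s" "s \<le> 1" and nz: "poly (of_int_poly P) y \<noteq> 0"
  shows "pot s \<rho> y P - ht P - degree P * ln (1 + cmod y) \<le> - ln (cmod (poly (of_int_poly P) y))"
proof -
  have "pot s \<rho> y P \<le> (\<Sum>a\<in>#croots P. ln (1 + cmod a) + ln (1 + cmod y) - ln (cmod (y - a)))"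
    unfolding pot_def
  proof (rule sum_mset_mono_real)
    fix a assume "a \<in># croots P"
    then have "y \<noteq> a" using nz in_croots_iff P by auto
    then have pos: "0 < cmod (y - a)" by simp
    have 1: "0 < 1 + cmod a" "0 < 1 + cmod y" by (simp_all add: add_pos_nonneg)
    have l: "0 \<le> ln (1 + cmod a)" "0 \<le> ln (1 + cmod y)" by simp_all
    show "gam s \<rho> y a \<le> ln (1 + cmod a) + ln (1 + cmod y) - ln (cmod (y - a))"
    proof (cases "cmod (y - a) < s")
      case True
      then have "cmod (y - a) \<le> s * exp (- gam s \<rho> y a)" using \<rho> by (intro cmod_le_exp_gam)
      also have "\<dots> \<le> exp (- gam s \<rho> y a)" using \<rho> by (simp add: mult_le_cancel_right2)
      finally have "ln (cmod (y - a)) \<le> - gam s \<rho> y a" using pos by (simp add: ln_le_if_le_exp)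
      then show ?thesis using l by linarith
    next
      case False
      have "cmod (y - a) \<le> cmod y + cmod a" by (rule norm_triangle_ineq4)
      also have "\<dots> \<le> (1 + cmod a) * (1 + cmod y)" by (simp add: algebra_simps)
      finally have "ln (cmod (y - a)) \<le> ln ((1 + cmod a) * (1 + cmod y))"
        using pos 1 by (subst ln_le_cancel_iff) (auto intro: mult_pos_pos)
      then have "ln (cmod (y - a)) \<le> ln (1 + cmod a) + ln (1 + cmod y)"
        using 1 by (simp add: ln_mult_pos)
      moreover have "gam s \<rho> y a = 0" using False \<rho> by (intro gam_eq_0) auto
      ultimately show ?thesis by linarith
    qed
  qed
  also have "\<dots> = (\<Sum>a\<in>#croots P. ln (1 + cmod a)) + degree P * ln (1 + cmod y) - (\<Sum>a\<in>#croots P. ln (cmod (y - a)))"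
    by (simp add: sum_mset_subtractf sum_mset.distrib size_croots)
  also have "\<dots> = ht P + degree P * ln (1 + cmod y) - ln (cmod (poly (of_int_poly P) y))"
    using P nz by (simp add: ln_cmod_poly_of_int ht_def)
  finally show ?thesis by linarith
qed

text \<open>By separation a root lies within s of at most one point x, so at most one term of the
  sum of minima is nonzero. If a and b both lie near x, then |a - b| \<le> 2 s exp(- min) \<le>
  exp(- min). For a = b the last term cancels the sum of minima, which matches ln 0 = 0.\<close>

lemma ln_cmod_diff_le:
  assumes X: "finite X" and sep: "\<And>x y. x \<in> X \<Longrightarrow> y \<in> X \<Longrightarrow> x \<noteq> y \<Longrightarrow> 2 * s \<le> cmod (x - y)"
    and \<rho>: "0 < \<rho>" "\<rho> \<le> s" "s \<le> 1 / 2"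
  shows "ln (cmod (a - b)) \<le> ln (1 + cmod a) + ln (1 + cmod b)
      - (\<Sum>x\<in>X. min (gam s \<rho> x a) (gam s \<rho> x b)) + (if a = b then \<Sum>x\<in>X. gam s \<rho> x a else 0)"
proof (cases "a = b")
  case False
  have pos: "0 < cmod (a - b)" using False by simp
  have 1: "0 < 1 + cmod a" "0 < 1 + cmod b" by (simp_all add: add_pos_nonneg)
  have l: "0 \<le> ln (1 + cmod a)" "0 \<le> ln (1 + cmod b)" by simp_all
  show ?thesis
  proof (cases "\<exists>x\<in>X. min (gam s \<rho> x a) (gam s \<rho> x b) \<noteq> 0")
    case True
    then obtain x where x: "x \<in> X" "min (gam s \<rho> x a) (gam s \<rho> x b) \<noteq> 0" by blast
    define \<mu> where "\<mu> = min (gam s \<rho> x a) (gam s \<rho> x b)"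
    have "0 \<le> gam s \<rho> x a" "0 \<le> gam s \<rho> x b" using \<rho> by (auto intro: gam_nonneg)
    then have "gam s \<rho> x a \<noteq> 0" "gam s \<rho> x b \<noteq> 0" using x(2) by (auto simp: min_def split: if_splits)
    then have near: "cmod (x - a) < s" "cmod (x - b) < s"
      using gam_eq_0[OF \<rho>(1,2)] by (meson not_le)+
    have other: "min (gam s \<rho> y a) (gam s \<rho> y b) = 0" if "y \<in> X - {x}" for y
    proof -
      have "2 * s \<le> cmod (y - x)" using that x(1) by (intro sep) auto
      also have "cmod (y - x) \<le> cmod (y - a) + cmod (x - a)"
        using norm_triangle_ineq4[of "y - a" "x - a"] by simp
      finally have "s \<le> cmod (y - a)" using near by linarith
      then have "gam s \<rho> y a = 0" using \<rho> by (intro gam_eq_0)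
      then show ?thesis using gam_nonneg[OF \<rho>(1,2), of y b] by simp
    qed
    have "(\<Sum>y\<in>X. min (gam s \<rho> y a) (gam s \<rho> y b)) = \<mu> + (\<Sum>y\<in>X - {x}. min (gam s \<rho> y a) (gam s \<rho> y b))"
      unfolding \<mu>_def using X x(1) by (rule sum.remove)
    then have sum_eq: "(\<Sum>y\<in>X. min (gam s \<rho> y a) (gam s \<rho> y b)) = \<mu>" using other by simp
    have "cmod (a - b) \<le> cmod (x - a) + cmod (x - b)"
      using norm_triangle_ineq4[of "x - b" "x - a"] by (simp add: algebra_simps)
    also have "\<dots> \<le> s * exp (- gam s \<rho> x a) + s * exp (- gam s \<rho> x b)"
      using near \<rho> by (intro add_mono cmod_le_exp_gam)
    also have "\<dots> \<le> s * exp (- \<mu>) + s * exp (- \<mu>)"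
      using \<rho> by (intro add_mono mult_left_mono) (auto simp: \<mu>_def)
    also have "\<dots> = 2 * s * exp (- \<mu>)" by simp
    also have "\<dots> \<le> exp (- \<mu>)" using \<rho> by (simp add: mult_le_cancel_right2)
    finally have "ln (cmod (a - b)) \<le> - \<mu>" using pos by (simp add: ln_le_if_le_exp)
    then show ?thesis unfolding sum_eq if_not_P[OF False] using l by linarith
  next
    case no: False
    have "cmod (a - b) \<le> cmod a + cmod b" by (rule norm_triangle_ineq4)
    also have "\<dots> \<le> (1 + cmod a) * (1 + cmod b)" by (simp add: algebra_simps)
    finally have "ln (cmod (a - b)) \<le> ln ((1 + cmod a) * (1 + cmod b))"
      using pos 1 by (subst ln_le_cancel_iff) (auto intro: mult_pos_pos)
    then have "ln (cmod (a - b)) \<le> ln (1 + cmod a) + ln (1 + cmod b)"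
      using 1 by (simp add: ln_mult_pos)
    then show ?thesis using False no by simp
  qed
qed simp

lemma sum_mset_sum_swap: "(\<Sum>a\<in>#A. \<Sum>x\<in>X. f a x) = (\<Sum>x\<in>X. \<Sum>a\<in>#A. f a x :: real)"
  by (induction A) (auto simp: sum.distrib)

lemma sum_mset_if_eq: "(\<Sum>b\<in>#A. if a = b then c else 0) = count A a * (c::real)"
  by (induction A) (auto simp: algebra_simps)

text \<open>The pairwise products \<open>gam a * gam b / B\<close> replace \<open>min (gam a) (gam b)\<close>: this turns the double sum
  over roots into the square of the potential, at the price of the diagonal, which the multiplicity
  bound \<open>T\<close> controls.\<close>

theorem sum_pot_squares_le:
  assumes L: "L \<noteq> 0" and X: "finite X"
    and sep: "\<And>x y. x \<in> X \<Longrightarrow> y \<in> X \<Longrightarrow> x \<noteq> y \<Longrightarrow> 2 * s \<le> cmod (x - y)"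
    and \<rho>: "0 < \<rho>" "\<rho> \<le> s" "s \<le> 1 / 2" and B: "0 < B" "ln s - ln \<rho> \<le> B"
    and T: "\<And>a. real (count (croots L) a) \<le> T"
  shows "(\<Sum>x\<in>X. pot s \<rho> x L * (pot s \<rho> x L / B - T)) \<le> 2 * degree L * ht L"
proof -
  let ?R = "croots L"
  let ?g = "gam s \<rho>"
  have g: "0 \<le> ?g x a" "?g x a \<le> B" for x a
    using \<rho> B gam_nonneg[of \<rho> s x a] gam_le[of \<rho> s x a] by auto
  have min_ge: "?g x a * ?g x b / B \<le> min (?g x a) (?g x b)" for x a b
  proof -
    have "?g x a * ?g x b \<le> ?g x a * B" "?g x a * ?g x b \<le> B * ?g x b"
      using g by (auto intro: mult_left_mono mult_right_mono)
    then show ?thesis using B(1) by (auto simp: divide_le_eq min_def mult.commute)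
  qed
  have pw: "ln (cmod (a - b)) \<le> ln (1 + cmod a) + ln (1 + cmod b)
      - (\<Sum>x\<in>X. ?g x a * ?g x b / B) + (if a = b then \<Sum>x\<in>X. ?g x a else 0)" for a b
    using ln_cmod_diff_le[OF X sep \<rho>, of a b] sum_mono[of X "\<lambda>x. ?g x a * ?g x b / B" "\<lambda>x. min (?g x a) (?g x b)"] min_ge
    by simp
  let ?h = "\<Sum>a\<in>#?R. ln (1 + cmod a)"
  have "energy L L \<le> (\<Sum>a\<in>#?R. \<Sum>b\<in>#?R. ln (1 + cmod a) + ln (1 + cmod b)
      - (\<Sum>x\<in>X. ?g x a * ?g x b / B) + (if a = b then \<Sum>x\<in>X. ?g x a else 0))"
    unfolding energy_def by (intro sum_mset_mono_real pw)
  also have "\<dots> = 2 * degree L * ?h - (\<Sum>a\<in>#?R. \<Sum>b\<in>#?R. \<Sum>x\<in>X. ?g x a * ?g x b / B)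
      + (\<Sum>a\<in>#?R. count ?R a * (\<Sum>x\<in>X. ?g x a))"
  proof -
    have inner: "(\<Sum>b\<in>#?R. ln (1 + cmod a) + ln (1 + cmod b)
        - (\<Sum>x\<in>X. ?g x a * ?g x b / B) + (if a = b then \<Sum>x\<in>X. ?g x a else 0)) =
      degree L * ln (1 + cmod a) + ?h - (\<Sum>b\<in>#?R. \<Sum>x\<in>X. ?g x a * ?g x b / B)
        + count ?R a * (\<Sum>x\<in>X. ?g x a)" for a
      by (simp add: sum_mset_subtractf sum_mset.distrib sum_mset_if_eq size_croots)
    show ?thesis
      unfolding inner
      by (simp only: sum_mset_subtractf sum_mset.distrib sum_mset_cmult_left sum_mset_constant size_croots)
  qed
  also have "(\<Sum>a\<in>#?R. \<Sum>b\<in>#?R. \<Sum>x\<in>X. ?g x a * ?g x b / B) = (\<Sum>x\<in>X. pot s \<rho> x L * pot s \<rho> x L / B)"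
  proof -
    have "(\<Sum>a\<in>#?R. \<Sum>b\<in>#?R. ?g x a * ?g x b / B) = pot s \<rho> x L * pot s \<rho> x L / B" for x
    proof -
      have "(\<Sum>b\<in>#?R. ?g x a * ?g x b / B) = ?g x a * (pot s \<rho> x L / B)" for a
      proof -
        have "(\<Sum>b\<in>#?R. ?g x a * ?g x b / B) = (\<Sum>b\<in>#?R. (?g x a / B) * ?g x b)" by simp
        also have "\<dots> = (?g x a / B) * pot s \<rho> x L" by (simp only: pot_def sum_mset_cmult_left)
        finally show ?thesis by simp
      qed
      then have "(\<Sum>a\<in>#?R. \<Sum>b\<in>#?R. ?g x a * ?g x b / B) = (\<Sum>a\<in>#?R. ?g x a * (pot s \<rho> x L / B))" by simp
      also have "\<dots> = pot s \<rho> x L * (pot s \<rho> x L / B)"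
        by (simp only: sum_mset_cmult_right pot_def[of s \<rho> x L])
      finally show ?thesis by simp
    qed
    then show ?thesis by (simp only: sum_mset_sum_swap)
  qed
  \<comment> \<open>The diagonal: each occurrence of a root meets as many equal entries as its
    multiplicity.\<close>
  also have "(\<Sum>a\<in>#?R. count ?R a * (\<Sum>x\<in>X. ?g x a)) \<le> (\<Sum>a\<in>#?R. T * (\<Sum>x\<in>X. ?g x a))"
    using g T by (intro sum_mset_mono_real mult_right_mono sum_nonneg) auto
  also have "\<dots> = (\<Sum>x\<in>X. T * pot s \<rho> x L)"
  proof -
    have "(\<Sum>a\<in>#?R. T * (\<Sum>x\<in>X. ?g x a)) = T * (\<Sum>a\<in>#?R. \<Sum>x\<in>X. ?g x a)"
      by (simp only: sum_mset_cmult_left)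
    then show ?thesis by (simp only: sum_mset_sum_swap pot_def sum_distrib_left)
  qed
  finally have "energy L L \<le> 2 * degree L * ?h - (\<Sum>x\<in>X. pot s \<rho> x L * pot s \<rho> x L / B) + (\<Sum>x\<in>X. T * pot s \<rho> x L)"
    by simp
  moreover have "0 \<le> 2 * degree L * ln \<bar>lead_coeff L\<bar> + energy L L"
    using energy_lower_bound[OF L L] by simp
  ultimately have "(\<Sum>x\<in>X. pot s \<rho> x L * pot s \<rho> x L / B) - (\<Sum>x\<in>X. T * pot s \<rho> x L) \<le> 2 * degree L * ht L"
    by (simp only: ht_def distrib_left)
  then show ?thesis by (simp add: sum_subtractf[symmetric] algebra_simps)
qed

section \<open>Heavy prime factors\<close>

text \<open>Degree, height, potential and minus the logarithm of the value at a transcendental point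
  all have this property. A strict inequality between two such functions therefore passes from a
  polynomial to one of its prime factors.\<close>

definition additive :: "(int poly \<Rightarrow> real) \<Rightarrow> bool" where
  "additive f \<longleftrightarrow> (\<forall>p q. p \<noteq> 0 \<longrightarrow> q \<noteq> 0 \<longrightarrow> f (p * q) = f p + f q)"

lemma additive_1: "additive f \<Longrightarrow> f 1 = 0"
  unfolding additive_def by (drule spec[of _ 1], drule spec[of _ 1]) simp

lemma additive_unit:
  assumes f: "additive f" and u: "is_unit u"
  shows "f u = 0"
proof -
  obtain c where "u = [:c:]" "is_unit c" using u by (auto simp: is_unit_poly_iff)
  then have "u * u = 1" by (auto simp: zdvd1_eq abs_if split: if_splits)
  moreover have "u \<noteq> 0" using u by auto
  ultimately have "f 1 = f u + f u" using f unfolding additive_def by metis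
  then show ?thesis using additive_1[OF f] by simp
qed

lemma additive_prod_mset:
  assumes "additive f" "0 \<notin># M"
  shows "f (prod_mset M) = (\<Sum>p\<in>#M. f p)"
  using assms(2)
proof (induction M)
  case empty
  then show ?case using additive_1[OF assms(1)] by simp
next
  case (add p M)
  then have "f (p * prod_mset M) = f p + f (prod_mset M)"
    using assms(1) unfolding additive_def by (auto simp: prod_mset_zero_iff)
  with add show ?case by simp
qed

lemma additive_prime_factorization:
  assumes f: "additive f" and S: "S \<noteq> 0"
  shows "f S = (\<Sum>p\<in>#prime_factorization S. f p)"
  using S
proof (induction S rule: prime_divisors_induct)
  case (unit u)
  then show ?case using additive_unit[OF f] by (simp add: prime_factorization_unit)
next
  case (factor p S)
  then have "p \<noteq> 0" "S \<noteq> 0" by auto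
  then show ?case
    using factor f by (simp add: additive_def prime_factorization_mult prime_factorization_prime)
qed simp

lemma exists_prime_factor_gt:
  assumes "additive f" "additive g" "S \<noteq> 0" "g S < f S"
  shows "\<exists>p. p \<in># prime_factorization S \<and> g p < f p"
proof (rule ccontr)
  assume "\<not> ?thesis"
  then have "(\<Sum>p\<in>#prime_factorization S. f p) \<le> (\<Sum>p\<in>#prime_factorization S. g p)"
    by (intro sum_mset_mono_real) (auto simp: not_less)
  then show False using assms additive_prime_factorization by (metis not_le)
qed

lemma additive_degree: "additive (\<lambda>p. real (degree p))"
  by (simp add: additive_def degree_mult_eq)

lemma additive_ht: "additive ht"
  by (simp add: additive_def ht_mult)

lemma additive_pot: "additive (pot s \<rho> y)"
  by (simp add: additive_def pot_mult)

lemma additive_cmult: "additive f \<Longrightarrow> additive (\<lambda>p. c * f p)"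
  by (simp add: additive_def distrib_left)

lemma additive_add: "additive f \<Longrightarrow> additive g \<Longrightarrow> additive (\<lambda>p. f p + g p)"
  by (simp add: additive_def)

lemma ht_le_if_dvd:
  assumes "p dvd q" "q \<noteq> 0"
  shows "ht p \<le> ht q"
proof -
  obtain r where "q = p * r" using assms(1) by blast
  with assms(2) show ?thesis using ht_mult[of p r] ht_nonneg[of r] by auto
qed

section \<open>Multiplicities of roots in products of primes\<close>

lemma croots_prod_mset: "0 \<notin># M \<Longrightarrow> croots (prod_mset M) = (\<Sum>p\<in>#M. croots p)"
proof (induction M)
  case (add p M)
  then show ?case by (simp add: croots_mult prod_mset_zero_iff)
qed (simp add: croots_def)

lemma primes_eq_if_common_root:
  assumes "prime p" "prime q" "a \<in># croots p" "a \<in># croots q"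
  shows "p = q"
proof -
  have "p \<noteq> 0" "q \<noteq> 0" using assms by auto
  then have "p dvd q" using assms prime_elem_dvd_if_common_root[of p a q] by (simp add: in_croots_iff)
  then show ?thesis using assms primes_dvd_imp_eq by blast
qed

lemma count_sum_mset: "count (\<Sum>p\<in>#M. f p) a = (\<Sum>p\<in>#M. count (f p) a)"
  by (induction M) auto

text \<open>Distinct primes have no common root and each has simple roots, so the multiplicity of a
  root is that of its prime.\<close>

lemma count_croots_prod_primes:
  assumes M: "\<And>p. p \<in># M \<Longrightarrow> prime p" and a: "p \<in># M" "a \<in># croots p"
  shows "count (croots (prod_mset M)) a = count M p"
proof -
  have "0 \<notin># M" using M not_prime_0 by blast
  then have "count (croots (prod_mset M)) a = (\<Sum>q\<in>#M. count (croots q) a)"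
    by (simp add: croots_prod_mset count_sum_mset)
  also have "\<dots> = (\<Sum>q\<in>#M. if q = p then 1 else 0)"
  proof (intro arg_cong[of _ _ sum_mset] image_mset_cong)
    fix q assume q: "q \<in># M"
    show "count (croots q) a = (if q = p then 1 else 0)"
    proof (cases "q = p")
      case True
      have "count (croots p) a \<le> 1" using M[OF a(1)] by (intro count_croots_prime_elem) auto
      moreover have "count (croots p) a \<noteq> 0" using a(2) by simp
      ultimately show ?thesis unfolding True if_P[OF refl] by linarith
    next
      case False
      then have "a \<notin># croots q" using primes_eq_if_common_root[OF M[OF q] M[OF a(1)]] a(2) by blast
      then show ?thesis using False by (simp add: not_in_iff)
    qed
  qed
  also have "\<dots> = count M p" by (induction M) auto
  finally show ?thesis .
qed

lemma count_croots_prod_primes_le: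
  assumes M: "\<And>p. p \<in># M \<Longrightarrow> prime p" and T: "0 \<le> T" "\<And>p. p \<in># M \<Longrightarrow> real (count M p) \<le> T"
  shows "real (count (croots (prod_mset M)) a) \<le> T"
proof (cases "\<exists>p. p \<in># M \<and> a \<in># croots p")
  case True
  then obtain p where p: "p \<in># M" "a \<in># croots p" by blast
  then have "count (croots (prod_mset M)) a = count M p" by (intro count_croots_prod_primes[OF M])
  then show ?thesis using T(2)[OF p(1)] by simp
next
  case False
  have "0 \<notin># M" using M not_prime_0 by blast
  then have "count (croots (prod_mset M)) a = (\<Sum>q\<in>#M. count (croots q) a)"
    by (simp add: croots_prod_mset count_sum_mset)
  also have "\<dots> = (\<Sum>q\<in>#M. 0)"
    using False by (intro arg_cong[of _ _ sum_mset] image_mset_cong) (metis count_eq_zero_iff)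
  finally show ?thesis using T(1) by simp
qed

text \<open>If the prime factors of multiplicity at most \<open>T\<close> carried half of the potential of \<open>S\<close> at every point
  of \<open>X\<close>, their product would violate \<open>sum_pot_squares_le\<close>.\<close>

theorem exists_heavy_prime_factor:
  fixes a b E T B s \<rho> :: real
  assumes S: "S \<noteq> 0" and X: "finite X"
    and sep: "\<And>x y. x \<in> X \<Longrightarrow> y \<in> X \<Longrightarrow> x \<noteq> y \<Longrightarrow> 2 * s \<le> cmod (x - y)"
    and \<rho>: "0 < \<rho>" "\<rho> \<le> s" "s \<le> 1 / 2" and B: "0 < B" "ln s - ln \<rho> \<le> B"
    and T: "0 \<le> T" "T \<le> E / (2 * B)" and E: "\<And>x. x \<in> X \<Longrightarrow> E \<le> pot s \<rho> x S"
    and large: "2 * degree S * ht S < card X * (E / 2 * (E / (2 * B) - T))"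
    and ab: "0 \<le> a" "0 \<le> b" "a * degree S + b * ht S < E / 2"
  shows "\<exists>x\<in>X. \<exists>p. prime p \<and> T < count (prime_factorization S) p \<and>
    a * degree p + b * ht p < pot s \<rho> x p"
proof -
  let ?A = "prime_factorization S"
  define M where "M = filter_mset (\<lambda>p. real (count ?A p) \<le> T) ?A"
  define M' where "M' = filter_mset (\<lambda>p. \<not> real (count ?A p) \<le> T) ?A"
  define L where "L = prod_mset M"
  have A: "?A = M + M'" unfolding M_def M'_def by (rule multiset_partition)
  have prime: "prime p" if "p \<in># ?A" for p using that by (auto simp: prime_factors_dvd)
  have M_prime: "prime p" if "p \<in># M" for p using that prime by (auto simp: M_def)
  have M0: "0 \<notin># M" using M_prime not_prime_0 by blast
  have M'0: "0 \<notin># M'" using prime not_prime_0 by (auto simp: M'_def)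
  have L0: "L \<noteq> 0" using M0 by (simp add: L_def prod_mset_zero_iff)
  have M'nz: "prod_mset M' \<noteq> 0" using M'0 by (simp add: prod_mset_zero_iff)
  have split: "f S = f L + f (prod_mset M')" if "additive f" for f
    using additive_prime_factorization[OF that S] additive_prod_mset[OF that M0] additive_prod_mset[OF that M'0]
    by (simp add: A L_def)
  have deg: "real (degree L) \<le> degree S" "real (degree (prod_mset M')) \<le> degree S"
    using split[OF additive_degree] by auto
  have ht: "ht L \<le> ht S" "ht (prod_mset M') \<le> ht S"
    using split[OF additive_ht] ht_nonneg[OF L0] ht_nonneg[OF M'nz] by auto
  have E0: "0 \<le> E / (2 * B)" using T by linarith
  then have E0: "0 \<le> E" using B(1) by (simp add: zero_le_divide_iff)
  \<comment> \<open>For u \<ge> E / 2 the expression u (u / B - T) is at least its value at E / 2,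
    because E / (2 B) \<ge> T. If every point had such a potential, the sum would exceed the bound
    of \<open>sum_pot_squares_le\<close>.\<close>
  have "\<exists>x\<in>X. pot s \<rho> x L \<le> E / 2"
  proof (rule ccontr)
    assume "\<not> ?thesis"
    then have big: "E / 2 < pot s \<rho> x L" if "x \<in> X" for x using that by force
    have cnt: "real (count (croots L) z) \<le> T" for z
      unfolding L_def using M_prime T(1)
      by (intro count_croots_prod_primes_le) (auto simp: M_def)
    have "card X * (E / 2 * (E / (2 * B) - T)) = (\<Sum>x\<in>X. E / 2 * (E / (2 * B) - T))" by simp
    also have "\<dots> \<le> (\<Sum>x\<in>X. pot s \<rho> x L * (pot s \<rho> x L / B - T))"
    proof (intro sum_mono mult_mono)
      fix x assume "x \<in> X"
      note b = big[OF this]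
      show "E / 2 \<le> pot s \<rho> x L" using b by simp
      show "0 \<le> pot s \<rho> x L" using b E0 by linarith
      have "E / 2 / B \<le> pot s \<rho> x L / B" using b B(1) by (intro divide_right_mono) auto
      then show "E / (2 * B) - T \<le> pot s \<rho> x L / B - T" by simp
      show "0 \<le> E / (2 * B) - T" using T by simp
    qed
    also have "\<dots> \<le> 2 * degree L * ht L"
      by (rule sum_pot_squares_le[OF L0 X sep \<rho> B cnt])
    also have "\<dots> \<le> 2 * degree S * ht S"
      using deg ht ht_nonneg[OF L0] by (intro mult_mono) auto
    finally show False using large by simp
  qed
  then obtain x where x: "x \<in> X" "pot s \<rho> x L \<le> E / 2" by blast
  \<comment> \<open>At this x at least half of the potential of S is carried by the primes of
    multiplicity above T, while their product still obeys the degree and height bounds of S.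
    Additivity then selects a single prime.\<close>
  let ?f = "pot s \<rho> x" and ?g = "\<lambda>p. a * degree p + b * ht p"
  have "?g (prod_mset M') \<le> a * degree S + b * ht S"
    using deg ht ab by (intro add_mono mult_left_mono) auto
  also have "\<dots> < E / 2" by (rule ab)
  also have "\<dots> \<le> ?f (prod_mset M')" using split[OF additive_pot, of s \<rho> x] E[OF x(1)] x(2) by simp
  finally have lt: "?g (prod_mset M') < ?f (prod_mset M')" .
  have "additive ?g" by (intro additive_add additive_cmult additive_degree additive_ht)
  have "\<exists>p. p \<in># M' \<and> ?g p < ?f p"
  proof (rule ccontr)
    assume "\<not> ?thesis"
    then have "(\<Sum>p\<in>#M'. ?f p) \<le> (\<Sum>p\<in>#M'. ?g p)"
      by (intro sum_mset_mono_real) (auto simp: not_less)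
    then show False
      using lt additive_prod_mset[OF additive_pot M'0, of s \<rho> x] additive_prod_mset[OF \<open>additive ?g\<close> M'0] by linarith
  qed
  then obtain p where "p \<in># M'" "?g p < ?f p" by blast
  then show ?thesis using x(1) prime by (intro bexI[of _ x] exI[of _ p]) (auto simp: M'_def)
qed

section \<open>Dilates of a polynomial\<close>

lemma pcompose_affine_prod:
  fixes i j :: complex
  assumes "i \<noteq> 0"
  shows "(\<Prod>a\<in>#A. [:-a, 1:]) \<circ>\<^sub>p [:j, i:] = Polynomial.smult (i ^ size A) (\<Prod>a\<in>#A. [:- ((a - j) / i), 1:])"
proof (induction A)
  case (add a A)
  have "[:-a, 1:] \<circ>\<^sub>p [:j, i:] = Polynomial.smult i [:- ((a - j) / i), 1:]"
    using assms by (simp add: pcompose_pCons)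
  then show ?case
    by (simp only: image_mset_add_mset prod_mset.add_mset pcompose_mult add.IH mult_smult_left
        mult_smult_right smult_smult size_add_mset power_Suc mult.commute)
qed simp

lemma proots_prod_linear: "proots (\<Prod>a\<in>#A. [:- (g a), 1:]) = image_mset g (A :: complex multiset)"
proof (induction A)
  case (add a A)
  have "(\<Prod>a\<in>#A. [:- (g a), 1:]) \<noteq> 0" by (auto simp: prod_mset_zero_iff)
  then have "proots ([:- (g a), 1:] * (\<Prod>a\<in>#A. [:- (g a), 1:])) = {#g a#} + image_mset g A"
    by (subst proots_mult) (simp_all only: proots_linear_factor add.IH minus_minus pCons_eq_0_iff, auto)
  then show ?case by simp
qed simp

lemma croots_pcompose:
  assumes P: "P \<noteq> 0" and i: "i \<noteq> 0"
  shows "croots (P \<circ>\<^sub>p [:j, i:]) = image_mset (\<lambda>a. (a - of_int j) / of_int i) (croots P)"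
proof -
  let ?l = "of_int (lead_coeff P) :: complex"
  have "of_int_poly (P \<circ>\<^sub>p [:j, i:]) = (of_int_poly P :: complex poly) \<circ>\<^sub>p [:of_int j, of_int i:]"
    by (simp add: of_int_hom.map_poly_pcompose hom_distribs)
  also have "(of_int_poly P :: complex poly) = Polynomial.smult ?l (\<Prod>a\<in>#croots P. [:-a, 1:])"
    using complex_poly_decompose_multiset[of "of_int_poly P"] by (simp add: croots_def)
  also have "\<dots> \<circ>\<^sub>p [:of_int j, of_int i:] =
      Polynomial.smult (?l * of_int i ^ size (croots P)) (\<Prod>a\<in>#croots P. [:- ((a - of_int j) / of_int i), 1:])"
    using i by (simp only: pcompose_smult pcompose_affine_prod of_int_eq_0_iff not_False_eq_True smult_smult)
  finally have "croots (P \<circ>\<^sub>p [:j, i:]) = proots \<dots>" by (simp add: croots_def)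
  also have "\<dots> = proots (\<Prod>a\<in>#croots P. [:- ((a - of_int j) / of_int i), 1:])"
    using P i by (intro proots_smult) simp
  also have "\<dots> = image_mset (\<lambda>a. (a - of_int j) / of_int i) (croots P)" by (rule proots_prod_linear)
  finally show ?thesis .
qed

lemma pcompose_affine_nonzero:
  fixes P :: "int poly"
  assumes "P \<noteq> 0" "i \<noteq> 0"
  shows "P \<circ>\<^sub>p [:j, i:] \<noteq> 0"
  using assms by (auto simp: pcompose_eq_0_iff)

lemma count_image_mset_inj: "inj f \<Longrightarrow> count (image_mset f M) (f x) = count M x"
  by (induction M) (auto simp: inj_eq)

lemma count_croots_pcompose:
  assumes P: "P \<noteq> 0" and i: "i \<noteq> 0"
  shows "count (croots (P \<circ>\<^sub>p [:j, i:])) z = count (croots P) (of_int i * z + of_int j)"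
proof -
  let ?f = "\<lambda>a. (a - of_int j) / of_int i :: complex"
  define w where "w = of_int i * z + of_int j"
  have inj: "inj ?f" using i by (auto simp: inj_def)
  have fw: "?f w = z" using i by (simp add: w_def)
  have "count (image_mset ?f (croots P)) (?f w) = count (croots P) w"
    by (rule count_image_mset_inj[OF inj])
  then show ?thesis unfolding fw unfolding croots_pcompose[OF assms] w_def .
qed

text \<open>The leading coefficient gains one factor i per root, which clears the denominator in the
  new root: i (1 + |a - j| / i) = i + |a - j| \<le> (i + j) (1 + |a|).\<close>

lemma ht_pcompose_le:
  assumes P: "P \<noteq> 0" and i: "1 \<le> i" and j: "0 \<le> j"
  shows "ht (P \<circ>\<^sub>p [:j, i:]) \<le> ht P + degree P * ln (real_of_int (i + j))"
proof -
  have i0: "i \<noteq> 0" using i by simp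
  have ip: "0 < real_of_int i" using i by simp
  have "lead_coeff (P \<circ>\<^sub>p [:j, i:]) = lead_coeff P * i ^ degree P"
    using i0 by (subst lead_coeff_comp) auto
  then have lead: "ln (real_of_int \<bar>lead_coeff (P \<circ>\<^sub>p [:j, i:])\<bar>) = ln \<bar>lead_coeff P\<bar> + degree P * ln (real_of_int i)"
    using P i by (simp add: abs_mult power_abs ln_mult_pos ln_realpow)
  have "ht (P \<circ>\<^sub>p [:j, i:]) = ln \<bar>lead_coeff P\<bar> + degree P * ln (real_of_int i) + (\<Sum>a\<in>#croots P. ln (1 + cmod ((a - of_int j) / of_int i)))"
    unfolding ht_def lead by (simp add: croots_pcompose[OF P i0] multiset.map_comp comp_def)
  also have "\<dots> = ln \<bar>lead_coeff P\<bar> + (\<Sum>a\<in>#croots P. ln (real_of_int i) + ln (1 + cmod ((a - of_int j) / of_int i)))"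
    by (simp add: sum_mset.distrib size_croots)
  also have "\<dots> \<le> ln \<bar>lead_coeff P\<bar> + (\<Sum>a\<in>#croots P. ln (real_of_int (i + j)) + ln (1 + cmod a))"
  proof (intro add_left_mono sum_mset_mono_real)
    fix a
    have 1: "0 < 1 + cmod ((a - of_int j) / of_int i)" "0 < 1 + cmod a" by (simp_all add: add_pos_nonneg)
    have "ln (real_of_int i) + ln (1 + cmod ((a - of_int j) / of_int i)) = ln (i * (1 + cmod ((a - of_int j) / of_int i)))"
      using ip 1 by (simp add: ln_mult_pos)
    also have "i * (1 + cmod ((a - of_int j) / of_int i)) = i + cmod (a - of_int j)"
      using ip by (simp add: norm_divide distrib_left)
    also have "ln (i + cmod (a - of_int j)) \<le> ln ((i + j) * (1 + cmod a))"
    proof (subst ln_le_cancel_iff)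
      have "cmod (a - of_int j) \<le> cmod a + j" using norm_triangle_ineq4[of a "of_int j"] j by simp
      moreover have "1 * cmod a \<le> (real_of_int i + j) * cmod a" using i j by (intro mult_right_mono) auto
      ultimately show "i + cmod (a - of_int j) \<le> (i + j) * (1 + cmod a)" by (simp add: algebra_simps)
      show "0 < i + cmod (a - of_int j)" using ip by (simp add: add_pos_nonneg)
      show "0 < real_of_int (i + j) * (1 + cmod a)" using i j 1 by (intro mult_pos_pos) auto
    qed
    also have "\<dots> = ln (real_of_int (i + j)) + ln (1 + cmod a)" using i j 1 by (subst ln_mult_pos) auto
    finally show "ln (real_of_int i) + ln (1 + cmod ((a - of_int j) / of_int i)) \<le> ln (real_of_int (i + j)) + ln (1 + cmod a)" .
  qed
  also have "\<dots> = ht P + degree P * ln (real_of_int (i + j))"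
    by (simp add: ht_def sum_mset.distrib size_croots)
  finally show ?thesis .
qed

text \<open>For n at least the degree and i nonzero, this is i^n p((u T + m) / i) written without
  denominators, so that it remains an integer polynomial.\<close>

definition scaled_affine :: "nat \<Rightarrow> int \<Rightarrow> int \<Rightarrow> int \<Rightarrow> int poly \<Rightarrow> int poly" where
  "scaled_affine n i u m p = (\<Sum>k\<le>n. Polynomial.smult (coeff p k * i ^ (n - k)) ([:m, u:] ^ k))"

lemma poly_scaled_affine:
  assumes "degree p \<le> n" "i \<noteq> 0"
  shows "poly (of_int_poly (scaled_affine n i u m p)) (z :: complex) =
    of_int i ^ n * poly (of_int_poly p) ((of_int u * z + of_int m) / of_int i)"
proof -
  have "poly (of_int_poly (scaled_affine n i u m p)) z =
      (\<Sum>k\<le>n. of_int (coeff p k) * of_int i ^ (n - k) * (of_int m + of_int u * z) ^ k)"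
    by (simp add: scaled_affine_def hom_distribs poly_sum mult.commute[of z])
  also have "\<dots> = (\<Sum>k\<le>n. of_int i ^ n * (of_int (coeff p k) * ((of_int u * z + of_int m) / of_int i) ^ k))"
    using assms(2) by (intro sum.cong) (auto simp: power_divide power_diff add.commute)
  also have "\<dots> = of_int i ^ n * (\<Sum>k\<le>n. coeff (of_int_poly p) k * ((of_int u * z + of_int m) / of_int i) ^ k)"
    by (simp add: sum_distrib_left)
  also have "(\<Sum>k\<le>n. coeff (of_int_poly p) k * ((of_int u * z + of_int m) / of_int i) ^ k) =
      poly (of_int_poly p) ((of_int u * z + of_int m) / of_int i)"
    unfolding poly_altdef using assms(1) by (intro sum.mono_neutral_right) (auto simp: coeff_eq_0)
  finally show ?thesis .
qed

text \<open>If an affine map with rational coefficients sends one root of an irreducible polynomial to a root, it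
  permutes all of them, so it has finite order there; with a positive ratio other than 1 that forces a fixed point.\<close>

lemma conjugate_affine_images:
  assumes p: "prime_elem p" and i: "0 < i" "0 < i'"
    and root: "poly (of_int_poly p) (of_int i * z + of_int j) = 0"
      "poly (of_int_poly p) (of_int i' * z + of_int j' :: complex) = 0"
  shows "(i = i' \<and> j = j') \<or> of_int i * z + of_int j = of_int i' * z + of_int j'"
proof -
  have p0: "p \<noteq> 0" using p by auto
  define b where "b = of_int i * z + of_int j"
  define l :: complex where "l = of_int i' / of_int i"
  define c :: complex where "c = (of_int (i * j' - i' * j)) / of_int i"
  \<comment> \<open>The affine map that takes i z + j to i' z + j'.\<close>
  define \<sigma> where "\<sigma> = (\<lambda>w. l * w + c)"
  define G where "G = scaled_affine (degree p) i i' (i * j' - i' * j) p"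
  have G: "poly (of_int_poly G) w = of_int i ^ degree p * poly (of_int_poly p) (\<sigma> w)" for w
    using i by (simp add: G_def poly_scaled_affine \<sigma>_def l_def c_def add_divide_distrib)
  have \<sigma>b: "\<sigma> b = of_int i' * z + of_int j'"
    using i by (simp add: \<sigma>_def l_def c_def b_def field_simps)
  have "poly (of_int_poly G) b = 0" using root(2) by (simp add: G \<sigma>b)
  \<comment> \<open>One root mapped to a root gives a common root of p and p o \<sigma> (up to a
    constant), so irreducibility makes \<sigma> map every root of p to a root.\<close>
  then have "p dvd G" using prime_elem_dvd_if_common_root[OF p, of b G] root(1) by (simp add: b_def)
  then have "(of_int_poly p :: complex poly) dvd of_int_poly G" by (rule of_int_poly_hom.hom_dvd)
  then have closed: "poly (of_int_poly p) (\<sigma> w) = 0" if "poly (of_int_poly p) w = 0" for w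
    using that G[of w] i by (auto elim!: dvdE)
  have iter: "poly (of_int_poly p) ((\<sigma> ^^ k) b) = 0" for k
    by (induction k) (auto simp: closed root(1) b_def)
  have "finite {w. poly (of_int_poly p) w = (0::complex)}" using p0 by (intro poly_roots_finite) simp
  moreover have "range (\<lambda>k. (\<sigma> ^^ k) b) \<subseteq> {w. poly (of_int_poly p) w = 0}" using iter by auto
  ultimately have "finite (range (\<lambda>k. (\<sigma> ^^ k) b))" by (rule rev_finite_subset)
  then have "\<not> inj (\<lambda>k. (\<sigma> ^^ k) b)" using finite_imageD infinite_UNIV_nat by blast
  \<comment> \<open>The orbit of b stays among finitely many roots, so it repeats. For ratio 1 this
    makes the translation trivial; otherwise b must be the fixed point \<open>z0\<close>.\<close>
  then obtain k k' where kk: "k \<noteq> k'" "(\<sigma> ^^ k) b = (\<sigma> ^^ k') b" by (auto simp: inj_def)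
  show ?thesis
  proof (cases "i = i'")
    case True
    then have l1: "l = 1" using i by (simp add: l_def)
    have "(\<sigma> ^^ k) b = b + of_nat k * c" for k
      by (induction k) (auto simp: \<sigma>_def l1 algebra_simps)
    then have "c = 0" using kk by simp
    then have "complex_of_int (i * j' - i' * j) = 0" using i by (simp add: c_def)
    then have "i * j' = i' * j" by (simp only: of_int_eq_0_iff right_minus_eq)
    then show ?thesis using True i by simp
  next
    case False
    have l1: "l \<noteq> 1" using False i by (simp add: l_def)
    define z0 where "z0 = c / (1 - l)"
    have fix0: "l * z0 + c = z0" using l1 by (simp add: z0_def field_simps)
    have pow: "(\<sigma> ^^ k) b - z0 = l ^ k * (b - z0)" for k
    proof (induction k)
      case (Suc k)
      have "(\<sigma> ^^ Suc k) b - z0 = l * (\<sigma> ^^ k) b + c - (l * z0 + c)" by (simp add: \<sigma>_def fix0)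
      also have "\<dots> = l * ((\<sigma> ^^ k) b - z0)" by (simp add: algebra_simps)
      finally show ?case by (simp add: Suc)
    qed simp
    \<comment> \<open>The ratio is a positive real other than 1, hence not a root of unity: taking
      logarithms would give k = k'.\<close>
    have "l ^ k \<noteq> l ^ k'"
    proof
      assume eq: "l ^ k = l ^ k'"
      have l: "l = of_real (of_int i' / of_int i)" by (simp add: l_def)
      have "(real_of_int i' / of_int i) ^ k = (of_int i' / of_int i) ^ k'"
        using eq unfolding l of_real_power[symmetric] of_real_eq_iff .
      then have "k * ln (real_of_int i' / of_int i) = k' * ln (real_of_int i' / of_int i)"
        using i by (metis divide_pos_pos ln_realpow of_int_0_less_iff)
      moreover have "ln (real_of_int i' / of_int i) \<noteq> 0" using i False by (simp add: ln_div)
      ultimately show False using kk(1) by simp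
    qed
    then have "b = z0" using pow[of k] pow[of k'] kk(2) by simp
    then have "\<sigma> b = b" using fix0 by (simp add: \<sigma>_def)
    then have "b = of_int i' * z + of_int j'" using \<sigma>b by simp
    then show ?thesis by (simp add: b_def)
  qed
qed

lemma poly_of_int_linear: "poly (of_int_poly [:m, u:]) z = of_int m + of_int u * (z :: complex)"
  by (simp add: hom_distribs mult.commute)

lemma ht_linear:
  assumes "u \<noteq> 0"
  shows "ht [:m, u:] = ln (real_of_int (\<bar>u\<bar> + \<bar>m\<bar>))"
proof -
  have "of_int_poly [:m, u:] = Polynomial.smult (of_int u) [:of_int m / of_int u, 1 :: complex:]"
    using assms by (simp add: hom_distribs)
  then have "croots [:m, u:] = proots [:of_int m / of_int u, 1 :: complex:]"
    using assms unfolding croots_def by (simp only: proots_smult of_int_eq_0_iff not_False_eq_True)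
  also have "\<dots> = {#- (of_int m / of_int u)#}" by (rule proots_linear_factor)
  finally have "ht [:m, u:] = ln \<bar>real_of_int u\<bar> + ln (1 + \<bar>real_of_int m\<bar> / \<bar>real_of_int u\<bar>)"
    using assms by (simp add: ht_def norm_divide)
  also have "\<dots> = ln (\<bar>real_of_int u\<bar> * (1 + \<bar>real_of_int m\<bar> / \<bar>real_of_int u\<bar>))"
    using assms by (subst ln_mult_pos) (auto simp: add_pos_nonneg)
  also have "\<bar>real_of_int u\<bar> * (1 + \<bar>real_of_int m\<bar> / \<bar>real_of_int u\<bar>) = \<bar>u\<bar> + \<bar>m\<bar>"
    using assms by (simp add: distrib_left)
  finally show ?thesis by simp
qed

lemma sum_count_le_sum_mset:
  fixes f :: "'a \<Rightarrow> real"
  assumes "finite A" "\<And>a. a \<in># M \<Longrightarrow> 0 \<le> f a"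
  shows "(\<Sum>a\<in>A. count M a * f a) \<le> (\<Sum>a\<in>#M. f a)"
proof -
  have "(\<Sum>a\<in>A. count M a * f a) = (\<Sum>b\<in>#M. if b \<in> A then f b else 0)"
  proof (induction M)
    case (add b M)
    have "(\<Sum>a\<in>A. count (add_mset b M) a * f a) = (\<Sum>a\<in>A. count M a * f a + (if a = b then f a else 0))"
      by (intro sum.cong) (auto simp: algebra_simps)
    also have "\<dots> = (\<Sum>a\<in>A. count M a * f a) + (if b \<in> A then f b else 0)"
      using assms(1) by (simp add: sum.distrib)
    finally show ?case using add by simp
  qed simp
  also have "\<dots> \<le> (\<Sum>b\<in>#M. f b)"
    using assms(2) by (intro sum_mset_mono_real) auto
  finally show ?thesis .
qed

lemma croots_prod_prime_factorization:
  assumes "P \<noteq> 0"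
  shows "croots (prod_mset (prime_factorization P)) = croots P"
  using assms
proof (induction P rule: prime_divisors_induct)
  case (unit u)
  then have "degree u = 0" by (auto simp: is_unit_poly_iff)
  then show ?case using unit by (simp add: prime_factorization_unit croots_degree_0)
next
  case (factor p P)
  then have "p \<noteq> 0" "P \<noteq> 0" by auto
  moreover have "prod_mset (prime_factorization P) \<noteq> 0" by (auto simp: prod_mset_zero_iff)
  ultimately show ?case
    using factor by (simp add: prime_factorization_mult prime_factorization_prime croots_mult)
qed simp

text \<open>Fix a root \<alpha> of q. The multiplicity of q in the dilate with indices (i, j) is
  that in P of the prime having i \<alpha> + j as a root. If these primes differ for different (i,
  j), their multiplicities add up inside the factorization of P, and each of them is at least as
  large as q up to a logarithm. If two coincide, \<open>conjugate_affine_images\<close> makes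
  \<alpha> rational.\<close>

theorem prime_factor_of_dilates_bounds:
  fixes P q :: "int poly" and K :: "(int \<times> int) set"
  assumes P: "P \<noteq> 0" and IJ: "1 \<le> I + J" and K: "finite K" "\<And>i j. (i, j) \<in> K \<Longrightarrow> 1 \<le> i \<and> i \<le> I \<and> 1 \<le> j \<and> j \<le> J"
    and S: "S = (\<Prod>(i, j)\<in>K. P \<circ>\<^sub>p [:j, i:])" and q: "prime q" "0 < degree q"
    and N: "N = count (prime_factorization S) q"
  shows "(degree q \<le> 1 \<and> ht q \<le> ln (real_of_int (I + J))) \<or>
    (real N * degree q \<le> degree P \<and> real N * ht q \<le> ht P + degree P * ln (real_of_int (I + J)))"
proof -
  let ?F = "\<lambda>(i, j). P \<circ>\<^sub>p [:j, i:]"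
  let ?A = "prime_factorization P"
  have q0: "q \<noteq> 0" using q by auto
  have F0: "?F k \<noteq> 0" if "k \<in> K" for k
  proof -
    obtain i j where ij: "k = (i, j)" by (cases k)
    then have "i \<noteq> 0" using K(2)[of i j] that by auto
    then show ?thesis unfolding ij prod.case by (rule pcompose_affine_nonzero[OF P])
  qed
  define \<mu> where "\<mu> = (\<lambda>k. count (prime_factorization (?F k)) q)"
  have N_eq: "N = (\<Sum>k\<in>K. \<mu> k)"
  proof -
    have "prime_factorization S = (\<Sum>k\<in>K. prime_factorization (?F k))"
      unfolding S using K(1) F0 by (intro prime_factorization_prod) (auto simp del: split_paired_All)
    then show ?thesis by (simp add: N \<mu>_def count_sum)
  qed
  obtain \<alpha> where \<alpha>: "\<alpha> \<in># croots q"
    using q(2) size_croots[of q] by (metis less_irrefl multiset_nonemptyE size_empty)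
  define K' where "K' = {k \<in> K. 0 < \<mu> k}"
  have K': "finite K'" "K' \<subseteq> K" using K(1) by (auto simp: K'_def)
  define pt where "pt = (\<lambda>(i, j). of_int i * \<alpha> + of_int j :: complex)"
  have ex: "\<exists>p. prime p \<and> p \<in># ?A \<and> pt k \<in># croots p \<and> \<mu> k \<le> count ?A p \<and>
      degree q \<le> degree p \<and> ht q \<le> ht p + degree p * ln (real_of_int (I + J))" if k: "k \<in> K'" for k
  proof -
    obtain i j where ij: "k = (i, j)" by (cases k)
    have bnd: "1 \<le> i" "i \<le> I" "1 \<le> j" "j \<le> J" using k K(2) ij K' by blast+
    let ?f = "P \<circ>\<^sub>p [:j, i:]"
    have f0: "?f \<noteq> 0" using F0[of k] k K' ij by auto
    have "\<mu> k = count (prime_factorization ?f) q" by (simp add: \<mu>_def ij)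
    also have "\<dots> = count (croots (prod_mset (prime_factorization ?f))) \<alpha>"
      using k \<alpha> by (intro count_croots_prod_primes[symmetric]) (auto simp: K'_def \<mu>_def ij prime_factors_dvd)
    also have "croots (prod_mset (prime_factorization ?f)) = croots ?f"
      by (rule croots_prod_prime_factorization[OF f0])
    also have "count (croots ?f) \<alpha> = count (croots P) (pt k)"
      using bnd by (simp add: count_croots_pcompose[OF P] pt_def ij)
    finally have \<mu>: "\<mu> k = count (croots (prod_mset ?A)) (pt k)"
      by (simp add: croots_prod_prime_factorization[OF P])
    have "0 < \<mu> k" using k by (simp add: K'_def)
    then have "pt k \<in># croots (prod_mset ?A)" unfolding \<mu> by (simp only: count_greater_zero_iff)
    moreover have "croots (prod_mset ?A) = (\<Sum>p\<in>#?A. croots p)" by (rule croots_prod_mset) simp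
    ultimately obtain p where p: "p \<in># ?A" "pt k \<in># croots p" by auto
    have pp: "prime p" using p(1) by (auto simp: prime_factors_dvd)
    then have p0: "p \<noteq> 0" by auto
    have \<mu>p: "\<mu> k = count ?A p"
      unfolding \<mu> using p by (intro count_croots_prod_primes) (auto simp: prime_factors_dvd)
    \<comment> \<open>The dilate of p vanishes at \<alpha>, so q divides it; this bounds degree and
      height of q by those of p.\<close>
    have dv: "q dvd p \<circ>\<^sub>p [:j, i:]"
    proof (rule prime_elem_dvd_if_common_root)
      have "0 < count (croots (p \<circ>\<^sub>p [:j, i:])) \<alpha>"
        using p(2) bnd by (simp add: count_croots_pcompose[OF p0] pt_def ij)
      then show "poly (of_int_poly (p \<circ>\<^sub>p [:j, i:])) \<alpha> = 0"
        using in_croots_iff[OF pcompose_affine_nonzero[OF p0]] bnd by simp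
      show "poly (of_int_poly q) \<alpha> = 0" using \<alpha> in_croots_iff[OF q0] by simp
    qed (use q in auto)
    have pc0: "p \<circ>\<^sub>p [:j, i:] \<noteq> 0" using p0 bnd by (intro pcompose_affine_nonzero) auto
    note dvd_imp_degree_le[OF dv pc0] ht_le_if_dvd[OF dv pc0]
    moreover have "degree (p \<circ>\<^sub>p [:j, i:]) = degree p" using bnd by simp
    moreover have "ht (p \<circ>\<^sub>p [:j, i:]) \<le> ht p + degree p * ln (real_of_int (i + j))"
      using p0 bnd by (intro ht_pcompose_le) auto
    moreover have "degree p * ln (real_of_int (i + j)) \<le> degree p * ln (real_of_int (I + J))"
      using bnd by (intro mult_left_mono) auto
    ultimately show ?thesis using p pp \<mu>p by (intro exI[of _ p]) auto
  qed
  then obtain f where f: "\<And>k. k \<in> K' \<Longrightarrow> prime (f k) \<and> f k \<in># ?A \<and> pt k \<in># croots (f k) \<and>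
      \<mu> k \<le> count ?A (f k) \<and> degree q \<le> degree (f k) \<and> ht q \<le> ht (f k) + degree (f k) * ln (real_of_int (I + J))"
    by metis
  show ?thesis
  proof (cases "inj_on f K'")
    case True
    \<comment> \<open>Injectivity of f prevents one prime of P from being charged for two
      dilates.\<close>
    have main: "real N * c \<le> (\<Sum>p\<in>#?A. g p)" if c: "0 \<le> c" "\<And>k. k \<in> K' \<Longrightarrow> c \<le> g (f k)"
      and g: "\<And>p. p \<in># ?A \<Longrightarrow> 0 \<le> g p" for c and g :: "int poly \<Rightarrow> real"
    proof -
      have "N = (\<Sum>k\<in>K'. \<mu> k)"
        unfolding N_eq K'_def using K(1) by (intro sum.mono_neutral_right) auto
      then have "real N * c = (\<Sum>k\<in>K'. \<mu> k * c)" by (simp add: sum_distrib_right)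
      also have "\<dots> \<le> (\<Sum>k\<in>K'. count ?A (f k) * g (f k))"
        using f c by (intro sum_mono mult_mono) auto
      also have "\<dots> = (\<Sum>p\<in>f ` K'. count ?A p * g p)" using True by (simp add: sum.reindex)
      also have "\<dots> \<le> (\<Sum>p\<in>#?A. g p)" using K' g by (intro sum_count_le_sum_mset) auto
      finally show ?thesis .
    qed
    have A0: "p \<noteq> 0" if "p \<in># ?A" for p using that by auto
    have "real N * degree q \<le> (\<Sum>p\<in>#?A. real (degree p))" using f by (intro main) auto
    moreover have "real N * ht q \<le> (\<Sum>p\<in>#?A. ht p + degree p * ln (real_of_int (I + J)))"
    proof (rule main)
      show "0 \<le> ht q" using q0 by (rule ht_nonneg)
      show "0 \<le> ht p + degree p * ln (real_of_int (I + J))" if "p \<in># ?A" for p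
        using IJ ht_nonneg[OF A0[OF that]] by simp
    qed (use f in auto)
    moreover have "(\<Sum>p\<in>#?A. ht p + degree p * ln (real_of_int (I + J))) = ht P + degree P * ln (real_of_int (I + J))"
      by (simp add: sum_mset.distrib sum_mset_cmult_right additive_prime_factorization[OF additive_ht P]
          additive_prime_factorization[OF additive_degree P])
    moreover have "(\<Sum>p\<in>#?A. real (degree p)) = degree P"
      by (simp add: additive_prime_factorization[OF additive_degree P])
    ultimately show ?thesis by simp
  next
    case False
    then obtain k k' where kk: "k \<in> K'" "k' \<in> K'" "k \<noteq> k'" "f k = f k'" by (auto simp: inj_on_def)
    obtain i j where ij: "k = (i, j)" by (cases k)
    obtain i' j' where ij': "k' = (i', j')" by (cases k')
    have bnd: "1 \<le> i" "i \<le> I" "1 \<le> j" "j \<le> J" "1 \<le> i'" "i' \<le> I" "1 \<le> j'" "j' \<le> J"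
      using kk K(2) ij ij' K' by blast+
    have p: "prime (f k)" using f kk by blast
    then have p0: "f k \<noteq> 0" by auto
    have "pt k \<in># croots (f k)" "pt k' \<in># croots (f k)" using f kk by metis+
    then have "poly (of_int_poly (f k)) (of_int i * \<alpha> + of_int j) = 0" "poly (of_int_poly (f k)) (of_int i' * \<alpha> + of_int j') = 0"
      using in_croots_iff[OF p0] by (auto simp: pt_def ij ij')
    then have eq: "of_int i * \<alpha> + of_int j = of_int i' * \<alpha> + of_int j'"
      using conjugate_affine_images[of "f k" i i' \<alpha> j j'] p bnd kk(3) ij ij' by auto
    have ii: "i \<noteq> i'"
    proof
      assume "i = i'"
      with eq have "complex_of_int j = of_int j'" by simp
      then show False using \<open>i = i'\<close> kk(3) ij ij' by simp
    qed
    \<comment> \<open>The coincidence i \<alpha> + j = i' \<alpha> + j' is a linear equation for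
      \<alpha>, so q divides this polynomial.\<close>
    let ?l = "[:j - j', i - i':]"
    have "poly (of_int_poly ?l) \<alpha> = (of_int i * \<alpha> + of_int j) - (of_int i' * \<alpha> + of_int j')"
      unfolding poly_of_int_linear by (simp add: algebra_simps)
    then have "poly (of_int_poly ?l) \<alpha> = 0" using eq by simp
    then have "q dvd ?l"
      using prime_elem_dvd_if_common_root[of q \<alpha> ?l] q \<alpha> in_croots_iff[OF q0] by auto
    moreover have "?l \<noteq> 0" using ii by simp
    ultimately have "degree q \<le> degree ?l" "ht q \<le> ht ?l"
      by (blast intro: dvd_imp_degree_le ht_le_if_dvd)+
    moreover have "degree ?l = 1" using ii by simp
    moreover have "ht ?l \<le> ln (real_of_int (I + J))"
    proof -
      have "ht ?l = ln (real_of_int (\<bar>i - i'\<bar> + \<bar>j - j'\<bar>))" using ii by (subst ht_linear) auto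
      also have "\<dots> \<le> ln (real_of_int (I + J))"
      proof (subst ln_le_cancel_iff)
        have "0 < \<bar>i - i'\<bar> + \<bar>j - j'\<bar>" using ii by linarith
        then show "0 < real_of_int (\<bar>i - i'\<bar> + \<bar>j - j'\<bar>)" by (simp only: of_int_0_less_iff)
        show "0 < real_of_int (I + J)" using bnd by simp
        have "\<bar>i - i'\<bar> + \<bar>j - j'\<bar> \<le> I + J" using bnd by linarith
        then show "real_of_int (\<bar>i - i'\<bar> + \<bar>j - j'\<bar>) \<le> real_of_int (I + J)" by (simp only: of_int_le_iff)
      qed
      finally show ?thesis .
    qed
    ultimately show ?thesis by simp
  qed
qed

section \<open>Gelfond's criterion\<close>

text \<open>Compare the distances to \<open>\<xi>\<close>: if the root of \<open>p\<close> nearest to \<open>\<xi>\<close> is at least as near as every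
  root of \<open>q\<close>, then the factors of the resultant at that root are at most \<open>2 |\<xi> - b|\<close>.\<close>

lemma minus_ln_le_if_nearest:
  assumes p: "p \<noteq> 0" and q: "q \<noteq> 0" and disj: "\<And>a b. a \<in># croots p \<Longrightarrow> b \<in># croots q \<Longrightarrow> a \<noteq> b"
    and a0: "a0 \<in># croots p" and near: "\<And>b. b \<in># croots q \<Longrightarrow> cmod (\<xi> - a0) \<le> cmod (\<xi> - b)"
    and nz: "poly (of_int_poly q) \<xi> \<noteq> 0"
  shows "- ln (cmod (poly (of_int_poly q) \<xi>)) \<le> degree q * ht p + degree p * ht q + degree q * ln 2"
proof -
  define M where "M = croots p - {#a0#}"
  have M: "croots p = add_mset a0 M" using a0 by (simp add: M_def)
  have Mp: "a \<in># croots p" if "a \<in># M" for a using that M by simp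
  let ?R = "croots q"
  let ?hq = "\<Sum>b\<in>#?R. ln (1 + cmod b)"
  have lead: "0 \<le> ln (real_of_int \<bar>lead_coeff q\<bar>)" by (rule ln_lead_nonneg[OF q])
  have sz: "real (size M) \<le> degree p" using size_croots[of p] by (simp add: M)
  have hq: "0 \<le> ?hq" by (intro sum_mset_nonneg_real) simp
  have "(\<Sum>b\<in>#?R. ln (cmod (a0 - b))) \<le> (\<Sum>b\<in>#?R. ln 2 + ln (cmod (\<xi> - b)))"
  proof (rule sum_mset_mono_real)
    fix b assume b: "b \<in># ?R"
    have pos: "0 < cmod (\<xi> - b)" "0 < cmod (a0 - b)"
      using b nz in_croots_iff[OF q] disj[OF a0 b] by auto
    have "cmod (a0 - b) \<le> cmod (\<xi> - b) + cmod (\<xi> - a0)"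
      using norm_triangle_ineq4[of "\<xi> - b" "\<xi> - a0"] by simp
    also have "\<dots> \<le> 2 * cmod (\<xi> - b)" using near[OF b] by simp
    finally have "ln (cmod (a0 - b)) \<le> ln (2 * cmod (\<xi> - b))" using pos by (subst ln_le_cancel_iff) auto
    then show "ln (cmod (a0 - b)) \<le> ln 2 + ln (cmod (\<xi> - b))" using pos by (simp add: ln_mult_pos)
  qed
  also have "\<dots> = degree q * ln 2 + (ln (cmod (poly (of_int_poly q) \<xi>)) - ln \<bar>lead_coeff q\<bar>)"
    using ln_cmod_poly_of_int[OF q nz] by (simp add: sum_mset.distrib size_croots)
  finally have 1: "(\<Sum>b\<in>#?R. ln (cmod (a0 - b))) \<le> degree q * ln 2 + ln (cmod (poly (of_int_poly q) \<xi>))"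
    using lead by linarith
  have "(\<Sum>a\<in>#M. \<Sum>b\<in>#?R. ln (cmod (a - b))) \<le> (\<Sum>a\<in>#M. \<Sum>b\<in>#?R. ln (1 + cmod a) + ln (1 + cmod b))"
  proof (intro sum_mset_mono_real)
    fix a b assume "a \<in># M" "b \<in># ?R"
    then have pos: "0 < cmod (a - b)" using disj Mp by force
    have o: "0 < 1 + cmod a" "0 < 1 + cmod b" by (simp_all add: add_pos_nonneg)
    have "cmod (a - b) \<le> cmod a + cmod b" by (rule norm_triangle_ineq4)
    also have "\<dots> \<le> (1 + cmod a) * (1 + cmod b)" by (simp add: algebra_simps)
    finally have "ln (cmod (a - b)) \<le> ln ((1 + cmod a) * (1 + cmod b))"
      using pos o by (subst ln_le_cancel_iff) (auto intro: mult_pos_pos)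
    then show "ln (cmod (a - b)) \<le> ln (1 + cmod a) + ln (1 + cmod b)"
      using o by (simp add: ln_mult_pos)
  qed
  also have "\<dots> = degree q * (\<Sum>a\<in>#M. ln (1 + cmod a)) + size M * ?hq"
  proof -
    have "(\<Sum>b\<in>#?R. ln (1 + cmod a) + ln (1 + cmod b)) = degree q * ln (1 + cmod a) + ?hq" for a
      by (simp add: sum_mset.distrib size_croots)
    then show ?thesis by (simp only: sum_mset.distrib sum_mset_cmult_left sum_mset_constant)
  qed
  also have "\<dots> \<le> degree q * (\<Sum>a\<in>#croots p. ln (1 + cmod a)) + degree p * ?hq"
    using sz hq by (intro add_mono mult_left_mono mult_right_mono) (auto simp: M)
  finally have 2: "(\<Sum>a\<in>#M. \<Sum>b\<in>#?R. ln (cmod (a - b))) \<le> degree q * (\<Sum>a\<in>#croots p. ln (1 + cmod a)) + degree p * ?hq" .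
  have "energy p q = (\<Sum>b\<in>#?R. ln (cmod (a0 - b))) + (\<Sum>a\<in>#M. \<Sum>b\<in>#?R. ln (cmod (a - b)))"
    by (simp add: energy_def M)
  then have "0 \<le> degree q * ln \<bar>lead_coeff p\<bar> + degree p * ln \<bar>lead_coeff q\<bar> +
      (degree q * ln 2 + ln (cmod (poly (of_int_poly q) \<xi>)) + (degree q * (\<Sum>a\<in>#croots p. ln (1 + cmod a)) + degree p * ?hq))"
    using energy_lower_bound[OF p q] 1 2 by linarith
  then have "- ln (cmod (poly (of_int_poly q) \<xi>)) \<le> degree q * (ln \<bar>lead_coeff p\<bar> + (\<Sum>a\<in>#croots p. ln (1 + cmod a)))
      + degree p * (ln \<bar>lead_coeff q\<bar> + ?hq) + degree q * ln 2"
    by (simp only: distrib_left)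
  then show ?thesis by (simp only: ht_def)
qed

text \<open>Compare the roots of p and q nearest to \<xi>. If the nearer one belongs to p, the value
  of q at \<xi> is bounded below, and conversely; which of the two values is controlled is not known
  in advance, hence the minimum.\<close>

lemma distinct_primes_not_both_small:
  assumes p: "prime p" "0 < degree p" and q: "prime q" "0 < degree q" and neq: "p \<noteq> q"
    and nz: "poly (of_int_poly p) \<xi> \<noteq> 0" "poly (of_int_poly q) \<xi> \<noteq> 0"
  shows "min (- ln (cmod (poly (of_int_poly p) \<xi>))) (- ln (cmod (poly (of_int_poly q) \<xi>)))
    \<le> degree q * ht p + degree p * ht q + (degree p + degree q)"
proof -
  have p0: "p \<noteq> 0" and q0: "q \<noteq> 0" using p q by auto
  have disj: "a \<noteq> b" if "a \<in># croots p" "b \<in># croots q" for a b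
    using primes_eq_if_common_root[OF p(1) q(1)] neq that by metis
  have nearest: "\<exists>a\<in>#croots r. \<forall>b\<in>#croots r. cmod (\<xi> - a) \<le> cmod (\<xi> - b)" if "0 < degree r" for r
  proof -
    have "set_mset (croots r) \<noteq> {}" using that size_croots[of r] by auto
    then obtain a where "is_arg_min (\<lambda>a. cmod (\<xi> - a)) (\<lambda>a. a \<in> set_mset (croots r)) a"
      using ex_is_arg_min_if_finite[of "set_mset (croots r)"] by blast
    then show ?thesis by (auto simp: is_arg_min_linorder)
  qed
  obtain a where a: "a \<in># croots p" "\<And>b. b \<in># croots p \<Longrightarrow> cmod (\<xi> - a) \<le> cmod (\<xi> - b)" using nearest[OF p(2)] by blast
  obtain b where b: "b \<in># croots q" "\<And>a. a \<in># croots q \<Longrightarrow> cmod (\<xi> - b) \<le> cmod (\<xi> - a)" using nearest[OF q(2)] by blast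
  have ln2: "ln 2 \<le> (1::real)" using ln_le_minus_one[of 2] by simp
  have l: "real (degree r) * ln 2 \<le> degree r" for r :: "int poly"
    using ln2 by (intro mult_left_le) auto
  show ?thesis
  proof (cases "cmod (\<xi> - a) \<le> cmod (\<xi> - b)")
    case True
    have "- ln (cmod (poly (of_int_poly q) \<xi>)) \<le> degree q * ht p + degree p * ht q + degree q * ln 2"
    proof (rule minus_ln_le_if_nearest[OF p0 q0 disj a(1) _ nz(2)])
      show "cmod (\<xi> - a) \<le> cmod (\<xi> - c)" if "c \<in># croots q" for c using b(2)[OF that] True by linarith
    qed
    then show ?thesis using l[of p] l[of q] by (intro min.coboundedI2) linarith
  next
    case False
    have "- ln (cmod (poly (of_int_poly p) \<xi>)) \<le> degree p * ht q + degree q * ht p + degree p * ln 2"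
    proof (rule minus_ln_le_if_nearest[OF q0 p0 _ b(1) _ nz(1)])
      show "a' \<noteq> b'" if "a' \<in># croots q" "b' \<in># croots p" for a' b' using disj that by metis
      show "cmod (\<xi> - b) \<le> cmod (\<xi> - c)" if "c \<in># croots p" for c using a(2)[OF that] False by linarith
    qed
    then show ?thesis using l[of p] l[of q] by (intro min.coboundedI1) linarith
  qed
qed

lemma not_algebraic_imp_nonzero:
  assumes "\<not> algebraic \<xi>" "P \<noteq> 0"
  shows "poly (of_int_poly P) \<xi> \<noteq> 0"
proof
  assume "poly (of_int_poly P) \<xi> = 0"
  then have "algebraic \<xi>"
    unfolding algebraic_def using assms(2) by (intro exI[of _ "of_int_poly P"]) simp
  with assms(1) show False by simp
qed

text \<open>The smallness required is linear in degree and height, so a prime factor inherits it.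
  Different primes at consecutive n would contradict \<open>distinct_primes_not_both_small\<close>.
  Hence one prime serves for all large n, although minus the logarithm of its fixed value at \<xi>
  would have to exceed n^(x - d) each time.\<close>

theorem gelfond_criterion:
  fixes d h x :: real
  assumes \<xi>: "\<not> algebraic \<xi>" and d: "0 < d" "d \<le> h" and x: "d + h < x"
    and F: "\<forall>\<^sub>F n in sequentially. \<exists>F :: int poly. F \<noteq> 0 \<and> degree F \<le> real n powr d \<and> ht F \<le> real n powr h \<and>
      real n powr x * (degree F / real n powr d + ht F / real n powr h) < - ln (cmod (poly (of_int_poly F) \<xi>))"
  shows False
proof -
  define good where "good = (\<lambda>n p. prime p \<and> 0 < degree p \<and> degree p \<le> real n powr d \<and> ht p \<le> real n powr h \<and>
      real n powr x * (degree p / real n powr d + ht p / real n powr h) < - ln (cmod (poly (of_int_poly p) \<xi>)))"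
  define L where "L = (\<lambda>p. - ln (cmod (poly (of_int_poly p) \<xi>)))"
  have addL: "additive L"
    unfolding additive_def L_def using not_algebraic_imp_nonzero[OF \<xi>]
    by (simp add: hom_distribs norm_mult ln_mult_pos)
  have ev_good: "\<forall>\<^sub>F n in sequentially. \<exists>p. good n p"
    using F
  proof eventually_elim
    case (elim n)
    then obtain F where F: "F \<noteq> 0" "degree F \<le> real n powr d" "ht F \<le> real n powr h"
      "real n powr x * (degree F / real n powr d + ht F / real n powr h) < L F" by (auto simp: L_def)
    define g where "g = (\<lambda>p. (real n powr x / real n powr d) * degree p + (real n powr x / real n powr h) * ht p)"
    have g: "real n powr x * (degree p / real n powr d + ht p / real n powr h) = g p" for p
      by (simp add: g_def algebra_simps)
    have "additive g" unfolding g_def by (intro additive_add additive_cmult additive_degree additive_ht)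
    then obtain p where p: "p \<in># prime_factorization F" "g p < L p"
      using exists_prime_factor_gt[OF addL _ F(1)] F(4) by (auto simp: g)
    then have pd: "prime p" "p dvd F" by (auto simp: prime_factors_dvd)
    then have p0: "p \<noteq> 0" by auto
    have deg: "degree p \<le> degree F" "ht p \<le> ht F" using pd F(1) by (auto intro: dvd_imp_degree_le ht_le_if_dvd)
    \<comment> \<open>A constant prime has value at least 1 in modulus and cannot satisfy the strict
      inequality.\<close>
    have "0 < degree p"
    proof (rule ccontr)
      assume "\<not> 0 < degree p"
      then have "croots p = {#}" by (simp add: croots_degree_0)
      then have "L p = - ln \<bar>lead_coeff p\<bar>"
        unfolding L_def using ln_cmod_poly_of_int[OF p0] not_algebraic_imp_nonzero[OF \<xi> p0] by simp
      then have "L p \<le> 0" using ln_lead_nonneg[OF p0] by simp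
      moreover have "0 \<le> g p" unfolding g_def using ht_nonneg[OF p0] by simp
      ultimately show False using p(2) by simp
    qed
    then have "good n p" unfolding good_def using pd deg F p(2) by (auto simp: g L_def)
    then show ?case by blast
  qed
  \<comment> \<open>The left side collects the terms of the resultant bound for the polynomials at n
    and n + 1. It is of order n^(d + h), because d \<le> h, so d + h < x suffices.\<close>
  have ev_ineq: "\<forall>\<^sub>F n in sequentially. (real n + 1) powr d * (real n powr h + 1) + (real n + 1) powr d * ((real n + 1) powr h + 1 + (real n + 1) powr d) < real n powr x"
  proof -
    define C where "C = 2 powr d * (3 + 2 powr h + 2 powr d)"
    have "filterlim (\<lambda>n. real n powr (x - d - h)) at_top sequentially"
      using x d by real_asymp
    then have "\<forall>\<^sub>F n in sequentially. C + 1 \<le> real n powr (x - d - h)" unfolding filterlim_at_top by blast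
    then show ?thesis using eventually_gt_at_top[of 0]
    proof eventually_elim
      case (elim n)
      then have n: "1 \<le> real n" by simp
      have p: "(real n + 1) powr y \<le> 2 powr y * real n powr y" if "0 \<le> y" for y
      proof -
        have "(real n + 1) powr y \<le> (2 * real n) powr y" using n that by (intro powr_mono2) auto
        then show ?thesis using n by (simp add: powr_mult)
      qed
      have b: "1 \<le> real n powr h" "1 \<le> real n powr d" "real n powr d \<le> real n powr h"
        using n d by (auto intro: ge_one_powr_ge_zero powr_mono)
      have pd: "(real n + 1) powr d \<le> 2 powr d * real n powr d" "(real n + 1) powr h \<le> 2 powr h * real n powr h"
        using p d by auto
      have "(real n + 1) powr d * (real n powr h + 1) + (real n + 1) powr d * ((real n + 1) powr h + 1 + (real n + 1) powr d)
          = (real n + 1) powr d * (real n powr h + 2 + (real n + 1) powr h + (real n + 1) powr d)" by (simp add: algebra_simps)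
      also have "\<dots> \<le> (2 powr d * real n powr d) * (real n powr h + 2 * real n powr h + 2 powr h * real n powr h + 2 powr d * real n powr h)"
      proof (intro mult_mono add_mono pd order_refl)
        show "2 \<le> 2 * real n powr h" using b by simp
        show "(real n + 1) powr d \<le> 2 powr d * real n powr h"
          using pd(1) b(3) by (meson mult_left_mono order_trans powr_ge_zero)
      qed (auto intro!: add_nonneg_nonneg)
      also have "\<dots> = C * (real n powr d * real n powr h)" by (simp add: C_def algebra_simps)
      also have "\<dots> < real n powr (x - d - h) * (real n powr d * real n powr h)"
        using elim b n by (intro mult_strict_right_mono mult_pos_pos) auto
      also have "\<dots> = real n powr x" by (simp add: powr_add[symmetric])
      finally show ?case .
    qed
  qed
  obtain N where N: "\<And>n. N \<le> n \<Longrightarrow> \<exists>p. good n p" "0 < N"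
    "\<And>n. N \<le> n \<Longrightarrow> (real n + 1) powr d * (real n powr h + 1) + (real n + 1) powr d * ((real n + 1) powr h + 1 + (real n + 1) powr d) < real n powr x"
    using eventually_conj[OF ev_good eventually_conj[OF ev_ineq eventually_gt_at_top[of 0]]]
    unfolding eventually_sequentially by (metis le_refl)
  define f where "f = (\<lambda>n. SOME p. good n p)"
  have f: "good n (f n)" if "N \<le> n" for n unfolding f_def using N(1)[OF that] by (rule someI_ex)
  have step: "f (Suc n) = f n" if n: "N \<le> n" for n
  proof (rule ccontr)
    assume neq: "f (Suc n) \<noteq> f n"
    define p q where "p = f n" and "q = f (Suc n)"
    define D H X D' H' X' where "D = real n powr d" and "H = real n powr h" and "X = real n powr x"
      and "D' = (real n + 1) powr d" and "H' = (real n + 1) powr h" and "X' = (real n + 1) powr x"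
    have n0: "0 < real n" using n N(2) by simp
    have pos: "1 \<le> D" "1 \<le> H" "1 \<le> X" using n0 d x by (auto simp: D_def H_def X_def ge_one_powr_ge_zero)
    have le: "D \<le> D'" "H \<le> H'" "X \<le> X'" using n0 d x by (auto simp: D_def H_def X_def D'_def H'_def X'_def intro!: powr_mono2)
    have gp: "prime p" "0 < degree p" "degree p \<le> D" "ht p \<le> H" "X * (degree p / D + ht p / H) < L p"
      using f[OF n] unfolding good_def p_def D_def H_def X_def L_def by auto
    have gq: "prime q" "0 < degree q" "degree q \<le> D'" "ht q \<le> H'" "X' * (degree q / D' + ht q / H') < L q"
      using f[of "Suc n"] n unfolding good_def q_def D'_def H'_def X'_def L_def by (auto simp: add.commute)
    have p0: "p \<noteq> 0" "q \<noteq> 0" using gp gq by auto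
    have hp: "0 \<le> ht p" "0 \<le> ht q" using p0 by (auto intro: ht_nonneg)
    have dp: "1 \<le> real (degree p)" "1 \<le> real (degree q)" using gp(2) gq(2) by auto
    let ?E = "degree q * ht p + degree p * ht q + (degree p + degree q)"
    let ?Z = "D' * (H + 1) + D' * (H' + 1 + D')"
    have Z: "?Z < X" using N(3)[OF n] by (simp add: D'_def H'_def H_def X_def)
    have "min (L p) (L q) \<le> ?E"
      unfolding L_def using distinct_primes_not_both_small[OF gp(1,2) gq(1,2)] neq p0
        not_algebraic_imp_nonzero[OF \<xi>] by (auto simp: p_def q_def)
    \<comment> \<open>Whichever value attains the minimum, the lower bound known for it already
      exceeds \<open>?E\<close>: each part of \<open>?E\<close> is compared with the degree term or
      the height term of that same polynomial.\<close>
    then consider "L p \<le> ?E" | "L q \<le> ?E" by linarith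
    then show False
    proof cases
      case 1
      have "degree q * ht p \<le> D' * ht p" using gq hp by (intro mult_right_mono)
      moreover have "degree p * ht q \<le> degree p * H'" using gq by (intro mult_left_mono) auto
      moreover have "degree q \<le> degree p * D'" using mult_mono[OF dp(1) gq(3)] dp by simp
      ultimately have "?E \<le> D' * ht p + degree p * (H' + 1 + D')" by (simp add: algebra_simps)
      also have "\<dots> \<le> X * (ht p / H) + X * (degree p / D)"
      proof (rule add_mono)
        have "D' * H \<le> X" using Z pos le by (smt (verit, best) mult_nonneg_nonneg distrib_left)
        then have "D' * H * (ht p / H) \<le> X * (ht p / H)" using hp pos by (intro mult_right_mono) auto
        then show "D' * ht p \<le> X * (ht p / H)" using pos by simp
        have "D * (H' + 1 + D') \<le> D' * (H' + 1 + D')" using le pos by (intro mult_right_mono) auto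
        also have "\<dots> \<le> X" using Z pos le by (smt (verit, best) mult_nonneg_nonneg)
        finally have "D * (H' + 1 + D') * (degree p / D) \<le> X * (degree p / D)" using pos by (intro mult_right_mono) auto
        then show "degree p * (H' + 1 + D') \<le> X * (degree p / D)" using pos by (simp add: mult_ac)
      qed
      also have "\<dots> < L p" using gp(5) by (simp add: algebra_simps)
      finally show False using 1 by simp
    next
      case 2
      have "degree p * ht q \<le> D' * ht q" using gp hp le by (intro mult_right_mono) auto
      moreover have "degree q * ht p \<le> degree q * H'" using gp le by (intro mult_left_mono) auto
      moreover have "degree p \<le> degree q * D'" using mult_mono[OF dp(2), of "degree p" D'] gp(3) le dp by simp
      ultimately have "?E \<le> D' * ht q + degree q * (H' + 1 + D')" by (simp add: algebra_simps)
      also have "\<dots> \<le> X' * (ht q / H') + X' * (degree q / D')"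
      proof (rule add_mono)
        have "D' * H' \<le> X'" using Z pos le by (smt (verit, best) mult_nonneg_nonneg distrib_left)
        then have "D' * H' * (ht q / H') \<le> X' * (ht q / H')" using hp pos le by (intro mult_right_mono) auto
        then show "D' * ht q \<le> X' * (ht q / H')" using pos le by simp
        have "D' * (H' + 1 + D') \<le> X'" using Z pos le by (smt (verit, best) mult_nonneg_nonneg)
        then have "D' * (H' + 1 + D') * (degree q / D') \<le> X' * (degree q / D')" using pos le by (intro mult_right_mono) auto
        then show "degree q * (H' + 1 + D') \<le> X' * (degree q / D')" using pos le by (simp add: mult_ac)
      qed
      also have "\<dots> < L q" using gq(5) by (simp add: algebra_simps)
      finally show False using 2 by simp
    qed
  qed
  define p where "p = f N"
  have const: "f n = p" if "N \<le> n" for n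
    using that by (induction n rule: dec_induct) (auto simp: p_def step)
  have p: "prime p" "0 < degree p" using f[of N] by (auto simp: p_def good_def)
  have bound: "real n powr (x - d) < L p" if n: "N \<le> n" for n
  proof -
    have n0: "0 < real n" using n N(2) by simp
    have "good n p" using f[OF n] const[OF n] by simp
    then have g: "real n powr x * (degree p / real n powr d + ht p / real n powr h) < L p"
      by (simp add: good_def L_def)
    have "real n powr (x - d) = real n powr x * (1 / real n powr d)" by (simp add: powr_diff)
    also have "\<dots> \<le> real n powr x * (degree p / real n powr d + ht p / real n powr h)"
      using p ht_nonneg[of p] by (intro mult_left_mono order_trans[OF divide_right_mono[of 1 "real (degree p)"]]) (auto simp: divide_nonneg_nonneg)
    finally show ?thesis using g by simp
  qed
  have "filterlim (\<lambda>n. real n powr (x - d)) at_top sequentially"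
    using x d by real_asymp
  then have "\<forall>\<^sub>F n in sequentially. L p \<le> real n powr (x - d)" by (simp add: filterlim_at_top)
  then have "\<forall>\<^sub>F n in sequentially. False"
    using eventually_ge_at_top[of N]
  proof eventually_elim
    case (elim n)
    then show ?case using bound[of n] by simp
  qed
  then show False by simp
qed

section \<open>Reduction to primitive polynomials\<close>

lemma rat_content_of_int_poly:
  assumes "P \<noteq> 0"
  shows "rat_content (of_int_poly P) = of_int (content P)"
  unfolding rat_content_def
proof (rule the1_equality)
  have nz: "(of_int_poly P :: rat poly) \<noteq> 0" using assms by simp
  then show "\<exists>!c::rat. 0 < c \<and> (\<exists>Q. content Q = 1 \<and> Polynomial.smult (inverse c) (of_int_poly P) = of_int_poly Q)"
    by (rule ex1_rat_content)
  have c: "0 < content P" using assms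
    by (metis abs_ge_zero content_eq_zero_iff normalize_content normalize_int_def order_le_less)
  have "(of_int_poly P :: rat poly) = Polynomial.smult (of_int (content P)) (of_int_poly (primitive_part P))"
    by (metis content_times_primitive_part of_int_hom.map_poly_hom_smult)
  then show "0 < (of_int (content P) :: rat) \<and> (\<exists>Q. content Q = 1 \<and> Polynomial.smult (inverse (of_int (content P))) (of_int_poly P) = (of_int_poly Q :: rat poly))"
    using c assms by (intro conjI exI[of _ "primitive_part P"]) auto
qed

lemma poly_divided_pderiv_smult:
  "poly (divided_pderiv j (Polynomial.smult c P)) y = c * poly (divided_pderiv j P) y"
  by (simp add: divided_pderiv_def higher_pderiv_smult)

text \<open>\<open>poly_height\<close> is invariant under scaling, so the hypothesis bounds the
  coefficients of the primitive part rather than those of P. Dividing by the content, a positive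
  integer, also shrinks every derivative.\<close>

lemma primitive_witness:
  fixes P :: "int poly"
  assumes P: "P \<noteq> 0" and H: "real_of_rat (poly_height (map_poly of_int P)) \<le> C"
  obtains Q where "Q \<noteq> 0" "degree Q = degree P" "\<And>i. \<bar>real_of_int (coeff Q i)\<bar> \<le> C"
    "\<And>j y. cmod (poly (divided_pderiv j (of_int_poly Q)) y) \<le> cmod (poly (divided_pderiv j (of_int_poly P)) y)"
proof
  let ?Q = "primitive_part P"
  have c: "0 < content P" using P
    by (metis abs_ge_zero content_eq_zero_iff normalize_content normalize_int_def order_le_less)
  then have c1: "1 \<le> real_of_int (content P)" by linarith
  have PQ: "P = Polynomial.smult (content P) ?Q" by simp
  show "?Q \<noteq> 0" using P by simp
  show "degree ?Q = degree P" by simp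
  show "\<bar>real_of_int (coeff ?Q i)\<bar> \<le> C" for i
  proof (cases "i \<le> degree P")
    case True
    let ?R = "of_int_poly P :: rat poly"
    have "\<bar>coeff ?R i\<bar> \<le> max_coeff ?R"
      unfolding max_coeff_def using True by (intro Max_ge) auto
    then have "of_int \<bar>coeff P i\<bar> \<le> max_coeff ?R" by simp
    moreover have "coeff P i = content P * coeff ?Q i" by (subst PQ) (rule coeff_smult)
    ultimately have "of_int (content P) * of_int \<bar>coeff ?Q i\<bar> \<le> max_coeff ?R"
      using c by (simp add: abs_mult)
    then have "of_int \<bar>coeff ?Q i\<bar> \<le> poly_height ?R"
      unfolding poly_height_def rat_content_of_int_poly[OF P] using c by (simp add: le_divide_eq mult.commute)
    then have "real_of_rat (of_int \<bar>coeff ?Q i\<bar>) \<le> real_of_rat (poly_height ?R)" by (simp only: of_rat_less_eq)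
    then have "real_of_int \<bar>coeff ?Q i\<bar> \<le> real_of_rat (poly_height ?R)" by (simp only: of_rat_of_int_eq)
    then show ?thesis using H by linarith
  next
    case False
    have "0 \<le> max_coeff (of_int_poly P :: rat poly)"
      unfolding max_coeff_def by (intro order_trans[OF abs_ge_zero Max_ge[OF _ imageI[of 0]]]) auto
    then have "0 \<le> poly_height (of_int_poly P)"
      unfolding poly_height_def rat_content_of_int_poly[OF P] using c by simp
    then have "0 \<le> real_of_rat (poly_height (of_int_poly P))" by (simp only: zero_le_of_rat_iff)
    then have "0 \<le> C" using H by linarith
    then show ?thesis using False by (simp add: coeff_eq_0)
  qed
  show "cmod (poly (divided_pderiv j (of_int_poly ?Q)) y) \<le> cmod (poly (divided_pderiv j (of_int_poly P)) y)" for j y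
  proof -
    have "(of_int_poly P :: complex poly) = Polynomial.smult (of_int (content P)) (of_int_poly ?Q)"
      by (metis content_times_primitive_part of_int_hom.map_poly_hom_smult)
    then have "cmod (poly (divided_pderiv j (of_int_poly P)) y) = content P * cmod (poly (divided_pderiv j (of_int_poly ?Q)) y)"
      using c by (simp add: poly_divided_pderiv_smult norm_mult)
    then show ?thesis using c1 mult_right_mono[OF c1, of "cmod (poly (divided_pderiv j (of_int_poly ?Q)) y)"] by simp
  qed
qed

text \<open>A bound on \<open>Max\<close> is informative only for a finite set; floors of the real
  bounds confine the indices to a finite box.\<close>

lemma le_if_Max_le:
  fixes f :: "int \<Rightarrow> int \<Rightarrow> nat \<Rightarrow> real"
  assumes M: "Max {f i j k | (i :: int) (j :: int) (k :: nat). 1 \<le> i \<and> real_of_int i \<le> a \<and> 1 \<le> j \<and> real_of_int j \<le> b \<and> real k \<le> c} \<le> e"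
    and ijk: "1 \<le> i" "real_of_int i \<le> a" "1 \<le> j" "real_of_int j \<le> b" "real k \<le> c"
  shows "f i j k \<le> e"
proof -
  let ?S = "{f i j k | (i :: int) (j :: int) (k :: nat). 1 \<le> i \<and> real_of_int i \<le> a \<and> 1 \<le> j \<and> real_of_int j \<le> b \<and> real k \<le> c}"
  have "?S \<subseteq> (\<lambda>(i, j, k). f i j k) ` ({1..\<lfloor>a\<rfloor>} \<times> {1..\<lfloor>b\<rfloor>} \<times> {..nat \<lfloor>c\<rfloor>})"
  proof
    fix v assume "v \<in> ?S"
    then obtain i j k where v: "v = f i j k" "1 \<le> i" "real_of_int i \<le> a" "1 \<le> j" "real_of_int j \<le> b" "real k \<le> c" by blast
    then have mem: "(i, j, k) \<in> {1..\<lfloor>a\<rfloor>} \<times> {1..\<lfloor>b\<rfloor>} \<times> {..nat \<lfloor>c\<rfloor>}"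
      by (auto simp: le_floor_iff le_nat_floor)
    show "v \<in> (\<lambda>(i, j, k). f i j k) ` ({1..\<lfloor>a\<rfloor>} \<times> {1..\<lfloor>b\<rfloor>} \<times> {..nat \<lfloor>c\<rfloor>})"
      by (rule rev_image_eqI[OF mem]) (simp add: v(1))
  qed
  then have "finite ?S" by (rule finite_subset) simp
  moreover have "f i j k \<in> ?S" using ijk by blast
  ultimately show ?thesis using M Max_ge order_trans by blast
qed

section \<open>Taylor coefficients and smallness on a disc\<close>

lemma coeff_linear_power_le: "cmod (coeff ([:y, 1:] ^ i) j) \<le> (1 + cmod y) ^ i"
proof (induction i arbitrary: j)
  case (Suc i)
  define G where "G = [:y, 1:] ^ i"
  have IH: "cmod (coeff G j) \<le> (1 + cmod y) ^ i" for j unfolding G_def by (rule Suc)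
  have "coeff ([:y, 1:] ^ Suc i) j = coeff (Polynomial.smult y G + pCons 0 G) j"
    by (simp add: G_def)
  also have "\<dots> = y * coeff G j + (case j of 0 \<Rightarrow> 0 | Suc j' \<Rightarrow> coeff G j')"
    by (simp add: coeff_pCons split: nat.split)
  also have "cmod \<dots> \<le> cmod y * (1 + cmod y) ^ i + (1 + cmod y) ^ i"
    by (intro norm_triangle_le add_mono) (auto simp: norm_mult IH intro!: mult_left_mono split: nat.split)
  also have "\<dots> = (1 + cmod y) ^ Suc i" by (simp add: algebra_simps)
  finally show ?case .
qed simp

lemma coeff_pcompose_shift: "coeff (P \<circ>\<^sub>p [:y, 1:]) j = poly (divided_pderiv j P) (y :: complex)"
proof -
  have "(pderiv ^^ j) (P \<circ>\<^sub>p [:y, 1:]) = ((pderiv ^^ j) P) \<circ>\<^sub>p [:y, 1:]"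
    by (induction j) (simp_all add: pderiv_pcompose pderiv_pCons)
  then have "coeff ((pderiv ^^ j) (P \<circ>\<^sub>p [:y, 1:])) 0 = poly ((pderiv ^^ j) P) y"
    by (simp add: poly_0_coeff_0[symmetric] poly_pcompose)
  moreover have "coeff ((pderiv ^^ j) (P \<circ>\<^sub>p [:y, 1:])) 0 = fact j * coeff (P \<circ>\<^sub>p [:y, 1:]) j"
    by (simp add: coeff_higher_pderiv pochhammer_fact)
  ultimately show ?thesis by (simp add: divided_pderiv_def field_simps)
qed

lemma cmod_divided_pderiv_le:
  assumes deg: "degree P \<le> n" and C: "\<And>i. cmod (coeff P i) \<le> C"
  shows "cmod (poly (divided_pderiv j P) y) \<le> (real n + 1) * (C * (1 + cmod y) ^ n)"
proof -
  have C0: "0 \<le> C" using C[of 0] norm_ge_zero order_trans by blast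
  have "P \<circ>\<^sub>p [:y, 1:] = (\<Sum>i\<le>n. Polynomial.smult (coeff P i) ([:y, 1:] ^ i))"
  proof -
    have "P \<circ>\<^sub>p [:y, 1:] = (\<Sum>i\<le>degree P. Polynomial.smult (coeff P i) ([:y, 1:] ^ i))"
      by (simp add: pcompose_altdef poly_altdef coeff_map_poly degree_map_poly)
    also have "\<dots> = (\<Sum>i\<le>n. Polynomial.smult (coeff P i) ([:y, 1:] ^ i))"
      using deg by (intro sum.mono_neutral_left) (auto simp: coeff_eq_0)
    finally show ?thesis .
  qed
  then have "poly (divided_pderiv j P) y = (\<Sum>i\<le>n. coeff P i * coeff ([:y, 1:] ^ i) j)"
    by (simp add: coeff_pcompose_shift[symmetric] coeff_sum)
  also have "cmod \<dots> \<le> (\<Sum>i\<le>n. C * (1 + cmod y) ^ n)"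
  proof (rule sum_norm_le)
    fix i assume "i \<in> {..n}"
    then have "(1 + cmod y) ^ i \<le> (1 + cmod y) ^ n" by (intro power_increasing) auto
    then have "cmod (coeff ([:y, 1:] ^ i) j) \<le> (1 + cmod y) ^ n" using coeff_linear_power_le order_trans by blast
    then show "cmod (coeff P i * coeff ([:y, 1:] ^ i) j) \<le> C * (1 + cmod y) ^ n"
      unfolding norm_mult using C C0 by (intro mult_mono) auto
  qed
  finally show ?thesis by (simp add: algebra_simps)
qed

text \<open>Taylor expansion at y: orders below t are bounded through \<delta>, all others through
  r^t. The later choice of r makes r^t and \<delta> equal.\<close>

lemma small_on_disc_if_small_derivatives:
  fixes P :: "complex poly"
  assumes deg: "degree P \<le> n" and A: "\<And>j. cmod (poly (divided_pderiv j P) y) \<le> A"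
    and \<delta>: "\<And>j. j < t \<Longrightarrow> cmod (poly (divided_pderiv j P) y) \<le> \<delta>" "0 \<le> \<delta>"
    and z: "cmod (z - y) \<le> r" "0 \<le> r" "r \<le> 1"
  shows "cmod (poly P z) \<le> (real n + 1) * (\<delta> + A * r ^ t)"
proof -
  have A0: "0 \<le> A" using A[of 0] norm_ge_zero order_trans by blast
  let ?Q = "P \<circ>\<^sub>p [:y, 1:]"
  have "poly P z = poly ?Q (z - y)" by (simp add: poly_pcompose)
  also have "\<dots> = (\<Sum>j\<le>n. coeff ?Q j * (z - y) ^ j)"
    unfolding poly_altdef using deg by (intro sum.mono_neutral_left) (auto simp: coeff_eq_0)
  also have "cmod \<dots> \<le> (\<Sum>j\<le>n. \<delta> + A * r ^ t)"
  proof (rule sum_norm_le)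
    fix j
    have zj: "cmod (z - y) ^ j \<le> r ^ j" using z by (intro power_mono) auto
    show "cmod (coeff ?Q j * (z - y) ^ j) \<le> \<delta> + A * r ^ t"
    proof (cases "j < t")
      case True
      have "cmod (z - y) ^ j \<le> 1" using zj z power_le_one[of r j] by linarith
      then have "cmod (coeff ?Q j * (z - y) ^ j) \<le> \<delta> * 1"
        unfolding norm_mult norm_power coeff_pcompose_shift using \<delta> True by (intro mult_mono) auto
      also have "\<dots> \<le> \<delta> + A * r ^ t" using A0 z by simp
      finally show ?thesis .
    next
      case False
      then have "r ^ j \<le> r ^ t" using z by (intro power_decreasing) auto
      then have "cmod (z - y) ^ j \<le> r ^ t" using zj by linarith
      then have "cmod (coeff ?Q j * (z - y) ^ j) \<le> A * r ^ t"
        unfolding norm_mult norm_power coeff_pcompose_shift using A A0 by (intro mult_mono) auto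
      then show ?thesis using \<delta> by linarith
    qed
  qed
  finally show ?thesis by (simp add: algebra_simps)
qed

lemma cmod_poly_le:
  assumes deg: "degree P \<le> n" and C: "\<And>i. cmod (coeff P i) \<le> C" and z: "cmod z \<le> c" "1 \<le> c"
  shows "cmod (poly P z) \<le> (real n + 1) * (C * c ^ n)"
proof -
  have C0: "0 \<le> C" using C[of 0] norm_ge_zero order_trans by blast
  have "poly P z = (\<Sum>j\<le>n. coeff P j * z ^ j)"
    unfolding poly_altdef using deg by (intro sum.mono_neutral_left) (auto simp: coeff_eq_0)
  also have "cmod \<dots> \<le> (\<Sum>j\<le>n. C * c ^ n)"
  proof (rule sum_norm_le)
    fix j assume "j \<in> {..n}"
    then have "cmod z ^ j \<le> c ^ j" "c ^ j \<le> c ^ n" using z by (auto intro: power_mono power_increasing)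
    then have "cmod z ^ j \<le> c ^ n" by linarith
    then show "cmod (coeff P j * z ^ j) \<le> C * c ^ n"
      unfolding norm_mult norm_power using C C0 by (intro mult_mono) auto
  qed
  finally show ?thesis by (simp add: algebra_simps)
qed

section \<open>Rescaling by r and the product of dilates\<close>

lemma not_algebraic_div_rat:
  assumes "\<not> algebraic \<xi>" "r \<noteq> 0"
  shows "\<not> algebraic (\<xi> / of_rat r :: complex)"
proof
  assume "algebraic (\<xi> / of_rat r)"
  then obtain p where p: "\<And>i. coeff p i \<in> \<rat>" "p \<noteq> 0" "poly p (\<xi> / of_rat r) = 0"
    unfolding algebraic_altdef by blast
  let ?q = "p \<circ>\<^sub>p [:0, 1 / of_rat r:]"
  have "coeff ?q i \<in> \<rat>" for i
    using p(1) by (auto simp: coeff_pcompose_linear intro!: Rats_mult Rats_power Rats_divide)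
  moreover have "?q \<noteq> 0" using p(2) assms(2) by (auto simp: pcompose_eq_0_iff)
  moreover have "poly ?q \<xi> = 0" using p(3) by (simp add: poly_pcompose)
  ultimately show False using assms(1) unfolding algebraic_altdef by blast
qed

text \<open>The points i1 \<xi> + i2 r are r times integer combinations of \<xi> / r and 1, so P(r
  T) is the polynomial to study; the power of the denominator of r keeps it integral.\<close>

lemma rescaled_polynomial:
  fixes r :: rat
  assumes P: "P \<noteq> 0" and r: "r \<noteq> 0" and deg: "degree P \<le> n" and C: "\<And>i. \<bar>real_of_int (coeff P i)\<bar> \<le> C"
    and R: "quotient_of r = (R1, R2)"
  obtains Q where "Q \<noteq> 0" "degree Q \<le> n"
    "\<And>z. poly (of_int_poly Q) z = of_int R2 ^ n * poly (of_int_poly P) (of_rat r * z :: complex)"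
    "ht Q \<le> n * ln 4 + ln (real_of_int R2 ^ n * ((real n + 1) * (C * (max 1 (real_of_rat \<bar>r\<bar>)) ^ n)))"
proof
  have R2: "0 < R2" using R by (rule quotient_of_denom_pos)
  have rR: "r = of_int R1 / of_int R2" using R by (rule quotient_of_div)
  let ?Q = "scaled_affine n R2 R1 0 P"
  show ev: "poly (of_int_poly ?Q) z = of_int R2 ^ n * poly (of_int_poly P) (of_rat r * z :: complex)" for z
    using R2 deg by (simp add: poly_scaled_affine rR of_rat_divide)
  show degQ: "degree ?Q \<le> n"
    unfolding scaled_affine_def
  proof (intro degree_sum_le)
    fix k assume "k \<in> {..n}"
    have "degree ([:0, R1:] ^ k) \<le> degree [:0, R1:] * k" by (rule degree_power_le)
    also have "\<dots> \<le> 1 * k" by (intro mult_right_mono) auto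
    also have "\<dots> \<le> n" using \<open>k \<in> {..n}\<close> by simp
    finally show "degree (Polynomial.smult (coeff P k * R2 ^ (n - k)) ([:0, R1:] ^ k)) \<le> n"
      using degree_smult_le order_trans by blast
  qed simp
  show Q0: "?Q \<noteq> 0"
  proof
    assume "?Q = 0"
    then have "poly (of_int_poly P) (of_rat r * z :: complex) = 0" for z using ev[of z] R2 by simp
    then have "poly (of_int_poly P) z = 0" for z :: complex
      by (metis r nonzero_mult_div_cancel_left of_rat_eq_0_iff times_divide_eq_right)
    then have "(of_int_poly P :: complex poly) = 0" using poly_all_0_iff_0 by blast
    then show False using P by simp
  qed
  let ?c = "max 1 (real_of_rat \<bar>r\<bar>)"
  have "ht ?Q \<le> degree ?Q * ln 4 + ln (real_of_int R2 ^ n * ((real n + 1) * (C * ?c ^ n)))"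
  proof (rule ht_le_if_bounded_on_disc[OF Q0])
    fix z :: complex assume z: "cmod z = 1"
    have "cmod (poly (of_int_poly P) (of_rat r * z)) \<le> (real n + 1) * (C * ?c ^ n)"
    proof (rule cmod_poly_le)
      have "cmod (of_rat r) = real_of_rat \<bar>r\<bar>"
        using R2 by (simp add: rR of_rat_divide norm_divide abs_divide flip: of_int_abs)
      then show "cmod (of_rat r * z) \<le> ?c" using z by (simp add: norm_mult)
    qed (use deg C in auto)
    then show "cmod (poly (of_int_poly ?Q) z) \<le> real_of_int R2 ^ n * ((real n + 1) * (C * ?c ^ n))"
      using R2 by (simp add: ev norm_mult norm_power)
  qed
  also have "degree ?Q * ln 4 \<le> n * ln (4::real)" using degQ by (intro mult_right_mono) auto
  finally show "ht ?Q \<le> n * ln 4 + ln (real_of_int R2 ^ n * ((real n + 1) * (C * ?c ^ n)))" by simp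
qed

text \<open>Each of the I * J dilates has degree at most n, height at most h and potential at least
  V at every point, so \<open>exists_heavy_prime_factor\<close> is applied with these quantities
  times I * J. \<open>prime_factor_of_dilates_bounds\<close> then converts multiplicity above T into
  bounds on the factor.\<close>

theorem exists_heavy_factor_of_dilates:
  fixes Q :: "int poly" and \<xi> :: complex and n I J K1 K2 :: nat and s \<rho> e B V T h a b :: real
  assumes Q: "Q \<noteq> 0" "degree Q \<le> n" and IJ: "1 \<le> I" "1 \<le> J"
    and small: "\<And>i j k l z. i \<in> {1..int I} \<Longrightarrow> j \<in> {1..int J} \<Longrightarrow> k \<in> {1..int K1} \<Longrightarrow> l \<in> {0..<int K2} \<Longrightarrow>
      cmod (z - (of_int k * \<xi> + of_int l)) \<le> \<rho> \<Longrightarrow> cmod (poly (of_int_poly Q) (of_int i * z + of_int j)) \<le> e"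
    and sep: "\<And>k l k' l'. k \<in> {1..int K1} \<Longrightarrow> k' \<in> {1..int K1} \<Longrightarrow> l \<in> {0..<int K2} \<Longrightarrow> l' \<in> {0..<int K2} \<Longrightarrow>
      (k, l) \<noteq> (k', l') \<Longrightarrow> 2 * s \<le> cmod ((of_int k * \<xi> + of_int l) - (of_int k' * \<xi> + of_int l'))"
    and \<rho>: "0 < \<rho>" "\<rho> \<le> s" "s \<le> 1 / 2" and B: "0 < B" "ln s - ln \<rho> \<le> B"
    and V: "0 \<le> V" "V \<le> n * ln s - n * ln 2 - ln e"
    and h: "ht Q + n * ln (real (I + J)) \<le> h"
    and T: "0 \<le> T" "T \<le> I * J * V / (2 * B)"
    and large: "2 * real (I * J * n) * (real (I * J) * h) < (K1 * K2) * (I * J * V / 2 * (I * J * V / (2 * B) - T))"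
    and ab: "0 \<le> a" "0 \<le> b" "a * (I * J * n) + b * (I * J * h) < I * J * V / 2"
  shows "\<exists>k l p. k \<in> {1..int K1} \<and> l \<in> {0..<int K2} \<and> prime p \<and> 0 < degree p \<and>
    a * degree p + b * ht p < pot s \<rho> (of_int k * \<xi> + of_int l) p \<and>
    ((degree p \<le> 1 \<and> ht p \<le> ln (real (I + J))) \<or> (T * degree p \<le> n \<and> T * ht p \<le> h))"
proof -
  define K where "K = {1..int I} \<times> {1..int J}"
  define S where "S = (\<Prod>(i, j)\<in>K. Q \<circ>\<^sub>p [:j, i:])"
  define G where "G = {1..int K1} \<times> {0..<int K2}"
  define f where "f = (\<lambda>(k, l). of_int k * \<xi> + of_int l :: complex)"
  define X where "X = f ` G"
  have fK: "finite K" "card K = I * J" by (simp_all add: K_def)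
  have fG: "finite G" "card G = K1 * K2" by (simp_all add: G_def)
  have s0: "0 < s" using \<rho> by linarith
  have sepG: "2 * s \<le> cmod (f x - f y)" if "x \<in> G" "y \<in> G" "x \<noteq> y" for x y
    using that sep by (cases x; cases y) (auto simp: G_def f_def)
  \<comment> \<open>Separation with s > 0 also shows that different index pairs give different
    points, so X has the full cardinality K1 * K2.\<close>
  have "inj_on f G"
  proof (rule inj_onI, rule ccontr)
    fix x y assume "x \<in> G" "y \<in> G" "f x = f y" "x \<noteq> y"
    then show False using sepG[of x y] s0 by simp
  qed
  then have cardX: "card X = K1 * K2" unfolding X_def using card_image fG(2) by metis
  have finX: "finite X" unfolding X_def using fG(1) by simp
  have F0: "Q \<circ>\<^sub>p [:j, i:] \<noteq> 0" if "(i, j) \<in> K" for i j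
    using that Q(1) by (intro pcompose_affine_nonzero) (auto simp: K_def)
  have additive_S: "g S = (\<Sum>(i, j)\<in>K. g (Q \<circ>\<^sub>p [:j, i:]))" "S \<noteq> 0" if g: "additive g" for g
  proof -
    have "M \<subseteq> K \<Longrightarrow> (\<Prod>(i, j)\<in>M. Q \<circ>\<^sub>p [:j, i:]) \<noteq> 0 \<and>
      g (\<Prod>(i, j)\<in>M. Q \<circ>\<^sub>p [:j, i:]) = (\<Sum>(i, j)\<in>M. g (Q \<circ>\<^sub>p [:j, i:]))" if "finite M" for M
      using that
    proof (induction M)
      case empty
      then show ?case using additive_1[OF g] by simp
    next
      case (insert x M)
      obtain i j where x: "x = (i, j)" by (cases x)
      have "Q \<circ>\<^sub>p [:j, i:] \<noteq> 0" using F0 insert x by auto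
      then show ?case using insert g unfolding additive_def by (simp add: x)
    qed
    from this[OF fK(1) order_refl] show "g S = (\<Sum>(i, j)\<in>K. g (Q \<circ>\<^sub>p [:j, i:]))" "S \<noteq> 0"
      unfolding S_def by auto
  qed
  have degS: "real (degree S) \<le> I * J * n"
  proof -
    have "real (degree S) = (\<Sum>(i, j)\<in>K. real (degree (Q \<circ>\<^sub>p [:j, i:])))"
      by (rule additive_S[OF additive_degree])
    also have "\<dots> \<le> (\<Sum>k\<in>K. real n)"
      using Q(2) by (intro sum_mono) (auto simp: K_def)
    finally show ?thesis using fK by simp
  qed
  have hIJ: "0 \<le> ln (real (I + J))" using IJ by simp
  have dlnIJ: "degree Q * ln (real (I + J)) \<le> n * ln (real (I + J))" using Q(2) hIJ by (intro mult_right_mono) auto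
  have htF: "ht (Q \<circ>\<^sub>p [:j, i:]) \<le> h" if "(i, j) \<in> K" for i j
  proof -
    have ij: "1 \<le> i" "i \<le> int I" "1 \<le> j" "j \<le> int J" using that by (auto simp: K_def)
    have "ht (Q \<circ>\<^sub>p [:j, i:]) \<le> ht Q + degree Q * ln (real_of_int (i + j))"
      using Q ij by (intro ht_pcompose_le) auto
    also have "degree Q * ln (real_of_int (i + j)) \<le> degree Q * ln (real (I + J))"
      using ij by (intro mult_left_mono) auto
    finally show ?thesis using dlnIJ h by linarith
  qed
  have htS: "ht S \<le> I * J * h"
  proof -
    have "ht S = (\<Sum>(i, j)\<in>K. ht (Q \<circ>\<^sub>p [:j, i:]))" by (rule additive_S[OF additive_ht])
    also have "\<dots> \<le> (\<Sum>k\<in>K. h)" using htF by (intro sum_mono) auto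
    finally show ?thesis using fK by simp
  qed
  have S0: "S \<noteq> 0" by (rule additive_S(2)[OF additive_ht])
  have E: "I * J * V \<le> pot s \<rho> x S" if x: "x \<in> X" for x
  proof -
    obtain k l where kl: "k \<in> {1..int K1}" "l \<in> {0..<int K2}" "x = of_int k * \<xi> + of_int l"
      using x by (auto simp: X_def G_def f_def)
    have "pot s \<rho> x S = (\<Sum>(i, j)\<in>K. pot s \<rho> x (Q \<circ>\<^sub>p [:j, i:]))" by (rule additive_S[OF additive_pot])
    also have "\<dots> \<ge> (\<Sum>k\<in>K. V)"
    proof (rule sum_mono, clarify)
      fix i j assume ij: "(i, j) \<in> K"
      let ?F = "Q \<circ>\<^sub>p [:j, i:]"
      have ij': "i \<in> {1..int I}" "j \<in> {1..int J}" using ij by (auto simp: K_def)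
      have dF: "degree ?F \<le> n" using Q(2) ij' by simp
      \<comment> \<open>The coefficient ln s - ln 2 is negative, so replacing the true degree by its
        upper bound n only lowers the bound.\<close>
      have "ln s \<le> 0" "0 \<le> ln (2::real)" using \<rho> by simp_all
      then have neg: "ln s - ln 2 \<le> 0" by linarith
      then have "real n * (ln s - ln 2) \<le> degree ?F * (ln s - ln 2)"
        using dF neg by (intro mult_right_mono_neg of_nat_mono)
      then have "V \<le> degree ?F * ln s - degree ?F * ln 2 - ln e"
        using V(2) by (simp add: right_diff_distrib)
      also have "\<dots> \<le> pot s \<rho> x ?F"
      proof (rule pot_ge_if_small_on_disc[OF F0[OF ij] \<rho>(1,2)])
        fix z assume z: "cmod (z - x) = \<rho>"
        have "poly (of_int_poly ?F) z = poly (of_int_poly Q) (of_int i * z + of_int j)"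
          by (simp add: of_int_hom.map_poly_pcompose poly_pcompose poly_of_int_linear add.commute)
        then show "cmod (poly (of_int_poly ?F) z) \<le> e"
          using small[OF ij' kl(1,2), of z] z kl(3) by simp
      qed
      finally show "V \<le> pot s \<rho> x ?F" .
    qed
    finally show ?thesis using fK by simp
  qed
  have "\<exists>x\<in>X. \<exists>p. prime p \<and> T < count (prime_factorization S) p \<and> a * degree p + b * ht p < pot s \<rho> x p"
  proof (rule exists_heavy_prime_factor[OF S0 finX _ \<rho> B T(1) _ E])
    show "2 * s \<le> cmod (x - y)" if "x \<in> X" "y \<in> X" "x \<noteq> y" for x y
      using that sepG by (auto simp: X_def)
    show "T \<le> I * J * V / (2 * B)" by (rule T(2))
    have "2 * degree S * ht S \<le> 2 * real (I * J * n) * (real (I * J) * h)"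
      using degS htS ht_nonneg[OF S0] by (intro mult_mono) auto
    also note large
    finally show "2 * degree S * ht S < card X * (I * J * V / 2 * (I * J * V / (2 * B) - T))" by (simp add: cardX)
    have "a * degree S + b * ht S \<le> a * (I * J * n) + b * (I * J * h)"
      using degS htS ab by (intro add_mono mult_left_mono) auto
    then show "a * degree S + b * ht S < I * J * V / 2" using ab(3) by linarith
  qed (use ab in auto)
  then obtain x p where x: "x \<in> X" and p: "prime p" "T < count (prime_factorization S) p"
    "a * degree p + b * ht p < pot s \<rho> x p" by blast
  obtain k l where kl: "k \<in> {1..int K1}" "l \<in> {0..<int K2}" "x = of_int k * \<xi> + of_int l"
    using x by (auto simp: X_def G_def f_def)
  have p0: "p \<noteq> 0" using p by auto
  have dp: "0 < degree p"
  proof (rule ccontr)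
    assume "\<not> 0 < degree p"
    then have "pot s \<rho> x p = 0" by (simp add: pot_def croots_degree_0)
    moreover have "0 \<le> a * degree p + b * ht p" using ab ht_nonneg[OF p0] by simp
    ultimately show False using p(3) by simp
  qed
  define N where "N = count (prime_factorization S) p"
  have "(degree p \<le> 1 \<and> ht p \<le> ln (real_of_int (int I + int J))) \<or>
    (real N * degree p \<le> degree Q \<and> real N * ht p \<le> ht Q + degree Q * ln (real_of_int (int I + int J)))"
  proof (rule prime_factor_of_dilates_bounds[OF Q(1) _ fK(1) _ S_def p(1) dp N_def])
    show "1 \<le> int I + int J" using IJ by simp
    show "1 \<le> i \<and> i \<le> int I \<and> 1 \<le> j \<and> j \<le> int J" if "(i, j) \<in> K" for i j
      using that by (auto simp: K_def)
  qed
  moreover have "T * degree p \<le> real N * degree p" "T * ht p \<le> real N * ht p"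
    using p(2) ht_nonneg[OF p0] by (auto simp: N_def intro!: mult_right_mono)
  ultimately have "(degree p \<le> 1 \<and> ht p \<le> ln (real (I + J))) \<or> (T * degree p \<le> n \<and> T * ht p \<le> h)"
    using Q(2) dlnIJ h by fastforce
  then show ?thesis using kl p dp by blast
qed

text \<open>The heavy factor is small at some k \<xi> + l depending on n, whereas Gelfond's
  criterion concerns one fixed number. Composing with k T + l moves it there at logarithmic
  cost.\<close>

lemma pullback_of_prime_factor:
  assumes p: "p \<noteq> 0" and k: "1 \<le> k" and l: "0 \<le> l" and \<rho>: "0 < \<rho>" "\<rho> \<le> s" "s \<le> 1"
    and nz: "poly (of_int_poly p) (of_int k * \<xi> + of_int l) \<noteq> 0"
  defines "F \<equiv> p \<circ>\<^sub>p [:l, k:]"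
  shows "F \<noteq> 0" "degree F = degree p" "ht F \<le> ht p + degree p * ln (real_of_int (k + l))"
    "pot s \<rho> (of_int k * \<xi> + of_int l) p - ht p - degree p * ln (1 + cmod (of_int k * \<xi> + of_int l))
      \<le> - ln (cmod (poly (of_int_poly F) \<xi>))"
proof -
  show "F \<noteq> 0" unfolding F_def using p k by (intro pcompose_affine_nonzero) auto
  show "degree F = degree p" unfolding F_def using k by simp
  show "ht F \<le> ht p + degree p * ln (real_of_int (k + l))"
    unfolding F_def using p k l by (intro ht_pcompose_le) auto
  have "poly (of_int_poly F) \<xi> = poly (of_int_poly p) (of_int k * \<xi> + of_int l)"
    by (simp add: F_def of_int_hom.map_poly_pcompose poly_pcompose poly_of_int_linear add.commute)
  then show "pot s \<rho> (of_int k * \<xi> + of_int l) p - ht p - degree p * ln (1 + cmod (of_int k * \<xi> + of_int l))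
      \<le> - ln (cmod (poly (of_int_poly F) \<xi>))"
    using pot_le_minus_ln[OF p \<rho> nz] by simp
qed

section \<open>Parameters\<close>

lemma nat_floor_bounds:
  fixes y :: real
  assumes "1 \<le> y"
  shows "1 \<le> nat \<lfloor>y\<rfloor>" "real (nat \<lfloor>y\<rfloor>) \<le> y" "y / 2 \<le> real (nat \<lfloor>y\<rfloor>)" "y < real (nat \<lfloor>y\<rfloor> + 1)"
proof -
  have f: "1 \<le> \<lfloor>y\<rfloor>" using assms by (simp add: le_floor_iff)
  then have r: "real (nat \<lfloor>y\<rfloor>) = of_int \<lfloor>y\<rfloor>" by simp
  show "1 \<le> nat \<lfloor>y\<rfloor>" using f by linarith
  have "of_int \<lfloor>y\<rfloor> \<le> y" "y < of_int \<lfloor>y\<rfloor> + 1" by linarith+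
  then show "real (nat \<lfloor>y\<rfloor>) \<le> y" "y < real (nat \<lfloor>y\<rfloor> + 1)" unfolding of_nat_add r by simp_all
  have "1 \<le> real_of_int \<lfloor>y\<rfloor>" using f by simp
  then show "y / 2 \<le> real (nat \<lfloor>y\<rfloor>)" unfolding r by linarith
qed

text \<open>Halving leaves room for i l and j to share the range up to n^\<sigma>2. The value 1 is
  forced as a minimum; for y < 4 it is the only value, and then the index l below k can only be
  0.\<close>

lemma half_floor_bounds:
  fixes y :: real
  assumes "1 \<le> y"
  defines "k \<equiv> max 1 (nat \<lfloor>y / 2\<rfloor>)"
  shows "1 \<le> k" "real k \<le> y" "y / 4 \<le> real k" "2 \<le> y \<Longrightarrow> real k \<le> y / 2" "y < 4 \<Longrightarrow> k = 1"
proof -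
  show "1 \<le> k" by (simp add: k_def)
  have fl: "real (nat \<lfloor>y / 2\<rfloor>) \<le> y / 2"
  proof -
    have "0 \<le> \<lfloor>y / 2\<rfloor>" using assms(1) by simp
    then have "real (nat \<lfloor>y / 2\<rfloor>) = of_int \<lfloor>y / 2\<rfloor>" by simp
    then show ?thesis by linarith
  qed
  then show "real k \<le> y" using assms(1) by (auto simp: k_def)
  show "real k \<le> y / 2" if "2 \<le> y" using fl that by (auto simp: k_def)
  show "y / 4 \<le> real k"
  proof (cases "2 \<le> y")
    case True
    then show ?thesis using nat_floor_bounds(3)[of "y / 2"] by (auto simp: k_def)
  qed (auto simp: k_def)
  show "k = 1" if "y < 4"
  proof -
    have "\<lfloor>y / 2\<rfloor> < 2" using that by (simp add: floor_less_iff)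
    then have "nat \<lfloor>y / 2\<rfloor> \<le> 1" by linarith
    then show ?thesis unfolding k_def by (rule max_absorb1)
  qed
qed

lemma gelfond_polynomial_if_close_points:
  fixes \<xi> :: complex and k l k' l' :: int
  assumes ne: "(k, l) \<noteq> (k', l')" and bnd: "real_of_int \<bar>k - k'\<bar> + real_of_int \<bar>l - l'\<bar> \<le> exp \<Lambda>"
    and close: "cmod ((of_int k * \<xi> + of_int l) - (of_int k' * \<xi> + of_int l')) < 2 * exp (- W)"
    and W: "ln 2 \<le> W" and \<xi>: "\<not> algebraic \<xi>"
  shows "\<exists>F. F \<noteq> 0 \<and> degree F = 1 \<and> ht F \<le> \<Lambda> \<and> W - ln 2 < - ln (cmod (poly (of_int_poly F) \<xi>))"
proof -
  define u m where "u = k - k'" and "m = l - l'"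
  let ?F = "[:m, u:]"
  have ev: "poly (of_int_poly ?F) \<xi> = (of_int k * \<xi> + of_int l) - (of_int k' * \<xi> + of_int l')"
    unfolding poly_of_int_linear by (simp add: u_def m_def algebra_simps)
  have "2 * exp (- W) \<le> 1"
  proof -
    have "exp (- W) \<le> exp (- ln 2)" using W by simp
    then show ?thesis by (simp add: exp_minus)
  qed
  \<comment> \<open>For u = 0 the difference of the points would be a nonzero integer, too large to
    be below 2 exp(- W) \<le> 1.\<close>
  have "u \<noteq> 0"
  proof
    assume u0: "u = 0"
    then have "m \<noteq> 0" using ne by (auto simp: u_def m_def)
    then have "1 \<le> \<bar>real_of_int m\<bar>" by linarith
    moreover have "cmod (poly (of_int_poly ?F) \<xi>) = \<bar>real_of_int m\<bar>"
      unfolding poly_of_int_linear u0 by simp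
    ultimately show False using close \<open>2 * exp (- W) \<le> 1\<close> unfolding ev by linarith
  qed
  then have F0: "?F \<noteq> 0" by simp
  have "ht ?F = ln (real_of_int (\<bar>u\<bar> + \<bar>m\<bar>))" using \<open>u \<noteq> 0\<close> by (rule ht_linear)
  also have "\<dots> \<le> \<Lambda>"
  proof (rule ln_le_if_le_exp)
    have "0 < \<bar>u\<bar> + \<bar>m\<bar>" using \<open>u \<noteq> 0\<close> by linarith
    then show "0 < real_of_int (\<bar>u\<bar> + \<bar>m\<bar>)" by (simp only: of_int_0_less_iff)
    show "real_of_int (\<bar>u\<bar> + \<bar>m\<bar>) \<le> exp \<Lambda>" using bnd by (simp add: u_def m_def)
  qed
  finally have ht: "ht ?F \<le> \<Lambda>" .
  have pos: "0 < cmod (poly (of_int_poly ?F) \<xi>)" using not_algebraic_imp_nonzero[OF \<xi> F0] by simp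
  have "ln (cmod (poly (of_int_poly ?F) \<xi>)) < ln (2 * exp (- W))"
    using pos close unfolding ev by (subst ln_less_cancel_iff) auto
  also have "\<dots> = ln 2 - W" by (simp add: ln_mult_pos)
  finally show ?thesis using F0 ht \<open>u \<noteq> 0\<close> by (intro exI[of _ ?F]) auto
qed

text \<open>The construction for one n. \<Lambda> dominates the logarithm of anything up to D N^3;
  the exponent 3 covers the index range N^\<sigma>1, as \<sigma>1 = 3 a < 3. The hypotheses
  \<open>e3\<close> to \<open>e12\<close> are growth comparisons that hold for large n under the
  final choice of exponents.\<close>

lemma gelfond_polynomial_exists:
  fixes \<xi> :: complex and r :: rat and n :: nat and P :: "int poly"
    and \<beta> \<sigma>1 \<sigma>2 \<tau> \<nu> \<kappa> d h x D :: real
  defines "a \<equiv> \<sigma>1 / 3" and "N \<equiv> real n" and "\<xi>' \<equiv> \<xi> / of_rat r"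
    and "R \<equiv> real_of_int (snd (quotient_of r))" and "c1 \<equiv> max 1 (real_of_rat \<bar>r\<bar>)"
  defines "S \<equiv> a + \<sigma>2 + \<tau>" and "\<Lambda> \<equiv> ln (D * N powr 3)" and "V \<equiv> N powr \<nu>"
  assumes \<xi>: "\<not> algebraic \<xi>" and r: "r \<noteq> 0"
    and exps: "0 \<le> \<sigma>1" "\<sigma>1 \<le> 3 * \<sigma>2" "0 \<le> \<tau>" "S < 1" "1 < \<beta>" "0 < d"
    and D: "2 * (1 + cmod \<xi> + c1) \<le> D" "2 * (1 + cmod \<xi>') \<le> D" and n: "1 \<le> n"
    and e3: "2 * N powr \<kappa> \<le> N powr (\<nu> - \<tau>)" and e4: "2 * \<Lambda> \<le> N powr (\<nu> - \<tau>)"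
    and e5: "16 * N powr (1 + \<kappa>) \<le> V" "16 * (ln 2 + ln R) * N \<le> V" "64 * (N * \<Lambda>) \<le> V" "16 * N powr \<beta> \<le> V"
    and e6: "4 * (N * \<Lambda>) \<le> N powr \<beta>" "2 * (ln 4 + ln R + ln c1) * N \<le> N powr \<beta>"
    and e7: "4096 * N powr (1 + \<beta>) \<le> N powr (\<nu> + S)"
    and e8: "128 * N powr (1 - S) \<le> N powr d"
    and e9: "512 * N powr (\<beta> - S) \<le> N powr h" "256 * (N powr (1 - S) * \<Lambda>) \<le> N powr h" "\<Lambda> \<le> N powr (\<beta> - S)"
    and e10: "48 * \<Lambda> \<le> N powr (\<nu> - 1)" "48 * N powr (x - d) \<le> N powr (\<nu> - 1)" "48 * (N powr (x - h) * \<Lambda>) \<le> N powr (\<nu> - 1)"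
    and e11: "64 \<le> N powr (\<nu> - \<beta>)" "64 * N powr (x - h) \<le> N powr (\<nu> - \<beta>)"
    and e12: "4 \<le> N powr \<kappa>" "4 * N powr (x - d) \<le> N powr \<kappa>" "4 * (N powr (x - h) * \<Lambda>) \<le> N powr \<kappa>"
    and P: "P \<noteq> 0" "degree P \<le> n" "\<And>i. \<bar>real_of_int (coeff P i)\<bar> \<le> exp (N powr \<beta>)"
    and small: "\<And>i j k. 1 \<le> i \<Longrightarrow> real_of_int i \<le> N powr \<sigma>1 \<Longrightarrow> 1 \<le> j \<Longrightarrow> real_of_int j \<le> N powr \<sigma>2 \<Longrightarrow>
      real k \<le> N powr \<tau> \<Longrightarrow> cmod (poly (divided_pderiv k (of_int_poly P)) (of_int i * \<xi> + of_int j * of_rat r)) \<le> exp (- V)"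
  shows "\<exists>F :: int poly. F \<noteq> 0 \<and> degree F \<le> N powr d \<and> ht F \<le> N powr h \<and>
      N powr x * (degree F / N powr d + ht F / N powr h) < - ln (cmod (poly (of_int_poly F) \<xi>'))"
proof -
  have N1: "1 \<le> N" using n by (simp add: N_def)
  then have N0: "0 < N" by simp
  have a: "0 \<le> a" "a \<le> \<sigma>2" "\<sigma>1 = 3 * a" using exps by (simp_all add: a_def)
  have ex1: "0 \<le> \<sigma>2" "a < 1" "\<sigma>2 < 1" "\<tau> < 1" "0 \<le> S" using a exps by (auto simp: S_def)
  have pow1: "1 \<le> N powr y" if "0 \<le> y" for y using that N1 by (rule_tac ge_one_powr_ge_zero)
  have pmono: "N powr y \<le> N powr z" if "y \<le> z" for y z using that N1 by (rule_tac powr_mono)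
  have \<xi>': "\<not> algebraic \<xi>'" unfolding \<xi>'_def using \<xi> r by (rule not_algebraic_div_rat)
  have r\<xi>: "of_rat r * \<xi>' = \<xi>" using r by (simp add: \<xi>'_def)
  have c1: "1 \<le> c1" by (simp add: c1_def)
  have cmodr: "cmod (of_rat r) \<le> c1"
  proof -
    obtain u v where "quotient_of r = (u, v)" by fastforce
    then have "r = of_int u / of_int v" "0 < v" by (auto intro: quotient_of_div quotient_of_denom_pos)
    then show ?thesis by (simp add: c1_def of_rat_divide norm_divide abs_divide flip: of_int_abs)
  qed
  obtain R1 R2 where R12: "quotient_of r = (R1, R2)" by fastforce
  have R: "R = real_of_int R2" by (simp add: R_def R12)
  have "0 < R2" using R12 by (rule quotient_of_denom_pos)
  then have R1': "1 \<le> R" unfolding R by linarith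
  have Dpos: "2 \<le> D"
  proof -
    have nn: "0 \<le> cmod \<xi>" by (rule norm_ge_zero)
    have "1 \<le> 1 + cmod \<xi> + c1" using c1 nn by linarith
    then have "2 \<le> 2 * (1 + cmod \<xi> + c1)" by simp
    then show ?thesis using D(1) by (rule order_trans)
  qed
  have expL: "exp \<Lambda> = D * N powr 3" unfolding \<Lambda>_def using Dpos N0 by simp
  have ln_le: "ln y \<le> \<Lambda>" if "0 < y" "y \<le> D * N powr 3" for y
    using that by (intro ln_le_if_le_exp) (simp_all add: expL)
  have N3: "N \<le> N powr 3" using pmono[of 1 3] N0 by simp
  have prod_le: "c * y \<le> D * N powr 3" if "0 \<le> c" "c \<le> D" "0 \<le> y" "y \<le> N powr 3" for c y
    using that by (intro mult_mono) auto
  have DN: "2 * N powr 3 \<le> D * N powr 3" using Dpos by (intro mult_right_mono) auto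
  have \<Lambda>0: "ln 2 \<le> \<Lambda>"
    using prod_le[of 2 1] Dpos pow1[of 3] by (intro ln_le) auto
  then have \<Lambda>0': "0 \<le> \<Lambda>" using ln_ge_zero[of "2::real"] by linarith
  have powm: "N powr y * N powr z = N powr (y + z)" for y z by (simp add: powr_add)
  \<comment> \<open>s is the separation scale. Shrinking to discs of radius s costs N W, which must
    be negligible against V; and a linear polynomial of size about exp(- W) at \<xi>' must already
    be small enough for Gelfond's criterion.\<close>
  define W s where "W = N powr \<kappa>" and "s = exp (- W)"
  have W1: "4 \<le> W" using e12(1) by (simp add: W_def)
  have ln2: "ln 2 \<le> (1::real)" "0 \<le> ln (2::real)" using ln_le_minus_one[of 2] by simp_all
  \<comment> \<open>Products i k stay below N^(a + 2 a) = N^\<sigma>1. The summand 1 in t counts the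
    derivative of order 0.\<close>
  define I J K1 K2 t where "I = nat \<lfloor>N powr a\<rfloor>" and "J = max 1 (nat \<lfloor>N powr \<sigma>2 / 2\<rfloor>)"
    and "K1 = nat \<lfloor>N powr (2 * a)\<rfloor>" and "K2 = max 1 (nat \<lfloor>N powr (\<sigma>2 - a) / 2\<rfloor>)"
    and "t = nat \<lfloor>N powr \<tau>\<rfloor> + 1"
  have bI: "1 \<le> I" "real I \<le> N powr a" "N powr a / 2 \<le> real I"
    unfolding I_def using nat_floor_bounds[OF pow1[OF a(1)]] by auto
  have bK1: "1 \<le> K1" "real K1 \<le> N powr (2 * a)" "N powr (2 * a) / 2 \<le> real K1"
    unfolding K1_def using nat_floor_bounds[OF pow1[of "2 * a"]] a by auto
  have bJ: "1 \<le> J" "real J \<le> N powr \<sigma>2" "N powr \<sigma>2 / 4 \<le> real J" "2 \<le> N powr \<sigma>2 \<Longrightarrow> real J \<le> N powr \<sigma>2 / 2"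
    unfolding J_def by (rule half_floor_bounds[OF pow1[OF ex1(1)]]; simp)+
  have sa: "0 \<le> \<sigma>2 - a" using a by simp
  have bK2: "1 \<le> K2" "real K2 \<le> N powr (\<sigma>2 - a)" "N powr (\<sigma>2 - a) / 4 \<le> real K2"
    "2 \<le> N powr (\<sigma>2 - a) \<Longrightarrow> real K2 \<le> N powr (\<sigma>2 - a) / 2" "N powr (\<sigma>2 - a) < 4 \<Longrightarrow> K2 = 1"
    unfolding K2_def by (rule half_floor_bounds[OF pow1[OF sa]]; simp)+
  have bt: "1 \<le> t" "N powr \<tau> \<le> real t" "real t \<le> 2 * N powr \<tau>"
  proof -
    note f = nat_floor_bounds[OF pow1[OF exps(3)]]
    show "1 \<le> t" by (simp add: t_def)
    show "N powr \<tau> \<le> real t" unfolding t_def using f(4) by linarith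
    show "real t \<le> 2 * N powr \<tau>" unfolding t_def of_nat_add of_nat_1 using f(2) pow1[OF exps(3)] by linarith
  qed
  have IN: "real I \<le> N" "real J \<le> N" "real K2 \<le> N powr 3" "real K1 \<le> N powr 3"
    using bI(2) bJ(2) bK1(2) bK2(2) pmono[of a 1] pmono[of \<sigma>2 1] pmono[of "2 * a" 3] pmono[of "\<sigma>2 - a" 3] ex1 a N0 by auto
  have IJt: "N powr S / 8 \<le> real I * real J * real t"
  proof -
    have "N powr S / 8 = (N powr a / 2) * (N powr \<sigma>2 / 4) * N powr \<tau>" by (simp add: S_def powr_add)
    also have "\<dots> \<le> real I * real J * real t" using bI bJ bt by (intro mult_mono) auto
    finally show ?thesis .
  qed
  have KKt: "N powr S / 8 \<le> real K1 * real K2 * real t"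
  proof -
    have "S = 2 * a + (\<sigma>2 - a) + \<tau>" by (simp add: S_def)
    then have "N powr S / 8 = (N powr (2 * a) / 2) * (N powr (\<sigma>2 - a) / 4) * N powr \<tau>" by (simp only: powr_add)
    also have "\<dots> \<le> real K1 * real K2 * real t" using bK1 bK2 bt by (intro mult_mono) auto
    finally show ?thesis .
  qed
  have V0: "0 < V" using N0 by (simp add: V_def)
  have t0: "0 < real t" using bt(1) by simp
  have Vt: "N powr (\<nu> - \<tau>) / 2 \<le> V / t"
  proof -
    have "N powr (\<nu> - \<tau>) / 2 = V / (2 * N powr \<tau>)" by (simp add: V_def powr_diff)
    also have "\<dots> \<le> V / t" using bt(3) t0 V0 N0 by (intro divide_left_mono mult_pos_pos) auto
    finally show ?thesis .
  qed
  have VtW: "W \<le> V / t" using e3 Vt unfolding W_def by linarith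
  have VtL: "\<Lambda> \<le> V / t" using e4 Vt by linarith
  have Ipos: "0 < real I" "0 < real J" "1 \<le> real I" using bI(1) bJ(1) by simp_all
  have lnIJ: "ln (real (I + J)) \<le> \<Lambda>"
  proof (rule ln_le)
    show "0 < real (I + J)" using Ipos by simp
    have "real (I + J) \<le> 2 * N powr 3" using IN N3 unfolding of_nat_add by linarith
    then show "real (I + J) \<le> D * N powr 3" using DN by linarith
  qed
  show ?thesis
  proof (cases "\<exists>k l k' l'. k \<in> {1..int K1} \<and> k' \<in> {1..int K1} \<and> l \<in> {0..<int K2} \<and> l' \<in> {0..<int K2} \<and>
      (k, l) \<noteq> (k', l') \<and> cmod ((of_int k * \<xi>' + of_int l) - (of_int k' * \<xi>' + of_int l')) < 2 * exp (- W)")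
    case True
    then obtain k l k' l' where kl: "k \<in> {1..int K1}" "k' \<in> {1..int K1}" "l \<in> {0..<int K2}" "l' \<in> {0..<int K2}"
      "(k, l) \<noteq> (k', l')" "cmod ((of_int k * \<xi>' + of_int l) - (of_int k' * \<xi>' + of_int l')) < 2 * exp (- W)" by blast
    have "real_of_int \<bar>k - k'\<bar> + real_of_int \<bar>l - l'\<bar> \<le> exp \<Lambda>"
    proof -
      have "\<bar>k - k'\<bar> \<le> int K1" "\<bar>l - l'\<bar> \<le> int K2" using kl by auto
      then have "real_of_int \<bar>k - k'\<bar> \<le> K1" "real_of_int \<bar>l - l'\<bar> \<le> K2" by linarith+
      then have "real_of_int \<bar>k - k'\<bar> + real_of_int \<bar>l - l'\<bar> \<le> 2 * N powr 3" using IN by linarith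
      also have "\<dots> \<le> exp \<Lambda>" unfolding expL by (rule DN)
      finally show ?thesis .
    qed
    from gelfond_polynomial_if_close_points[OF kl(5) this kl(6) _ \<xi>'] W1 ln2
    obtain F where F: "F \<noteq> 0" "degree F = 1" "ht F \<le> \<Lambda>" "W - ln 2 < - ln (cmod (poly (of_int_poly F) \<xi>'))" by auto
    have "N powr x * (degree F / N powr d + ht F / N powr h) = N powr (x - d) + N powr (x - h) * ht F"
      using N0 F(2) by (simp add: distrib_left powr_diff)
    also have "\<dots> \<le> N powr (x - d) + N powr (x - h) * \<Lambda>" using F(3) by (intro add_left_mono mult_left_mono) auto
    \<comment> \<open>By \<open>e12\<close> both terms are at most W / 4, and W \<ge> 4 leaves room
      for ln 2.\<close>
    also have "\<dots> \<le> W - ln 2" using e12 ln2 W1 by (simp add: W_def)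
    finally have "N powr x * (degree F / N powr d + ht F / N powr h) < - ln (cmod (poly (of_int_poly F) \<xi>'))" using F(4) by linarith
    moreover have "degree F \<le> N powr d" using F(2) pow1[of d] exps by simp
    moreover have "ht F \<le> N powr h" using F(3) e9(1,3) powr_ge_zero[of N "\<beta> - S"] by linarith
    ultimately show ?thesis using F(1) by blast
  next
    case False
    obtain Q where Q: "Q \<noteq> 0" "degree Q \<le> n"
      "\<And>z. poly (of_int_poly Q) z = of_int R2 ^ n * poly (of_int_poly P) (of_rat r * z :: complex)"
      "ht Q \<le> n * ln 4 + ln (real_of_int R2 ^ n * ((real n + 1) * (exp (N powr \<beta>) * (max 1 (real_of_rat \<bar>r\<bar>)) ^ n)))"
      using rescaled_polynomial[OF P(1) r P(2,3) R12] by blast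
    \<comment> \<open>\<rho>' is chosen so that its t-th power is exp(- V), the size of the given
      derivatives. The map from z to r (i z + j) expands distances by at most c1 * I, hence the
      smaller radius \<rho>.\<close>
    define \<rho>' \<rho> where "\<rho>' = exp (- (V / t))" and "\<rho> = \<rho>' / (c1 * I)"
    define Y where "Y = (cmod \<xi> + c1) * N powr 3"
    define A where "A = (N + 1) * (exp (N powr \<beta>) * (1 + Y) ^ n)"
    define e where "e = R ^ n * ((N + 1) * (exp (- V) + A * exp (- V)))"
    have Y0: "0 \<le> Y" unfolding Y_def using c1 by (intro mult_nonneg_nonneg add_nonneg_nonneg) auto
    have A1: "1 \<le> A"
    proof -
      have "1 * (1 * 1) \<le> (N + 1) * (exp (N powr \<beta>) * (1 + Y) ^ n)"
        using N0 Y0 by (intro mult_mono) (auto intro: one_le_power)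
      then show ?thesis by (simp add: A_def)
    qed
    have lnN1: "ln (N + 1) \<le> \<Lambda>"
    proof (rule ln_le)
      show "N + 1 \<le> D * N powr 3" using N1 N3 DN by linarith
    qed (use N0 in simp)
    have NL: "\<Lambda> \<le> N * \<Lambda>" using mult_right_mono[OF N1 \<Lambda>0'] by simp
    have lnY: "ln (1 + Y) \<le> \<Lambda>"
    proof (rule ln_le)
      have "1 + Y \<le> N powr 3 + (cmod \<xi> + c1) * N powr 3" using pow1[of 3] by (simp add: Y_def)
      also have "\<dots> = (1 + cmod \<xi> + c1) * N powr 3" by (simp add: algebra_simps)
      also have "\<dots> \<le> D * N powr 3"
      proof (intro mult_right_mono)
        show "1 + cmod \<xi> + c1 \<le> D" using D(1) c1 norm_ge_zero[of \<xi>] unfolding distrib_left by linarith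
      qed simp
      finally show "1 + Y \<le> D * N powr 3" .
    qed (use Y0 in simp)
    have lne: "ln e \<le> N * ln R + 4 * (N * \<Lambda>) + N powr \<beta> - V"
    proof -
      have "e = R ^ n * ((N + 1) * ((1 + A) * exp (- V)))" by (simp add: e_def algebra_simps)
      also have "ln \<dots> = N * ln R + (ln (N + 1) + (ln (1 + A) - V))"
        using R1' N0 A1 by (simp add: ln_mult_pos ln_realpow N_def)
      also have "ln (1 + A) \<le> ln (2 * A)" using A1 by (subst ln_le_cancel_iff) auto
      also have "ln (2 * A) = ln 2 + (ln (N + 1) + (N powr \<beta> + N * ln (1 + Y)))"
        unfolding A_def using N0 Y0 by (simp add: ln_mult_pos ln_realpow N_def)
      finally have "ln e \<le> N * ln R + (ln (N + 1) + (ln 2 + (ln (N + 1) + (N powr \<beta> + N * ln (1 + Y))) - V))" by simp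
      moreover have "N * ln (1 + Y) \<le> N * \<Lambda>" using lnY N0 by (intro mult_left_mono) auto
      ultimately show ?thesis using lnN1 \<Lambda>0 NL by linarith
    qed
    have NW: "N * W = N powr (1 + \<kappa>)" using N0 by (simp add: W_def powr_add)
    have lnR: "0 \<le> ln R" using R1' by simp
    have cI: "1 \<le> c1 * I" using mult_mono[OF c1 Ipos(3)] c1 by simp
    have \<rho>0: "0 < \<rho>" unfolding \<rho>_def \<rho>'_def using cI by (intro divide_pos_pos) auto
    have \<rho>\<rho>': "\<rho> \<le> \<rho>'" unfolding \<rho>_def \<rho>'_def using cI by (simp add: divide_le_eq)
    have \<rho>'s: "\<rho>' \<le> s" unfolding \<rho>'_def s_def using VtW by simp
    have s2: "s \<le> 1 / 2"
    proof -
      have "s \<le> exp (- ln 2)" unfolding s_def using W1 ln2 by simp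
      then show ?thesis by (simp add: exp_minus)
    qed
    have lns: "ln s = - W" by (simp add: s_def)
    \<comment> \<open>Here V / t comes from \<rho>'; the second V / t absorbs the logarithm of c1 *
      I, which is at most \<Lambda>.\<close>
    have ln\<rho>: "ln s - ln \<rho> \<le> 2 * V / t"
    proof -
      have "ln \<rho> = - (V / t) - ln (c1 * I)" unfolding \<rho>_def \<rho>'_def using cI by (subst ln_div) auto
      moreover have "ln (c1 * I) \<le> \<Lambda>"
      proof (intro ln_le prod_le)
        show "c1 \<le> D" using D(1) c1 norm_ge_zero[of \<xi>] unfolding distrib_left by linarith
        show "real I \<le> N powr 3" using IN N3 by linarith
      qed (use cI c1 in auto)
      ultimately show ?thesis using lns VtL W1 by simp
    qed
    \<comment> \<open>These are the indices of i (k \<xi>' + l) + j, which is r^(-1) times a point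
      where P is small.\<close>
    have indices: "1 \<le> i * k" "real_of_int (i * k) \<le> N powr \<sigma>1" "1 \<le> i * l + j" "real_of_int (i * l + j) \<le> N powr \<sigma>2"
      if "i \<in> {1..int I}" "j \<in> {1..int J}" "k \<in> {1..int K1}" "l \<in> {0..<int K2}" for i j k l
    proof -
      have b: "1 \<le> i" "i \<le> int I" "1 \<le> j" "j \<le> int J" "1 \<le> k" "k \<le> int K1" "0 \<le> l" "l \<le> int K2 - 1" using that by auto
      show "1 \<le> i * k" using mult_mono[of 1 i 1 k] b by simp
      have "0 \<le> i * l" using b by simp
      then show "1 \<le> i * l + j" using b by linarith
      have "real_of_int (i * k) \<le> real I * real K1" using b unfolding of_int_mult by (intro mult_mono) auto
      also have "\<dots> \<le> N powr a * N powr (2 * a)" using bI bK1 by (intro mult_mono) auto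
      also have "\<dots> = N powr \<sigma>1" by (simp add: powm a(3))
      finally show "real_of_int (i * k) \<le> N powr \<sigma>1" .
      have il: "real_of_int (i * l) \<le> real I * (real K2 - 1)"
        using b unfolding of_int_mult by (intro mult_mono) auto
      \<comment> \<open>If N^(\<sigma>2 - a) < 4, then l = 0 and only j counts. Otherwise i l and j
        each take at most half of N^\<sigma>2.\<close>
      show "real_of_int (i * l + j) \<le> N powr \<sigma>2"
      proof (cases "N powr (\<sigma>2 - a) < 4")
        case True
        then have "real_of_int (i * l) \<le> 0" using il bK2(5) by simp
        then show ?thesis using b(4) bJ(2) by simp
      next
        case False
        then have "2 \<le> N powr \<sigma>2" using pmono[of "\<sigma>2 - a" \<sigma>2] a by simp
        then have J2: "real J \<le> N powr \<sigma>2 / 2" by (rule bJ(4))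
        have "real I * (real K2 - 1) \<le> N powr a * (N powr (\<sigma>2 - a) / 2)"
          using bI bK2(1,4) False by (intro mult_mono) auto
        also have "\<dots> = N powr \<sigma>2 / 2" by (simp add: powm)
        finally show ?thesis using il J2 b(4) by simp
      qed
    qed
    have smallQ: "cmod (poly (of_int_poly Q) (of_int i * z + of_int j)) \<le> e"
      if ix: "i \<in> {1..int I}" "j \<in> {1..int J}" "k \<in> {1..int K1}" "l \<in> {0..<int K2}"
        and z: "cmod (z - (of_int k * \<xi>' + of_int l)) \<le> \<rho>" for i j k l z
    proof -
      note ind = indices[OF ix]
      define y where "y = of_int (i * k) * \<xi> + of_int (i * l + j) * of_rat r"
      have y_eq: "y = of_rat r * (of_int i * (of_int k * \<xi>' + of_int l) + of_int j)"
        by (simp add: y_def r\<xi>[symmetric] algebra_simps)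
      have ip: "0 \<le> real_of_int i" "real_of_int i \<le> real I" using ix(1) by auto
      have "cmod (of_rat r * (of_int i * z + of_int j) - y) = cmod (of_rat r) * (real_of_int i * cmod (z - (of_int k * \<xi>' + of_int l)))"
      proof -
        have "of_rat r * (of_int i * z + of_int j) - y = of_rat r * (of_int i * (z - (of_int k * \<xi>' + of_int l)))"
          by (simp add: y_eq algebra_simps)
        then show ?thesis using ip by (simp add: norm_mult)
      qed
      also have "\<dots> \<le> c1 * (real I * \<rho>)"
        using cmodr ip z \<rho>0 c1 by (intro mult_mono mult_nonneg_nonneg) auto
      also have "\<dots> = \<rho>'" unfolding \<rho>_def using c1 Ipos by simp
      finally have dist: "cmod (of_rat r * (of_int i * z + of_int j) - y) \<le> \<rho>'" .
      have ycm: "cmod y \<le> Y"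
      proof -
        have p3: "N powr \<sigma>1 \<le> N powr 3" "N powr \<sigma>2 \<le> N powr 3" using ex1 a by (auto intro!: pmono)
        have "cmod y \<le> cmod (of_int (i * k) * \<xi>) + cmod (of_int (i * l + j) * of_rat r)"
          unfolding y_def by (rule norm_triangle_ineq)
        also have "\<dots> = real_of_int (i * k) * cmod \<xi> + real_of_int (i * l + j) * cmod (of_rat r)"
        proof -
          have "0 \<le> real_of_int (i * k)" "0 \<le> real_of_int (i * l + j)" using ind(1,3) by linarith+
          then show ?thesis by (simp only: norm_mult norm_of_int abs_of_nonneg)
        qed
        also have "\<dots> \<le> N powr 3 * cmod \<xi> + N powr 3 * c1"
          using ind p3 cmodr c1 by (intro add_mono mult_mono) auto
        finally show ?thesis by (simp add: Y_def algebra_simps)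
      qed
      have "cmod (poly (of_int_poly P) (of_rat r * (of_int i * z + of_int j))) \<le> (real n + 1) * (exp (- V) + A * \<rho>' ^ t)"
      proof (rule small_on_disc_if_small_derivatives[OF _ _ _ _ dist])
        show "degree (of_int_poly P :: complex poly) \<le> n" using P(2) by simp
        show "cmod (poly (divided_pderiv k (of_int_poly P)) y) \<le> A" for k
        proof -
          have "cmod (poly (divided_pderiv k (of_int_poly P)) y) \<le> (real n + 1) * (exp (N powr \<beta>) * (1 + cmod y) ^ n)"
            using P by (intro cmod_divided_pderiv_le) auto
          also have "\<dots> \<le> A" unfolding A_def N_def using ycm by (intro mult_left_mono power_mono) auto
          finally show ?thesis .
        qed
        show "cmod (poly (divided_pderiv k (of_int_poly P)) y) \<le> exp (- V)" if "k < t" for k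
        proof -
          have "k \<le> nat \<lfloor>N powr \<tau>\<rfloor>" using that by (simp add: t_def)
          then have "real k \<le> N powr \<tau>" using nat_floor_bounds(2)[OF pow1[OF exps(3)]] by linarith
          then show ?thesis unfolding y_def using small ind by blast
        qed
        show "\<rho>' \<le> 1" using \<rho>'s s2 by linarith
      qed (simp_all add: \<rho>'_def)
      also have "\<rho>' ^ t = exp (- V)" using t0 by (simp add: \<rho>'_def exp_of_nat_mult[symmetric])
      finally have "cmod (poly (of_int_poly P) (of_rat r * (of_int i * z + of_int j))) \<le> (N + 1) * (exp (- V) + A * exp (- V))"
        by (simp add: N_def)
      then show ?thesis
        unfolding Q(3) e_def R norm_mult norm_power norm_of_int using \<open>0 < R2\<close> by (intro mult_mono) auto
    qed
    have N\<beta>: "0 < N powr \<beta>" using N0 by simp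
    have lnQ: "ht Q + n * ln (real (I + J)) \<le> 2 * N powr \<beta>"
    proof -
      have "ln (real_of_int R2 ^ n * ((real n + 1) * (exp (N powr \<beta>) * c1 ^ n))) = N * ln R + (ln (N + 1) + (N powr \<beta> + N * ln c1))"
        using R1' N0 c1 by (simp add: ln_mult_pos ln_realpow N_def R)
      then have "ht Q \<le> N * ln 4 + (N * ln R + (ln (N + 1) + (N powr \<beta> + N * ln c1)))"
        using Q(4) by (simp add: c1_def N_def)
      moreover have "n * ln (real (I + J)) \<le> N * \<Lambda>" unfolding N_def using lnIJ by (intro mult_left_mono) auto
      moreover have "2 * (N * ln 4) + 2 * (N * ln R) + 2 * (N * ln c1) \<le> N powr \<beta>"
        using e6(2) by (simp add: algebra_simps)
      ultimately show ?thesis using lnN1 NL e6(1) by linarith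
    qed
    \<comment> \<open>Each of the four losses, N W, N (ln 2 + ln R), 4 N \<Lambda> and N^\<beta>, is
      at most V / 16.\<close>
    have VB: "V / 2 \<le> n * ln s - n * ln 2 - ln e"
    proof -
      have "16 * (N * ln 2) + 16 * (N * ln R) \<le> V" using e5(2) by (simp add: algebra_simps)
      moreover have "real n * ln s = - (N * W)" by (simp add: lns N_def)
      moreover have "real n * ln 2 = N * ln 2" by (simp add: N_def)
      ultimately show ?thesis using lne e5 NW V0 by linarith
    qed
    have IJ0: "0 < real I * real J" using Ipos by simp
    \<comment> \<open>With potential V / 2 per dilate and B = 2 V / t, the ratio E / (2 B) is I J t
      / 8, and the threshold is half of it. The weights spend I J V / 16 on the degree and as much
      on the height, together half of E / 2 = I J V / 4.\<close>
    have "\<exists>k l p. k \<in> {1..int K1} \<and> l \<in> {0..<int K2} \<and> prime p \<and> 0 < degree p \<and>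
      V / (16 * N) * degree p + V / (32 * N powr \<beta>) * ht p < pot s \<rho> (of_int k * \<xi>' + of_int l) p \<and>
      ((degree p \<le> 1 \<and> ht p \<le> ln (real (I + J))) \<or>
        (I * J * t / 16 * degree p \<le> n \<and> I * J * t / 16 * ht p \<le> 2 * N powr \<beta>))"
    proof (rule exists_heavy_factor_of_dilates[where e = e and B = "2 * V / t" and V = "V / 2"])
      show "2 * s \<le> cmod ((of_int k * \<xi>' + of_int l) - (of_int k' * \<xi>' + of_int l'))"
        if "k \<in> {1..int K1}" "k' \<in> {1..int K1}" "l \<in> {0..<int K2}" "l' \<in> {0..<int K2}" "(k, l) \<noteq> (k', l')" for k l k' l'
        using False that unfolding s_def by (meson not_le)
      show "\<rho> \<le> s" using \<rho>\<rho>' \<rho>'s by linarith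
      have BT: "real I * real J * (V / 2) / (2 * (2 * V / t)) = real I * real J * t / 8" using V0 t0 by (simp add: field_simps)
      have BT': "real (I * J) * (V / 2) / (2 * (2 * V / t)) = real I * real J * t / 8" unfolding of_nat_mult by (rule BT)
      show "I * J * t / 16 \<le> real (I * J) * (V / 2) / (2 * (2 * V / t))"
        using IJ0 t0 unfolding of_nat_mult BT by simp
      show "2 * real (I * J * n) * (real (I * J) * (2 * N powr \<beta>))
        < real (K1 * K2) * (real (I * J) * (V / 2) / 2 * (real (I * J) * (V / 2) / (2 * (2 * V / t)) - I * J * t / 16))"
      proof -
        have "2 * real (I * J * n) * (real (I * J) * (2 * N powr \<beta>)) = (real I * real J) * (real I * real J) * (4 * N powr (1 + \<beta>))"
          using N0 by (simp add: N_def[symmetric] powr_add)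
        \<comment> \<open>The factor (I J)^2 cancels, and what remains compares N^(\<nu> + S) with
          N^(1 + \<beta>): the hypothesis on \<nu>, up to constants.\<close>
        also have "\<dots> < (real I * real J) * (real I * real J) * (real K1 * real K2 * t * V / 64)"
        proof (rule mult_strict_left_mono)
          have "N powr S / 8 * V \<le> real K1 * real K2 * t * V" using KKt V0 by (intro mult_right_mono) auto
          moreover have "N powr S * V = N powr (\<nu> + S)" by (simp add: V_def powm add.commute)
          moreover have "0 < N powr (1 + \<beta>)" using N0 by simp
          ultimately show "4 * N powr (1 + \<beta>) < real K1 * real K2 * t * V / 64" using e7 by linarith
          show "0 < real I * real J * (real I * real J)" using IJ0 by simp
        qed
        also have "\<dots> = real (K1 * K2) * (real (I * J) * (V / 2) / 2 * (real I * real J * t / 8 - I * J * t / 16))"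
          by simp
        finally show ?thesis unfolding BT' .
      qed
      show "V / (16 * N) * real (I * J * n) + V / (32 * N powr \<beta>) * (real (I * J) * (2 * N powr \<beta>)) < real (I * J) * (V / 2) / 2"
        using N0 N\<beta> IJ0 V0 by (simp add: N_def[symmetric])
    qed (use Q bI bJ smallQ \<rho>0 s2 V0 t0 ln\<rho> VB lnQ N0 in auto)
    then obtain k l p where kl: "k \<in> {1..int K1}" "l \<in> {0..<int K2}" and p: "prime p" "0 < degree p"
      and potp: "V / (16 * N) * degree p + V / (32 * N powr \<beta>) * ht p < pot s \<rho> (of_int k * \<xi>' + of_int l) p"
      and alt: "(degree p \<le> 1 \<and> ht p \<le> ln (real (I + J))) \<or>
        (I * J * t / 16 * degree p \<le> n \<and> I * J * t / 16 * ht p \<le> 2 * N powr \<beta>)" by blast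
    have p0: "p \<noteq> 0" using p by auto
    have hp0: "0 \<le> ht p" by (rule ht_nonneg[OF p0])
    have T: "N powr S / 128 \<le> I * J * t / 16" using IJt by simp
    \<comment> \<open>A linear factor of logarithmic height obeys the same bounds, because S < 1 and
      \<Lambda> is at most N^(\<beta> - S).\<close>
    have dp: "degree p \<le> 128 * N powr (1 - S)" and hp: "ht p \<le> 256 * N powr (\<beta> - S)"
    proof -
      have NS: "0 < N powr S" using N0 by simp
      have d1: "degree p \<le> 128 * N powr (1 - S)" if "I * J * t / 16 * degree p \<le> n"
      proof -
        have "N powr S / 128 * degree p \<le> N" using mult_right_mono[OF T of_nat_0_le_iff[of "degree p"]] that unfolding N_def by linarith
        then have "degree p \<le> 128 * (N / N powr S)" using NS by (simp add: field_simps)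
        then show ?thesis using N0 by (simp add: powr_diff)
      qed
      have d2: "ht p \<le> 256 * N powr (\<beta> - S)" if "I * J * t / 16 * ht p \<le> 2 * N powr \<beta>"
      proof -
        have "N powr S / 128 * ht p \<le> 2 * N powr \<beta>" using mult_right_mono[OF T hp0] that by linarith
        then have "ht p \<le> 256 * (N powr \<beta> / N powr S)" using NS by (simp add: field_simps)
        then show ?thesis by (simp add: powr_diff)
      qed
      have "1 \<le> N powr (1 - S)" using exps by (intro pow1) simp
      then have d3: "degree p \<le> 128 * N powr (1 - S)" if "degree p \<le> 1" using that by simp
      have d4: "ht p \<le> 256 * N powr (\<beta> - S)" if "ht p \<le> ln (real (I + J))"
        using that lnIJ e9(3) powr_ge_zero[of N "\<beta> - S"] by linarith
      show "degree p \<le> 128 * N powr (1 - S)" "ht p \<le> 256 * N powr (\<beta> - S)" using alt d1 d2 d3 d4 by blast+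
    qed
    have k1: "1 \<le> k" "0 \<le> l" using kl by auto
    let ?F = "p \<circ>\<^sub>p [:l, k:]"
    have "?F \<noteq> 0" using p0 k1 by (intro pcompose_affine_nonzero) auto
    then have "poly (of_int_poly ?F) \<xi>' \<noteq> 0" by (rule not_algebraic_imp_nonzero[OF \<xi>'])
    then have nz: "poly (of_int_poly p) (of_int k * \<xi>' + of_int l) \<noteq> 0"
      by (simp add: of_int_hom.map_poly_pcompose poly_pcompose poly_of_int_linear add.commute)
    have \<rho>s: "\<rho> \<le> s" using \<rho>\<rho>' \<rho>'s by linarith
    have s1: "s \<le> 1" using s2 by simp
    note F = pullback_of_prime_factor[OF p0 k1 \<rho>0 \<rho>s s1 nz]
    have kK: "real_of_int k \<le> N powr 3" "real_of_int l \<le> N powr 3" using kl IN by auto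
    have lnkl: "ln (real_of_int (k + l)) \<le> \<Lambda>"
    proof (rule ln_le)
      show "0 < real_of_int (k + l)" using k1 by simp
      show "real_of_int (k + l) \<le> D * N powr 3" using kK DN unfolding of_int_add by linarith
    qed
    have lnx: "ln (1 + cmod (of_int k * \<xi>' + of_int l)) \<le> \<Lambda>"
    proof (rule ln_le)
      have "cmod (of_int k * \<xi>' + of_int l) \<le> cmod (of_int k * \<xi>') + cmod (of_int l)" by (rule norm_triangle_ineq)
      also have "\<dots> = real_of_int k * cmod \<xi>' + real_of_int l" using k1 by (simp add: norm_mult)
      also have "\<dots> \<le> N powr 3 * cmod \<xi>' + N powr 3" using kK by (intro add_mono mult_right_mono) auto
      finally have "1 + cmod (of_int k * \<xi>' + of_int l) \<le> N powr 3 + (N powr 3 * cmod \<xi>' + N powr 3)" using pow1[of 3] by simp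
      also have "\<dots> = (2 + cmod \<xi>') * N powr 3" by (simp add: algebra_simps)
      also have "\<dots> \<le> D * N powr 3"
      proof (intro mult_right_mono)
        show "2 + cmod \<xi>' \<le> D" using D(2) norm_ge_zero[of \<xi>'] unfolding distrib_left by linarith
      qed simp
      finally show "1 + cmod (of_int k * \<xi>' + of_int l) \<le> D * N powr 3" .
    qed (simp add: add_pos_nonneg)
    define dd where "dd = real (degree p)"
    have dd: "0 \<le> dd" "dd \<le> 128 * N powr (1 - S)" "dd * ln (real_of_int (k + l)) \<le> dd * \<Lambda>"
      "dd * ln (1 + cmod (of_int k * \<xi>' + of_int l)) \<le> dd * \<Lambda>"
      using dp lnkl lnx by (auto simp: dd_def intro: mult_left_mono)
    have htF: "ht ?F \<le> ht p + dd * \<Lambda>" using F(3) dd(3) unfolding dd_def by linarith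
    have htFh: "ht ?F \<le> N powr h"
    proof -
      have "dd * \<Lambda> \<le> 128 * N powr (1 - S) * \<Lambda>" using dd(2) \<Lambda>0' by (rule mult_right_mono)
      then show ?thesis using htF hp e9(1,2) by linarith
    qed
    have degF: "real (degree ?F) \<le> N powr d" using F(2) dp e8 by simp
    have Xd: "N powr x * (degree ?F / N powr d + ht ?F / N powr h) = dd * N powr (x - d) + N powr (x - h) * ht ?F"
      using F(2) by (simp add: dd_def distrib_left powr_diff)
    also have "N powr (x - h) * ht ?F \<le> N powr (x - h) * (ht p + dd * \<Lambda>)" using htF by (intro mult_left_mono) auto
    finally have up: "N powr x * (degree ?F / N powr d + ht ?F / N powr h) \<le> dd * N powr (x - d) + N powr (x - h) * ht p + dd * (N powr (x - h) * \<Lambda>)"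
      by (simp add: algebra_simps)
    have Va: "V / (16 * N) = N powr (\<nu> - 1) / 16" "V / (32 * N powr \<beta>) = N powr (\<nu> - \<beta>) / 32"
      using N0 by (simp_all add: V_def powr_diff)
    \<comment> \<open>Three quantities, each at most N^(\<nu> - 1) / 48, share the degree weight
      N^(\<nu> - 1) / 16. In the same way two quantities share the height weight N^(\<nu> - \<beta>)
      / 32 below.\<close>
    have "dd * (\<Lambda> + N powr (x - d) + N powr (x - h) * \<Lambda>) \<le> dd * (N powr (\<nu> - 1) / 16)"
      using dd(1) e10 by (intro mult_left_mono) auto
    then have "dd * \<Lambda> + dd * N powr (x - d) + dd * (N powr (x - h) * \<Lambda>) \<le> V / (16 * N) * degree p"
      unfolding Va dd_def by (simp add: algebra_simps)
    moreover have "(1 + N powr (x - h)) * ht p \<le> N powr (\<nu> - \<beta>) / 32 * ht p"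
      using hp0 e11 by (intro mult_right_mono) auto
    then have "ht p + N powr (x - h) * ht p \<le> V / (32 * N powr \<beta>) * ht p"
      unfolding Va by (simp add: algebra_simps)
    moreover have "pot s \<rho> (of_int k * \<xi>' + of_int l) p - ht p - dd * ln (1 + cmod (of_int k * \<xi>' + of_int l))
      \<le> - ln (cmod (poly (of_int_poly ?F) \<xi>'))" using F(4) by (simp only: dd_def)
    ultimately have "N powr x * (degree ?F / N powr d + ht ?F / N powr h) < - ln (cmod (poly (of_int_poly ?F) \<xi>'))"
      using up potp dd(4) by linarith
    then show ?thesis using F(1) degF htFh by blast
  qed
qed

section \<open>Growth comparisons and the final choice of exponents\<close>

lemma eventually_powr_le:
  assumes "y < z"
  shows "\<forall>\<^sub>F n in sequentially. C * real n powr y \<le> real n powr z"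
proof -
  have "filterlim (\<lambda>n. real n powr (z - y)) at_top sequentially" using assms by real_asymp
  then have "\<forall>\<^sub>F n in sequentially. C \<le> real n powr (z - y)" unfolding filterlim_at_top by blast
  then show ?thesis using eventually_gt_at_top[of 0]
  proof eventually_elim
    case (elim n)
    have "C * real n powr y \<le> real n powr (z - y) * real n powr y" using elim by (intro mult_right_mono) auto
    then show ?case by (simp flip: powr_add)
  qed
qed

lemma eventually_powr_ln_le:
  assumes "y < z" "0 < D"
  shows "\<forall>\<^sub>F n in sequentially. C * (real n powr y * ln (D * real n powr 3)) \<le> real n powr z"
proof -
  define \<delta> where "\<delta> = z - y"
  have \<delta>: "0 < \<delta>" using assms by (simp add: \<delta>_def)
  have "(\<lambda>n. C * ln (D * real n powr 3) / real n powr \<delta>) \<longlonglongrightarrow> 0"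
    using \<delta> assms(2) by real_asymp
  then have "\<forall>\<^sub>F n in sequentially. C * ln (D * real n powr 3) / real n powr \<delta> < 1"
    by (rule order_tendstoD) simp
  then show ?thesis using eventually_gt_at_top[of 0]
  proof eventually_elim
    case (elim n)
    then have "C * ln (D * real n powr 3) \<le> real n powr \<delta>" by (simp add: divide_less_eq)
    then have "real n powr y * (C * ln (D * real n powr 3)) \<le> real n powr y * real n powr \<delta>"
      by (intro mult_left_mono) auto
    then show ?case by (simp add: \<delta>_def mult_ac flip: powr_add)
  qed
qed

theorem theorem5p3:
  fixes \<xi> :: complex and r :: rat and \<beta> \<sigma>\<^sub>1 \<sigma>\<^sub>2 \<tau> \<nu> :: real
  assumes "\<not> algebraic \<xi>"
    and "r \<noteq> 0"
    and "0 \<le> \<beta>" "0 \<le> \<sigma>\<^sub>1" "0 \<le> \<sigma>\<^sub>2" "0 \<le> \<tau>" "0 \<le> \<nu>"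
    and "\<beta> > 1"
    and "\<sigma>\<^sub>1 \<le> 3 * \<sigma>\<^sub>2"
    and "(1/3) * \<sigma>\<^sub>1 + \<sigma>\<^sub>2 + \<tau> < 1"
    and "\<nu> > 1 + \<beta> - (1/3) * \<sigma>\<^sub>1 - \<sigma>\<^sub>2 - \<tau>"
  shows "\<forall>N::nat. \<exists>n\<ge>N. \<not> (\<exists>P :: int poly. P \<noteq> 0 \<and> degree P \<le> n \<and>
    real_of_rat (poly_height (map_poly of_int P)) \<le> exp (real n powr \<beta>) \<and>
    Max {cmod (poly (divided_pderiv j (map_poly of_int P)) (of_int i\<^sub>1 * \<xi> + of_int i\<^sub>2 * of_rat r))
          | (i\<^sub>1 :: int) (i\<^sub>2 :: int) (j :: nat).
            1 \<le> i\<^sub>1 \<and> real_of_int i\<^sub>1 \<le> real n powr \<sigma>\<^sub>1 \<and>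
            1 \<le> i\<^sub>2 \<and> real_of_int i\<^sub>2 \<le> real n powr \<sigma>\<^sub>2 \<and>
            real j \<le> real n powr \<tau>}
      \<le> exp (- (real n powr \<nu>)))"
proof (rule ccontr)
  let ?H = "\<lambda>n P. real_of_rat (poly_height (map_poly of_int P)) \<le> exp (real n powr \<beta>)"
  let ?M = "\<lambda>n P. Max {cmod (poly (divided_pderiv j (map_poly of_int P)) (of_int i\<^sub>1 * \<xi> + of_int i\<^sub>2 * of_rat r))
          | (i\<^sub>1 :: int) (i\<^sub>2 :: int) (j :: nat).
            1 \<le> i\<^sub>1 \<and> real_of_int i\<^sub>1 \<le> real n powr \<sigma>\<^sub>1 \<and>
            1 \<le> i\<^sub>2 \<and> real_of_int i\<^sub>2 \<le> real n powr \<sigma>\<^sub>2 \<and>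
            real j \<le> real n powr \<tau>} \<le> exp (- (real n powr \<nu>))"
  assume "\<not> ?thesis"
  then obtain N0 where N0: "\<exists>P :: int poly. P \<noteq> 0 \<and> degree P \<le> n \<and> ?H n P \<and> ?M n P" if "N0 \<le> n" for n
    by blast
  define S \<eta> \<epsilon> where "S = \<sigma>\<^sub>1 / 3 + \<sigma>\<^sub>2 + \<tau>" and "\<eta> = \<nu> - 1 - \<beta> + S" and "\<epsilon> = \<eta> / 8"
  \<comment> \<open>d and h are the exponents 1 - S and \<beta> - S of the heavy factor, enlarged by
    \<epsilon> to absorb constants and logarithms, and x exceeds d + h by \<epsilon>. \<kappa> lies
    above x - d = \<beta> - S + 2 \<epsilon> and x - h = 1 - S + 2 \<epsilon>, and 1 + \<kappa>
    below \<nu>.\<close>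
  define d h x \<kappa> where "d = 1 - S + \<epsilon>" and "h = \<beta> - S + \<epsilon>" and "x = 1 + \<beta> - 2 * S + 3 * \<epsilon>" and "\<kappa> = \<beta> - S + 4 * \<epsilon>"
  have \<nu>: "\<nu> = 1 + \<beta> - S + 8 * \<epsilon>" proof -
    have "8 * \<epsilon> = \<eta>" by (simp add: \<epsilon>_def)
    then show ?thesis using \<eta>_def by linarith
  qed
  have S: "0 \<le> S" "S < 1" "\<tau> \<le> S" and \<epsilon>: "0 < \<epsilon>"
    using assms by (auto simp: S_def \<epsilon>_def \<eta>_def)
  note defs = d_def h_def x_def \<kappa>_def \<nu>
  define \<xi>' where "\<xi>' = \<xi> / of_rat r"
  define R where "R = real_of_int (snd (quotient_of r))"
  define c1 where "c1 = max 1 (real_of_rat \<bar>r\<bar>)"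
  define D where "D = 2 * (1 + cmod \<xi> + c1) + 2 * (1 + cmod \<xi>')"
  have c1: "1 \<le> c1" by (simp add: c1_def)
  have D1: "2 * (1 + cmod \<xi> + c1) \<le> D" "2 * (1 + cmod \<xi>') \<le> D"
    using c1 by (simp_all add: D_def add_nonneg_nonneg)
  have D: "0 < D" using D1(2) norm_ge_zero[of \<xi>'] unfolding distrib_left by linarith
  let ?L = "\<lambda>n. ln (D * real n powr 3)"
  note pe = eventually_powr_le and le = eventually_powr_ln_le[OF _ D]
  have e3: "\<forall>\<^sub>F n in sequentially. 2 * real n powr \<kappa> \<le> real n powr (\<nu> - \<tau>)"
    by (insert assms(8) S \<epsilon>, (rule pe le; simp add: defs)+)
  \<comment> \<open>The factor \<open>real n powr 0\<close> gives the inequality the form of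
    \<open>eventually_powr_ln_le\<close>; \<open>n1\<close> removes it below.\<close>
  have e4: "\<forall>\<^sub>F n in sequentially. 2 * (real n powr 0 * ?L n) \<le> real n powr (\<nu> - \<tau>)"
    by (insert assms(8) S \<epsilon>, (rule pe le; simp add: defs)+)
  have e5: "\<forall>\<^sub>F n in sequentially. 16 * real n powr (1 + \<kappa>) \<le> real n powr \<nu>"
    "\<forall>\<^sub>F n in sequentially. 16 * (ln 2 + ln R) * real n powr 1 \<le> real n powr \<nu>"
    "\<forall>\<^sub>F n in sequentially. 64 * (real n powr 1 * ?L n) \<le> real n powr \<nu>"
    "\<forall>\<^sub>F n in sequentially. 16 * real n powr \<beta> \<le> real n powr \<nu>"
    by (insert assms(8) S \<epsilon>, (rule pe le; simp add: defs)+)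
  have e6: "\<forall>\<^sub>F n in sequentially. 4 * (real n powr 1 * ?L n) \<le> real n powr \<beta>"
    "\<forall>\<^sub>F n in sequentially. 2 * (ln 4 + ln R + ln c1) * real n powr 1 \<le> real n powr \<beta>"
    by (insert assms(8) S \<epsilon>, (rule pe le; simp add: defs)+)
  have e7: "\<forall>\<^sub>F n in sequentially. 4096 * real n powr (1 + \<beta>) \<le> real n powr (\<nu> + S)"
    by (insert assms(8) S \<epsilon>, (rule pe le; simp add: defs)+)
  have e8: "\<forall>\<^sub>F n in sequentially. 128 * real n powr (1 - S) \<le> real n powr d"
    by (insert assms(8) S \<epsilon>, (rule pe le; simp add: defs)+)
  have e9: "\<forall>\<^sub>F n in sequentially. 512 * real n powr (\<beta> - S) \<le> real n powr h"
    "\<forall>\<^sub>F n in sequentially. 256 * (real n powr (1 - S) * ?L n) \<le> real n powr h"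
    "\<forall>\<^sub>F n in sequentially. 1 * (real n powr 0 * ?L n) \<le> real n powr (\<beta> - S)"
    by (insert assms(8) S \<epsilon>, (rule pe le; simp add: defs)+)
  have e10: "\<forall>\<^sub>F n in sequentially. 48 * (real n powr 0 * ?L n) \<le> real n powr (\<nu> - 1)"
    "\<forall>\<^sub>F n in sequentially. 48 * real n powr (x - d) \<le> real n powr (\<nu> - 1)"
    "\<forall>\<^sub>F n in sequentially. 48 * (real n powr (x - h) * ?L n) \<le> real n powr (\<nu> - 1)"
    by (insert assms(8) S \<epsilon>, (rule pe le; simp add: defs)+)
  have e11: "\<forall>\<^sub>F n in sequentially. 64 * real n powr 0 \<le> real n powr (\<nu> - \<beta>)"
    "\<forall>\<^sub>F n in sequentially. 64 * real n powr (x - h) \<le> real n powr (\<nu> - \<beta>)"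
    by (insert assms(8) S \<epsilon>, (rule pe le; simp add: defs)+)
  have e12: "\<forall>\<^sub>F n in sequentially. 4 * real n powr 0 \<le> real n powr \<kappa>"
    "\<forall>\<^sub>F n in sequentially. 4 * real n powr (x - d) \<le> real n powr \<kappa>"
    "\<forall>\<^sub>F n in sequentially. 4 * (real n powr (x - h) * ?L n) \<le> real n powr \<kappa>"
    by (insert assms(8) S \<epsilon>, (rule pe le; simp add: defs)+)
  show False
  proof (rule gelfond_criterion)
    show "\<not> algebraic \<xi>'" unfolding \<xi>'_def using assms(1,2) by (rule not_algebraic_div_rat)
    show "0 < d" "d \<le> h" "d + h < x" using S \<epsilon> assms(8) by (auto simp: defs)
    show "\<forall>\<^sub>F n in sequentially. \<exists>F :: int poly. F \<noteq> 0 \<and> degree F \<le> real n powr d \<and> ht F \<le> real n powr h \<and>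
      real n powr x * (degree F / real n powr d + ht F / real n powr h) < - ln (cmod (poly (of_int_poly F) \<xi>'))"
      using e3 e4 e5 e6 e7 e8 e9 e10 e11 e12 eventually_ge_at_top[of N0] eventually_ge_at_top[of 1]
    proof eventually_elim
      case (elim n)
      then have n: "N0 \<le> n" "1 \<le> n" by auto
      have n1: "real n powr 1 = real n" "real n powr 0 = 1" using n by auto
      note E = elim[unfolded n1 mult_1 mult_1_right S_def R_def c1_def]
      obtain P where P: "P \<noteq> 0" "degree P \<le> n" "?H n P" "?M n P" using N0[OF n(1)] by blast
      obtain Q where Q: "Q \<noteq> 0" "degree Q = degree P" "\<And>i. \<bar>real_of_int (coeff Q i)\<bar> \<le> exp (real n powr \<beta>)"
        "\<And>j y. cmod (poly (divided_pderiv j (of_int_poly Q)) y) \<le> cmod (poly (divided_pderiv j (of_int_poly P)) y)"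
        using primitive_witness[OF P(1,3)] by blast
      have small: "cmod (poly (divided_pderiv k (of_int_poly Q)) (of_int i * \<xi> + of_int j * of_rat r)) \<le> exp (- (real n powr \<nu>))"
        if "1 \<le> i" "real_of_int i \<le> real n powr \<sigma>\<^sub>1" "1 \<le> j" "real_of_int j \<le> real n powr \<sigma>\<^sub>2" "real k \<le> real n powr \<tau>" for i j k
        using Q(4) le_if_Max_le[where f = "\<lambda>i j k. cmod (poly (divided_pderiv k (of_int_poly P)) (of_int i * \<xi> + of_int j * of_rat r))", OF P(4) that]
          order_trans by blast
      show ?case
        unfolding \<xi>'_def
      proof (rule gelfond_polynomial_exists[where P = Q and \<beta> = \<beta> and ?\<sigma>1.0 = \<sigma>\<^sub>1 and ?\<sigma>2.0 = \<sigma>\<^sub>2 and \<tau> = \<tau> and \<nu> = \<nu> and \<kappa> = \<kappa> and D = D])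
        show "degree Q \<le> n" using P(2) Q(2) by simp
        show "\<sigma>\<^sub>1 / 3 + \<sigma>\<^sub>2 + \<tau> < 1" using S(2) by (simp add: S_def)
        show "0 < d" using S \<epsilon> assms(8) by (auto simp: defs)
      qed (fact E assms D1[unfolded c1_def] D1[unfolded \<xi>'_def] n small Q(1,3))+
    qed
  qed
qed

end
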